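(* Fix a constant $\delta>0$. Let $k=k(n)$ satisfy $k=o(n)$ and $k=\omega((\log n)^{3/2})$, and let $N(\mathbf L)$ be the number of intercalates in a uniformly random $k\times n$ Latin rectangle $\mathbf L$. Then, as $n\to\infty$, \[\Pr\left[N(\mathbf L)\ge(1+\delta)\frac{k^2}{4}\right]=\exp\left(-(1+o(1))\,\Phi\!\left(\delta\frac{k^2}{4}\right)\log n\right).\]
   Context: A $k\times n$ Latin rectangle is a $k\times n$ array, every cell of which is filled with a symbol from $\{1,\dots,n\}$, such that every symbol appears at most once in each row and in each column. A partial Latin square is an array (of any finite dimensions) in which some cells are filled with symbols, such that no symbol appears more than once in any row or column. An intercalate in a (partial) array $L$ is a pair of rows $i<j$ and a pair of columns $x<y$ such that the four cells $(i,x),(i,y),(j,x),(j,y)$ are all filled and $L_{i,x}=L_{j,y}$, $L_{i,y}=L_{j,x}$. For a real number $N$, $\Phi(N)$ denotes the minimum number of nonempty cells in a partial Latin square with at least $N$ intercalates. *)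

theory Defs
  imports "HOL-Probability.Probability" "HOL-Library.Landau_Symbols"
begin

text \<open>
  An array is a partial map from cells (row, column) to symbols; its domain is the set of
  filled (nonempty) cells. Rows, columns and the symbols of a Latin rectangle are numbered from 1.
\<close>

type_synonym partial_array = "nat \<times> nat \<rightharpoonup> nat"

text \<open>
  An \<open>a \<times> b\<close> partial Latin square. The set of available symbols is not restricted; since
  only finitely many cells are filled, taking natural numbers as symbols loses nothing.
\<close>

definition partial_latin_square :: "nat \<Rightarrow> nat \<Rightarrow> partial_array \<Rightarrow> bool" where
  "partial_latin_square a b L \<longleftrightarrow>
     dom L \<subseteq> {1..a} \<times> {1..b} \<and>
     (\<forall>i x y s. L (i, x) = Some s \<and> L (i, y) = Some s \<longrightarrow> x = y) \<and>
     (\<forall>i j x s. L (i, x) = Some s \<and> L (j, x) = Some s \<longrightarrow> i = j)"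

definition latin_rectangles :: "nat \<Rightarrow> nat \<Rightarrow> partial_array set" where
  "latin_rectangles k n =
     {L. partial_latin_square k n L \<and> dom L = {1..k} \<times> {1..n} \<and> ran L \<subseteq> {1..n}}"

definition intercalates :: "partial_array \<Rightarrow> (nat \<times> nat \<times> nat \<times> nat) set" where
  "intercalates L =
     {(i, j, x, y). i < j \<and> x < y \<and>
        {(i, x), (i, y), (j, x), (j, y)} \<subseteq> dom L \<and>
        L (i, x) = L (j, y) \<and> L (i, y) = L (j, x)}"

definition num_intercalates :: "partial_array \<Rightarrow> nat" where
  "num_intercalates L = card (intercalates L)"

text \<open>
  The minimum is over a nonempty set for every \<open>N\<close>: a partial Latin square can contain
  arbitrarily many pairwise disjoint intercalates.
\<close>

definition Phi :: "real \<Rightarrow> nat" where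
  "Phi N = (LEAST m. \<exists>a b L. partial_latin_square a b L \<and>
                       real (num_intercalates L) \<ge> N \<and> m = card (dom L))"

text \<open>
  For \<open>k \<le> n\<close> the set of Latin rectangles is finite and nonempty, so this is the uniform
  distribution; for \<open>k > n \<ge> 1\<close> there are no Latin rectangles and the value is unspecified.
\<close>

definition random_latin_rectangle :: "nat \<Rightarrow> nat \<Rightarrow> partial_array pmf" where
  "random_latin_rectangle k n = pmf_of_set (latin_rectangles k n)"

end

theory Submission
  imports Defs "HOL-Real_Asymp.Real_Asymp"
begin

text \<open>
  Write \<open>\<mu> = k\<^sup>2 / 4\<close> for the typical number of intercalates.

  Switchings inside a single row (transpositions and 3-cycles of its entries) show that prescribing
  one more cell of a random \<open>k \<times> n\<close> Latin rectangle costs a factor of about \<open>1 / n\<close>, even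
  when many cells are already prescribed.

  For the lower bound, plant an optimal partial Latin square with \<open>(\<delta> + 2\<epsilon>)\<mu>\<close> intercalates. After
  deleting its sparse rows, columns and symbols it occupies \<open>O(k\<^sup>2\<^sup>/\<^sup>3)\<close> rows and columns, and outside them the
  conditional expected number of intercalates is still \<open>(1 - o(1))\<mu>\<close>. Since that number is trivially
  at most \<open>k\<^sup>2n\<^sup>2\<close>, it is at least \<open>(1 - \<epsilon>)\<mu>\<close> with conditional probability polynomial in \<open>1 / n\<close>, which is
  negligible against \<open>n\<close> to the power \<open>-\<Phi>\<close>.

  For the upper bound, follow the moment method of Harel, Mousset and Samotij. A seed is a partial
  array with \<open>O(\<Phi> log n)\<close> cells and at least \<open>(\<delta> - 2\<epsilon>)\<mu>\<close> intercalates. Conditioning on any non-seed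
  leaves the expected number of intercalates below \<open>(1 + \<delta> - \<epsilon>)\<mu>\<close>, so a moment of order \<open>O(\<Phi> log n)\<close>
  rules out a large count in the absence of seeds. A seed contains a core, all of whose cells lie in
  at least \<open>\<beta>\<close> intercalates of the core, where \<open>\<beta>\<close> tends to infinity because \<open>k\<close> exceeds
  \<open>(log n)\<^sup>3\<^sup>/\<^sup>2\<close>. Up to few exceptional cells a core is recovered from a sparse random
  subset of itself by completing three corners of an intercalate to the fourth, so there are only
  \<open>n\<close> to the power \<open>o(m)\<close> cores with \<open>m\<close> cells, and a union bound over cores suffices.
\<close>

section \<open>Partial Latin squares and \<open>Phi\<close>\<close>

text \<open>The order \<open>k^(4/3)\<close> of \<Phi> fixes all scales. A seed has
  \<open>s = O(k^(4/3) log n)\<close> cells, so deleting cells that lie in fewer than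
  \<open>\<beta> = \<epsilon> \<mu> / s\<close> intercalates costs at most
  \<open>\<epsilon> \<mu>\<close>, and \<open>\<beta>\<close> has order
  \<open>k^(2/3) / log n\<close>: this is the origin of the exponent 3/2. Two obstacles shape the
  upper bound. A seed may have more than \<open>n\<close> cells, and the cost \<open>1 / n\<close>
  fails in rows that it nearly fills. Such rows are few, and a crude count of the intercalates in
  them suffices, as \<open>s^2 / n\<close> is small against \<open>k^2\<close>. Moreover a core with
  \<open>m\<close> cells has probability about \<open>n^(-m)\<close>, so the enumeration may cost
  only \<open>n^o(1)\<close> per cell. The entries that the sparse subset completes in many ways
  number at most \<open>m\<close> times a power of \<open>log n\<close>, because
  \<open>s / \<beta>^2\<close> has order \<open>(log n)^3\<close>, so choosing among them is cheap.
  Switchings stay in one row because the other rows block only about \<open>2 k\<close> of its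
  \<open>n\<close> positions. Losing \<open>\<epsilon> \<mu>\<close> intercalates is harmless since
  \<Phi> is subadditive and \<open>\<Phi>(\<epsilon> \<mu>)\<close> is a small fraction of
  \<open>\<Phi>(\<delta> \<mu>)\<close>.\<close>

definition latin :: "partial_array \<Rightarrow> bool" where
  "latin P \<longleftrightarrow> finite (dom P) \<and>
     (\<forall>i x y s. P (i, x) = Some s \<and> P (i, y) = Some s \<longrightarrow> x = y) \<and>
     (\<forall>i j x s. P (i, x) = Some s \<and> P (j, x) = Some s \<longrightarrow> i = j)"

definition row_size :: "partial_array \<Rightarrow> nat \<Rightarrow> nat" where
  "row_size P i = card {x. (i, x) \<in> dom P}"

definition col_size :: "partial_array \<Rightarrow> nat \<Rightarrow> nat" where
  "col_size P x = card {i. (i, x) \<in> dom P}"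

definition sym_size :: "partial_array \<Rightarrow> nat \<Rightarrow> nat" where
  "sym_size P s = card {c. P c = Some s}"

text \<open>Intercalates through a cell, indexed by the corner diagonally opposite to it. Neither
  rows nor columns are ordered here, so the given cell may be any of the four corners;
  \<open>sort_quad\<close> restores the order that \<open>intercalates\<close> demands.\<close>

definition opposite :: "partial_array \<Rightarrow> nat \<times> nat \<Rightarrow> (nat \<times> nat) set" where
  "opposite P = (\<lambda>(i, x). {(j, y). j \<noteq> i \<and> y \<noteq> x \<and>
     {(i, x), (i, y), (j, x), (j, y)} \<subseteq> dom P \<and> P (i, x) = P (j, y) \<and> P (i, y) = P (j, x)})"

definition quad_cells :: "nat \<times> nat \<times> nat \<times> nat \<Rightarrow> (nat \<times> nat) set" where
  "quad_cells = (\<lambda>(i, j, x, y). {(i, x), (i, y), (j, x), (j, y)})"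

definition sort_quad :: "nat \<times> nat \<times> nat \<times> nat \<Rightarrow> nat \<times> nat \<times> nat \<times> nat" where
  "sort_quad = (\<lambda>(a, b, u, v). (min a b, max a b, min u v, max u v))"

lemma latinD_finite: "latin P \<Longrightarrow> finite (dom P)"
  by (simp add: latin_def)

lemma latinD_row: "latin P \<Longrightarrow> P (i, x) = Some s \<Longrightarrow> P (i, y) = Some s \<Longrightarrow> x = y"
  by (metis latin_def)

lemma latinD_col: "latin P \<Longrightarrow> P (i, x) = Some s \<Longrightarrow> P (j, x) = Some s \<Longrightarrow> i = j"
  by (metis latin_def)


lemma partial_latin_square_imp_latin: "partial_latin_square a b P \<Longrightarrow> latin P"
  unfolding partial_latin_square_def latin_def
  using finite_subset[of "dom P" "{1..a} \<times> {1..b}"] by simp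

lemma latin_partial_latin_square:
  "latin P \<Longrightarrow> dom P \<subseteq> {1..a} \<times> {1..b} \<Longrightarrow> partial_latin_square a b P"
  unfolding partial_latin_square_def latin_def by simp

lemma map_le_SomeD: "P \<subseteq>\<^sub>m Q \<Longrightarrow> P c = Some s \<Longrightarrow> Q c = Some s"
  by (metis domI map_le_def)

lemma restrict_map_le: "P |` D \<subseteq>\<^sub>m P"
  by (simp add: map_le_def)

lemma latin_map_le: "latin Q \<Longrightarrow> P \<subseteq>\<^sub>m Q \<Longrightarrow> latin P"
  using latinD_row[of Q] latinD_col[of Q] unfolding latin_def[of P]
  by (meson finite_subset latinD_finite map_le_SomeD map_le_implies_dom_le)

lemma latin_restrict: "latin P \<Longrightarrow> latin (P |` D)"
  using latin_map_le restrict_map_le by blast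

lemma intercalates_mono:
  assumes "P \<subseteq>\<^sub>m Q" shows "intercalates P \<subseteq> intercalates Q"
proof clarify
  fix i j x y assume q: "(i, j, x, y) \<in> intercalates P"
  then have "{(i, x), (i, y), (j, x), (j, y)} \<subseteq> dom P" by (simp add: intercalates_def)
  then have "Q (i, x) = P (i, x)" "Q (i, y) = P (i, y)" "Q (j, x) = P (j, x)" "Q (j, y) = P (j, y)"
    using assms unfolding map_le_def by simp_all
  with q show "(i, j, x, y) \<in> intercalates Q"
    unfolding intercalates_def by (simp add: dom_def)
qed

lemma finite_intercalates [simp]: "finite (dom P) \<Longrightarrow> finite (intercalates P)"
proof -
  assume f: "finite (dom P)"
  have "intercalates P \<subseteq> (\<lambda>((i, x), (j, y)). (i, j, x, y)) ` (dom P \<times> dom P)"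
    unfolding intercalates_def by force
  with f show ?thesis by (meson finite_SigmaI finite_imageI finite_subset)
qed

lemma intercalates_restrict:
  "q \<in> intercalates (P |` D) \<longleftrightarrow> q \<in> intercalates P \<and> quad_cells q \<subseteq> D"
  unfolding intercalates_def quad_cells_def by (auto simp: restrict_map_def dom_def split: if_splits)

lemma finite_opposite: "finite (dom P) \<Longrightarrow> finite (opposite P c)"
  by (rule finite_subset[of _ "dom P"]) (auto simp: opposite_def)

lemma opposite_sort_quad:
  "(j, y) \<in> opposite P (i, x) \<Longrightarrow> sort_quad (i, j, x, y) \<in> intercalates P"
  unfolding opposite_def
  by (cases "i \<le> j"; cases "x \<le> y") (auto simp: sort_quad_def intercalates_def)

text \<open>Column \<open>y\<close> holds the symbol of \<open>(i, x)\<close> at most once, so the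
  opposite cell is determined by its column \<open>y\<close>, and \<open>(i, y)\<close> is a filled
  cell of row \<open>i\<close>. The next two bounds do the same for columns and symbols; together
  they say that a cell in a small row, column or symbol class lies in few intercalates.\<close>

lemma card_opposite_le_row:
  assumes "latin P" shows "card (opposite P (i, x)) \<le> row_size P i"
proof -
  have "finite {y. (i, y) \<in> dom P}"
    by (rule finite_subset[of _ "snd ` dom P"]) (use assms latinD_finite in force)+
  moreover have "inj_on snd (opposite P (i, x))"
    unfolding opposite_def inj_on_def using latinD_col[OF assms] by (fastforce simp: dom_def)
  moreover have "snd ` opposite P (i, x) \<subseteq> {y. (i, y) \<in> dom P}"
    unfolding opposite_def by auto
  ultimately show ?thesis unfolding row_size_def by (rule card_inj_on_le[rotated 2]) 
qed

lemma card_opposite_le_col: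
  assumes "latin P" shows "card (opposite P (i, x)) \<le> col_size P x"
proof -
  have "finite {j. (j, x) \<in> dom P}"
    by (rule finite_subset[of _ "fst ` dom P"]) (use assms latinD_finite in force)+
  moreover have "inj_on fst (opposite P (i, x))"
    unfolding opposite_def inj_on_def using latinD_row[OF assms] by (fastforce simp: dom_def)
  moreover have "fst ` opposite P (i, x) \<subseteq> {j. (j, x) \<in> dom P}"
    unfolding opposite_def by auto
  ultimately show ?thesis unfolding col_size_def by (rule card_inj_on_le[rotated 2])
qed

lemma card_opposite_le_sym:
  assumes "latin P" "P (i, x) = Some s" shows "card (opposite P (i, x)) \<le> sym_size P s"
proof -
  have "finite {c. P c = Some s}"
    by (rule finite_subset[of _ "dom P"]) (use assms latinD_finite in auto)
  moreover have "opposite P (i, x) \<subseteq> {c. P c = Some s}"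
    unfolding opposite_def using assms(2) by auto
  ultimately show ?thesis unfolding sym_size_def by (rule card_mono)
qed

lemma card_intercalates_through:
  assumes "finite (dom P)"
  shows "card {q \<in> intercalates P. c \<in> quad_cells q} \<le> card (opposite P c)"
proof -
  obtain a u where c: "c = (a, u)" by (cases c)
  have "q \<in> (\<lambda>(j, y). sort_quad (a, j, u, y)) ` opposite P c"
    if q: "q \<in> intercalates P" "c \<in> quad_cells q" for q
  proof -
    obtain i j x y where [simp]: "q = (i, j, x, y)" by (cases q)
    let ?p = "(if a = i then j else i, if u = x then y else x)"
    have p: "?p \<in> opposite P c"
      using q unfolding c opposite_def intercalates_def quad_cells_def by auto
    have "q = (\<lambda>(j, y). sort_quad (a, j, u, y)) ?p"
      using q unfolding c intercalates_def quad_cells_def sort_quad_def by auto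
    then show ?thesis using p by (rule image_eqI)
  qed
  then have "{q \<in> intercalates P. c \<in> quad_cells q} \<subseteq> (\<lambda>(j, y). sort_quad (a, j, u, y)) ` opposite P c"
    by blast
  then show ?thesis
    by (meson assms card_image_le card_mono finite_imageI finite_opposite le_trans)
qed

lemma num_intercalates_remove:
  assumes "finite (dom P)" "finite X"
  shows "num_intercalates P \<le> num_intercalates (P |` (-X)) + (\<Sum>c\<in>X. card (opposite P c))"
proof -
  have "intercalates P \<subseteq> intercalates (P |` (-X)) \<union> (\<Union>c\<in>X. {q \<in> intercalates P. c \<in> quad_cells q})"
    by (auto simp: intercalates_restrict)
  then have "num_intercalates P \<le> card (intercalates (P |` (-X)) \<union> (\<Union>c\<in>X. {q \<in> intercalates P. c \<in> quad_cells q}))"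
    unfolding num_intercalates_def using assms by (intro card_mono) auto
  also have "\<dots> \<le> num_intercalates (P |` (-X)) + card (\<Union>c\<in>X. {q \<in> intercalates P. c \<in> quad_cells q})"
    unfolding num_intercalates_def by (rule card_Un_le)
  also have "card (\<Union>c\<in>X. {q \<in> intercalates P. c \<in> quad_cells q}) \<le> (\<Sum>c\<in>X. card {q \<in> intercalates P. c \<in> quad_cells q})"
    using assms by (intro card_UN_le)
  also have "\<dots> \<le> (\<Sum>c\<in>X. card (opposite P c))"
    by (intro sum_mono card_intercalates_through assms)
  finally show ?thesis by simp
qed

lemma intercalates_empty [simp]: "intercalates Map.empty = {}"
  by (auto simp: intercalates_def)

lemma num_intercalates_le_sum_opposite:
  assumes "finite (dom P)"
  shows "num_intercalates P \<le> (\<Sum>c\<in>dom P. card (opposite P c))"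
proof -
  have "P |` (- dom P) = Map.empty" by (auto simp: restrict_map_def fun_eq_iff)
  with num_intercalates_remove[OF assms assms] show ?thesis by (simp add: num_intercalates_def)
qed

section \<open>Pruning and the 3/2-power bound\<close>

lemma card_large_fibres:
  fixes \<theta> :: real
  assumes "finite D" "A \<subseteq> f ` D" "\<And>a. a \<in> A \<Longrightarrow> \<theta> \<le> card {c \<in> D. f c = a}"
  shows "\<theta> * card A \<le> card D"
proof -
  have fA: "finite A" using assms finite_subset by blast
  have "\<theta> * card A = (\<Sum>a\<in>A. \<theta>)" by simp
  also have "\<dots> \<le> (\<Sum>a\<in>A. real (card {c \<in> D. f c = a}))"
    by (rule sum_mono) (use assms in auto)
  also have "\<dots> = card (\<Union>a\<in>A. {c \<in> D. f c = a})"
    by (subst card_UN_disjoint) (use fA assms in auto)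
  also have "\<dots> \<le> card D" using assms by (intro of_nat_mono card_mono) auto
  finally show ?thesis .
qed

lemma row_size_fibre: "row_size P i = card {c \<in> dom P. fst c = i}"
proof -
  have "{c \<in> dom P. fst c = i} = Pair i ` {x. (i, x) \<in> dom P}" by force
  then show ?thesis by (simp add: row_size_def card_image inj_on_def)
qed

lemma col_size_fibre: "col_size P x = card {c \<in> dom P. snd c = x}"
proof -
  have "{c \<in> dom P. snd c = x} = (\<lambda>i. (i, x)) ` {i. (i, x) \<in> dom P}" by force
  then show ?thesis by (simp add: col_size_def card_image inj_on_def)
qed

lemma sym_size_fibre: "sym_size P s = card {c \<in> dom P. the (P c) = s}"
  unfolding sym_size_def by (rule arg_cong[of _ _ card]) (auto simp: dom_def)

lemma ran_eq_image: "ran P = (\<lambda>c. the (P c)) ` dom P"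
  by (force simp: ran_def dom_def)

lemma finite_ran: "finite (dom P) \<Longrightarrow> finite (ran P)"
  by (simp add: ran_eq_image)

text \<open>A cell whose row, column or symbol class has fewer than \<open>\<theta>\<close> cells
  lies in at most \<open>\<theta>\<close> intercalates, so all such cells can be deleted at once.
  Sizes are measured in \<open>P\<close>, not in what remains: each surviving row, column or symbol
  owns at least \<open>\<theta>\<close> cells of \<open>P\<close>, which bounds their number without
  iteration.\<close>

lemma prune:
  fixes \<theta> :: real
  assumes P: "latin P" and "\<theta> \<ge> 0"
  obtains P' where "P' \<subseteq>\<^sub>m P" "num_intercalates P \<le> num_intercalates P' + \<theta> * card (dom P)"
    "\<theta> * card (fst ` dom P') \<le> card (dom P)" "\<theta> * card (snd ` dom P') \<le> card (dom P)"
    "\<theta> * card (ran P') \<le> card (dom P)"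
proof
  define X where "X = {c \<in> dom P. row_size P (fst c) < \<theta> \<or> col_size P (snd c) < \<theta> \<or> sym_size P (the (P c)) < \<theta>}"
  let ?P = "P |` (- X)"
  have fin: "finite (dom P)" using P by (rule latinD_finite)
  then have finX: "finite X" by (simp add: X_def)
  show "?P \<subseteq>\<^sub>m P" by (rule restrict_map_le)
  have dom: "dom ?P = {c \<in> dom P. \<theta> \<le> row_size P (fst c) \<and> \<theta> \<le> col_size P (snd c) \<and> \<theta> \<le> sym_size P (the (P c))}"
    by (auto simp: X_def)
  have opp: "card (opposite P c) \<le> \<theta>" if "c \<in> X" for c
  proof -
    obtain i x where c: "c = (i, x)" by (cases c)
    from that obtain s where s: "P (i, x) = Some s" by (auto simp: X_def c)
    from that have "real (row_size P i) < \<theta> \<or> col_size P x < \<theta> \<or> sym_size P s < \<theta>"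
      by (auto simp: X_def c s)
    then show ?thesis
      using card_opposite_le_row[OF P, of i x] card_opposite_le_col[OF P, of i x]
        card_opposite_le_sym[OF P s] unfolding c by linarith
  qed
  have "real (\<Sum>c\<in>X. card (opposite P c)) \<le> (\<Sum>c\<in>X. \<theta>)"
    unfolding of_nat_sum by (rule sum_mono) (rule opp)
  also have "\<dots> \<le> \<theta> * card (dom P)"
    using card_mono[OF fin, of X] \<open>\<theta> \<ge> 0\<close> by (simp add: X_def mult.commute mult_left_mono)
  finally show "num_intercalates P \<le> num_intercalates ?P + \<theta> * card (dom P)"
    using num_intercalates_remove[OF fin finX] by linarith
  show "\<theta> * card (fst ` dom ?P) \<le> card (dom P)"
    by (rule card_large_fibres[OF fin, of _ fst]) (unfold dom, auto simp flip: row_size_fibre)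
  show "\<theta> * card (snd ` dom ?P) \<le> card (dom P)"
    by (rule card_large_fibres[OF fin, of _ snd]) (unfold dom, auto simp flip: col_size_fibre)
  have "(\<lambda>c. the (?P c)) ` dom ?P = (\<lambda>c. the (P c)) ` dom ?P"
    by (rule image_cong) auto
  then show "\<theta> * card (ran ?P) \<le> card (dom P)" unfolding ran_eq_image
    by (intro card_large_fibres[OF fin, of _ "\<lambda>c. the (P c)"]) (unfold dom, auto simp flip: sym_size_fibre)
qed

lemma num_intercalates_le:
  assumes P: "latin P"
  shows "num_intercalates P \<le> 2 * real (card (dom P)) powr (3/2)"
proof (cases "card (dom P) = 0")
  case True
  then have "P = Map.empty" using latinD_finite[OF P] by simp
  then show ?thesis by (simp add: num_intercalates_def)
next
  case False
  define m where "m = real (card (dom P))"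
  have m: "m > 0" using False by (simp add: m_def)
  \<comment> \<open>\<open>\<theta> = sqrt m\<close> balances the loss \<open>\<theta> m\<close>
    against the \<open>m / \<theta>\<close> surviving rows, which bound every column and hence the
    number of intercalates through a cell.\<close>
  obtain P' where P': "P' \<subseteq>\<^sub>m P" "num_intercalates P \<le> num_intercalates P' + sqrt m * m"
    "sqrt m * card (fst ` dom P') \<le> m"
    using prune[OF P, of "sqrt m"] m unfolding m_def by (metis less_eq_real_def real_sqrt_ge_zero)
  have lat: "latin P'" using P P'(1) latin_map_le by blast
  have rows: "card (fst ` dom P') \<le> sqrt m"
    using P'(3) m by (metis mult_le_cancel_left_pos real_sqrt_gt_zero real_sqrt_mult_self abs_of_pos)
  have fin': "finite (dom P')" using lat latinD_finite by blast
  have "card (opposite P' c) \<le> sqrt m" for c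
  proof -
    obtain i x where c: "c = (i, x)" by (cases c)
    have "card {i. (i, x) \<in> dom P'} \<le> card (fst ` dom P')"
      by (rule card_mono) (use fin' in force)+
    then show ?thesis using rows card_opposite_le_col[OF lat, of i x] unfolding c col_size_def by linarith
  qed
  then have "real (\<Sum>c\<in>dom P'. card (opposite P' c)) \<le> (\<Sum>c\<in>dom P'. sqrt m)"
    unfolding of_nat_sum by (intro sum_mono)
  also have "\<dots> \<le> m * sqrt m"
    using card_mono[OF latinD_finite[OF P] map_le_implies_dom_le[OF P'(1)]] m
    by (simp add: m_def mult_right_mono)
  finally have "num_intercalates P' \<le> m * sqrt m"
    using num_intercalates_le_sum_opposite[OF fin'] by linarith
  moreover have "m powr (3/2) = m * sqrt m"
    using m powr_add[of m 1 "1/2"] by (simp add: powr_half_sqrt)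
  moreover have "sqrt m * m = m * sqrt m" by simp
  ultimately show ?thesis using P'(2) unfolding m_def by linarith
qed

text \<open>\<open>latin\<close> carries no bounding box, whereas \<open>Phi\<close> and the Latin
  rectangles do; this supplies a tight one. Rows and columns are renumbered monotonically because
  intercalates are recorded with \<open>i < j\<close> and \<open>x < y\<close>, while for symbols
  any bijection will do.\<close>

lemma relabel:
  assumes P: "latin P"
  obtains P' where "latin P'" "dom P' \<subseteq> {1..card (fst ` dom P)} \<times> {1..card (snd ` dom P)}"
    "ran P' \<subseteq> {1..card (ran P)}" "card (dom P') \<le> card (dom P)"
    "num_intercalates P \<le> num_intercalates P'"
proof -
  have fin: "finite (dom P)" using P by (rule latinD_finite)
  have enum: "\<exists>h. bij_betw h {1..card M} M \<and> strict_mono_on {1..card M} h" if M: "finite M" for M :: "nat set"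
  proof -
    obtain h where h: "bij_betw h {..<card M} M" "strict_mono_on {..<card M} h"
      by (rule ex_bij_betw_strict_mono_card[OF M])
    have "bij_betw (\<lambda>i. i - 1) {1..card M} {..<card M}"
      by (rule bij_betwI[where g = Suc]) auto
    then have "bij_betw (h \<circ> (\<lambda>i. i - 1)) {1..card M} M" using h(1) by (rule bij_betw_trans)
    moreover have "strict_mono_on {1..card M} (h \<circ> (\<lambda>i. i - 1))"
    proof (rule strict_mono_onI)
      fix r s assume "r \<in> {1..card M}" "s \<in> {1..card M}" "r < s"
      then show "(h \<circ> (\<lambda>i. i - 1)) r < (h \<circ> (\<lambda>i. i - 1)) s"
        using strict_mono_onD[OF h(2), of "r - 1" "s - 1"] by auto
    qed
    ultimately show ?thesis by blast
  qed
  define A where "A = fst ` dom P"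
  define B where "B = snd ` dom P"
  obtain e where e: "bij_betw e {1..card A} A" "strict_mono_on {1..card A} e"
    using enum[of A] fin by (auto simp: A_def)
  obtain f where f: "bij_betw f {1..card B} B" "strict_mono_on {1..card B} f"
    using enum[of B] fin by (auto simp: B_def)
  obtain g where g: "bij_betw g (ran P) {1..card (ran P)}"
    using enum[of "ran P"] finite_ran[OF fin] bij_betw_inv by blast
  define P' where "P' = (\<lambda>(i, x). if i \<in> {1..card A} \<and> x \<in> {1..card B} then map_option g (P (e i, f x)) else None)"
  have P'Some: "P' (i, x) = Some t \<longleftrightarrow> i \<in> {1..card A} \<and> x \<in> {1..card B} \<and> (\<exists>s. P (e i, f x) = Some s \<and> t = g s)" for i x t
    by (auto simp: P'_def)
  have ginj: "g s = g t \<Longrightarrow> P c = Some s \<Longrightarrow> P d = Some t \<Longrightarrow> s = t" for s t c d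
    using g unfolding bij_betw_def inj_on_def by (metis ranI)
  have einj: "e i = e j \<Longrightarrow> i \<in> {1..card A} \<Longrightarrow> j \<in> {1..card A} \<Longrightarrow> i = j" for i j
    using e(1) unfolding bij_betw_def inj_on_def by blast
  have finj: "f i = f j \<Longrightarrow> i \<in> {1..card B} \<Longrightarrow> j \<in> {1..card B} \<Longrightarrow> i = j" for i j
    using f(1) unfolding bij_betw_def inj_on_def by blast
  have dom': "dom P' \<subseteq> {1..card A} \<times> {1..card B}" by (auto simp: P'_def split: if_splits)
  have "latin P'" unfolding latin_def
  proof (intro conjI allI impI)
    show "finite (dom P')" using dom' finite_subset by blast
  next
    fix i x y s assume "P' (i, x) = Some s \<and> P' (i, y) = Some s"
    then show "x = y" unfolding P'Some using ginj finj latinD_row[OF P] by metis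
  next
    fix i j x s assume "P' (i, x) = Some s \<and> P' (j, x) = Some s"
    then show "i = j" unfolding P'Some using ginj einj latinD_col[OF P] by metis
  qed
  moreover have "ran P' \<subseteq> {1..card (ran P)}"
  proof
    fix t assume "t \<in> ran P'"
    then obtain c s where "P c = Some s" "t = g s" unfolding ran_def using P'Some by auto
    then show "t \<in> {1..card (ran P)}" using g bij_betwE ranI by metis
  qed
  moreover have "card (dom P') \<le> card (dom P)"
  proof (rule card_inj_on_le[OF _ _ fin])
    show "inj_on (\<lambda>(i, x). (e i, f x)) (dom P')"
    proof (rule inj_onI, clarify)
      fix i x j y s t
      assume "P' (i, x) = Some s" "P' (j, y) = Some t" "e i = e j" "f x = f y"
      then show "i = j \<and> x = y" unfolding P'Some using einj[of i j] finj[of x y] by blast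
    qed
    show "(\<lambda>(i, x). (e i, f x)) ` dom P' \<subseteq> dom P"
    proof clarify
      fix i x t assume "P' (i, x) = Some t"
      then show "\<exists>s. P (e i, f x) = Some s" unfolding P'Some by blast
    qed
  qed
  moreover have "num_intercalates P \<le> num_intercalates P'"
  proof -
    have "q \<in> (\<lambda>(i, j, x, y). (e i, e j, f x, f y)) ` intercalates P'" if q: "q \<in> intercalates P" for q
    proof -
      obtain i' j' x' y' where [simp]: "q = (i', j', x', y')" by (cases q)
      have mem: "i' \<in> A" "j' \<in> A" "x' \<in> B" "y' \<in> B" and lt: "i' < j'" "x' < y'"
        using q unfolding intercalates_def A_def B_def by (auto simp: image_iff Bex_def)
      have im: "A = e ` {1..card A}" "B = f ` {1..card B}" using e(1) f(1) by (simp_all add: bij_betw_def)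
      obtain i where i: "i' = e i" "i \<in> {1..card A}" using mem(1) im(1) by blast
      obtain j where j: "j' = e j" "j \<in> {1..card A}" using mem(2) im(1) by blast
      obtain x where x: "x' = f x" "x \<in> {1..card B}" using mem(3) im(2) by blast
      obtain y where y: "y' = f y" "y \<in> {1..card B}" using mem(4) im(2) by blast
      note ij = i(1) j(1) x(1) y(1) i(2) j(2) x(2) y(2)
      have "i < j" using lt(1) strict_mono_on_less[OF e(2)] ij by simp
      moreover have "x < y" using lt(2) strict_mono_on_less[OF f(2)] ij by simp
      ultimately have "(i, j, x, y) \<in> intercalates P'"
        using q ij(5-) unfolding intercalates_def by (auto simp: P'_def ij(1-4) dom_def)
      moreover have "q = (\<lambda>(i, j, x, y). (e i, e j, f x, f y)) (i, j, x, y)" by (simp add: ij(1-4))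
      ultimately show ?thesis by (rule image_eqI[rotated])
    qed
    then have "card (intercalates P) \<le> card ((\<lambda>(i, j, x, y). (e i, e j, f x, f y)) ` intercalates P')"
      using \<open>latin P'\<close> latinD_finite by (intro card_mono) auto
    also have "\<dots> \<le> card (intercalates P')"
      using \<open>latin P'\<close> latinD_finite by (intro card_image_le) auto
    finally show ?thesis by (simp add: num_intercalates_def)
  qed
  ultimately show ?thesis using that dom' unfolding A_def B_def by blast
qed

lemma Phi_le:
  assumes "latin P" "N \<le> real (num_intercalates P)"
  shows "Phi N \<le> card (dom P)"
proof -
  obtain P' where P': "latin P'" "dom P' \<subseteq> {1..card (fst ` dom P)} \<times> {1..card (snd ` dom P)}"
    "ran P' \<subseteq> {1..card (ran P)}" "card (dom P') \<le> card (dom P)" "num_intercalates P \<le> num_intercalates P'"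
    by (rule relabel[OF assms(1)])
  have "real (num_intercalates P') \<ge> N" using P'(5) assms(2) by linarith
  then have "Phi N \<le> card (dom P')" unfolding Phi_def
    using latin_partial_latin_square[OF P'(1,2)] by (intro Least_le exI conjI) auto
  with P' show ?thesis by simp
qed

section \<open>Order of magnitude and subadditivity of \<open>Phi\<close>\<close>

unbundle bit_operations_syntax

text \<open>The addition table of the elementary abelian group of order \<open>2 ^ r\<close>. Every
  element is its own inverse, so any two rows and any column lie in a common intercalate.\<close>

definition xor_square :: "nat \<Rightarrow> partial_array" where
  "xor_square r = (\<lambda>(i, x). if i < 2 ^ r \<and> x < 2 ^ r then Some (i XOR x) else None)"

lemma nat_xor_less: "(a::nat) < 2 ^ r \<Longrightarrow> b < 2 ^ r \<Longrightarrow> a XOR b < 2 ^ r"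
  by (metis take_bit_nat_eq_self_iff take_bit_xor)

lemma nat_xor_cancel: "(a::nat) XOR b = a XOR c \<longleftrightarrow> b = c"
  by (metis xor.assoc xor_self_eq xor.left_neutral)

lemma nat_xor_cancel_right: "(b::nat) XOR a = c XOR a \<longleftrightarrow> b = c"
  by (metis nat_xor_cancel xor.commute)

lemma latin_xor_square: "latin (xor_square r)"
  unfolding latin_def
proof (intro conjI allI impI)
  show "finite (dom (xor_square r))"
    by (rule finite_subset[of _ "{..<2^r} \<times> {..<2^r}"]) (auto simp: xor_square_def split: if_splits)
qed (auto simp: xor_square_def nat_xor_cancel nat_xor_cancel_right split: if_splits)

lemma card_dom_xor_square: "card (dom (xor_square r)) = (2 ^ r)\<^sup>2"
proof -
  have "dom (xor_square r) = {..<2^r} \<times> {..<2^r}" by (auto simp: xor_square_def split: if_splits)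
  then show ?thesis by (simp add: power2_eq_square)
qed

text \<open>Two distinct rows \<open>i\<close>, \<open>j\<close> and a column \<open>x\<close>
  determine the second column \<open>x XOR (i XOR j)\<close>. The maps \<open>?f0\<close> to
  \<open>?f3\<close> list the four triples that belong to one intercalate, which explains the factor
  4.\<close>

lemma num_intercalates_xor_square:
  "2 ^ r * (2 ^ r - 1) * 2 ^ r \<le> 4 * num_intercalates (xor_square r)"
proof -
  let ?n = "2 ^ r :: nat" and ?I = "intercalates (xor_square r)"
  let ?T = "SIGMA i:{..<?n}. ({..<?n} - {i}) \<times> {..<?n}"
  let ?f0 = "\<lambda>(i, j, x, y). (i, j, x)" and ?f1 = "\<lambda>(i, j, x, y). (j, i, x)"
    and ?f2 = "\<lambda>(i, j, x, y). (i, j, y)" and ?f3 = "\<lambda>(i, j, x, y). (j, i, y)"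
  have fin: "finite ?I" using latin_xor_square latinD_finite by auto
  have "t \<in> ?f0 ` ?I \<union> ?f1 ` ?I \<union> ?f2 ` ?I \<union> ?f3 ` ?I" if t: "t \<in> ?T" for t
  proof -
    obtain i j x where [simp]: "t = (i, j, x)" by (cases t)
    have lt: "i < ?n" "j < ?n" "x < ?n" "i \<noteq> j" using t by auto
    define y where "y = x XOR (i XOR j)"
    have y: "y < ?n" using lt unfolding y_def by (simp add: nat_xor_less)
    have iy: "i XOR y = j XOR x"
      unfolding y_def by (metis xor.assoc xor.commute xor.left_neutral xor_self_eq)
    have jy: "j XOR y = i XOR x"
      unfolding y_def by (metis xor.assoc xor.commute xor.left_neutral xor_self_eq)
    have "x \<noteq> y" using iy lt(4) by (metis nat_xor_cancel_right)
    then have "(j, y) \<in> opposite (xor_square r) (i, x)"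
      using lt y iy jy unfolding opposite_def by (simp add: xor_square_def dom_def)
    then have mem: "sort_quad (i, j, x, y) \<in> ?I" by (rule opposite_sort_quad)
    have "t \<in> {?f0 (sort_quad (i, j, x, y)), ?f1 (sort_quad (i, j, x, y)),
        ?f2 (sort_quad (i, j, x, y)), ?f3 (sort_quad (i, j, x, y))}"
      by (cases "i \<le> j"; cases "x \<le> y") (simp_all add: sort_quad_def)
    with mem show ?thesis by blast
  qed
  then have "card ?T \<le> card (?f0 ` ?I \<union> ?f1 ` ?I \<union> ?f2 ` ?I \<union> ?f3 ` ?I)"
    by (intro card_mono finite_UnI finite_imageI fin subsetI)
  also have "\<dots> \<le> card (?f0 ` ?I) + card (?f1 ` ?I) + card (?f2 ` ?I) + card (?f3 ` ?I)"
    by (meson add_mono card_Un_le le_refl le_trans)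
  also have "\<dots> \<le> card ?I + card ?I + card ?I + card ?I"
    by (intro add_mono card_image_le fin)
  finally have "card ?T \<le> 4 * num_intercalates (xor_square r)" by (simp add: num_intercalates_def)
  moreover have "card ?T = ?n * (?n - 1) * ?n" by (simp add: card_SigmaI)
  ultimately show ?thesis by simp
qed

text \<open>Take the xor square of side \<open>q\<close>, the least power of two (at least 2) with
  \<open>q ^ 3 \<ge> 8 * N\<close>. It has at least \<open>q ^ 3 / 8\<close> intercalates, and
  minimality gives \<open>q ^ 3 \<le> 64 * N\<close>, hence at most \<open>16 * N powr (2/3)\<close>
  cells.\<close>

lemma Phi_le_powr:
  assumes "N \<ge> 1"
  shows "real (Phi N) \<le> 16 * N powr (2/3)"
proof -
  define r where "r = (LEAST r. 8 * N \<le> 2 ^ (3 * Suc r))"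
  obtain n where "8 * N < 2 ^ n" using real_arch_pow[of 2 "8 * N"] by auto
  also have "(2::real) ^ n \<le> 2 ^ (3 * Suc n)" by (rule power_increasing) auto
  finally have ex: "8 * N \<le> 2 ^ (3 * Suc n)" by simp
  have r: "8 * N \<le> 2 ^ (3 * Suc r)" unfolding r_def by (rule LeastI[of _ n]) (rule ex)
  define q where "q = (2::nat) ^ Suc r"
  have q2: "q \<ge> 2" by (simp add: q_def)
  have q3: "real q ^ 3 = 2 ^ (3 * Suc r)" 
  proof -
    have "(2::real) ^ (3 * Suc r) = (2 ^ Suc r) ^ 3" by (subst mult.commute) (rule power_mult)
    then show ?thesis by (simp only: q_def of_nat_power of_nat_numeral)
  qed
  have "real (q * (q - 1) * q) \<ge> real q ^ 3 / 2"
  proof -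
    have "real (q * (q - 1) * q) = real q * (real q - 1) * real q" using q2 by (simp add: of_nat_diff)
    also have "\<dots> \<ge> real q * (real q / 2) * real q"
      using q2 by (intro mult_right_mono mult_left_mono) auto
    finally show ?thesis by (simp add: power3_eq_cube)
  qed
  moreover have "q * (q - 1) * q \<le> 4 * num_intercalates (xor_square (Suc r))"
    unfolding q_def by (rule num_intercalates_xor_square)
  ultimately have "N \<le> num_intercalates (xor_square (Suc r))" using r q3 by linarith
  then have "Phi N \<le> card (dom (xor_square (Suc r)))" using latin_xor_square Phi_le by blast
  then have Phi: "real (Phi N) \<le> real q ^ 2" unfolding card_dom_xor_square q_def by (simp flip: of_nat_power)
  have "real q ^ 3 \<le> 64 * N"
  proof (cases r)
    case 0 then show ?thesis using q3 assms by simp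
  next
    case (Suc r')
    have "\<not> 8 * N \<le> 2 ^ (3 * Suc r')"
      by (rule not_less_Least[of r' "\<lambda>r. 8 * N \<le> 2 ^ (3 * Suc r)"]) (use Suc in \<open>simp add: r_def\<close>)
    then show ?thesis unfolding q3 Suc by (simp add: power_add)
  qed
  then have "(real q ^ 3) powr (2/3) \<le> (64 * N) powr (2/3)" by (intro powr_mono2) auto
  moreover have "(real q ^ 3) powr (2/3) = real q ^ 2"
  proof -
    have q: "real q powr 3 = real q ^ 3" "real q powr 2 = real q ^ 2" by simp_all
    have "(real q powr 3) powr (2/3) = real q powr (3 * (2/3))" by (rule powr_powr)
    also have "3 * (2/3) = (2::real)" by simp
    finally show ?thesis unfolding q .
  qed
  moreover have "(64 * N) powr (2/3) = 16 * N powr (2/3)"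
  proof -
    have 4: "(4::real) powr 3 = 64" "(4::real) powr 2 = 16" by simp_all
    have "(4 powr 3) powr (2/3) = (4::real) powr (3 * (2/3))" by (rule powr_powr)
    also have "3 * (2/3) = (2::real)" by simp
    finally have "(64::real) powr (2/3) = 16" unfolding 4 .
    then show ?thesis unfolding powr_mult by (rule arg_cong)
  qed
  ultimately show ?thesis using Phi by linarith
qed

lemma Phi_attained:
  obtains P where "latin P" "N \<le> real (num_intercalates P)" "card (dom P) = Phi N"
proof -
  have ex: "\<exists>P. latin P \<and> N \<le> num_intercalates P"
  proof -
    obtain r where r: "max N 1 * 8 < 2 ^ r" using real_arch_pow[of 2 "max N 1 * 8"] by auto
    let ?q = "(2::nat) ^ r"
    have q2: "?q \<ge> 2" using r by (cases r) auto
    have "?q * 1 * 1 \<le> ?q * (?q - 1) * ?q" using q2 by (intro mult_mono) auto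
    also note num_intercalates_xor_square[of r]
    finally have "?q \<le> 4 * num_intercalates (xor_square r)" by (simp only: mult_1_right)
    then have "real ?q \<le> real (4 * num_intercalates (xor_square r))" by (simp only: of_nat_le_iff)
    then have "N \<le> num_intercalates (xor_square r)" using r by simp
    then show ?thesis using latin_xor_square by blast
  qed
  then obtain P where P: "latin P" "N \<le> num_intercalates P" by blast
  obtain P' where P': "latin P'" "dom P' \<subseteq> {1..card (fst ` dom P)} \<times> {1..card (snd ` dom P)}"
    "ran P' \<subseteq> {1..card (ran P)}" "card (dom P') \<le> card (dom P)" "num_intercalates P \<le> num_intercalates P'"
    by (rule relabel[OF P(1)])
  have "real (num_intercalates P') \<ge> N" using P'(5) P(2) by linarith
  then have "\<exists>m a b L. partial_latin_square a b L \<and> real (num_intercalates L) \<ge> N \<and> m = card (dom L)"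
    using latin_partial_latin_square[OF P'(1,2)] by blast
  then have "\<exists>a b L. partial_latin_square a b L \<and> real (num_intercalates L) \<ge> N \<and> Phi N = card (dom L)"
    unfolding Phi_def by (rule LeastI_ex)
  then obtain a b L where "partial_latin_square a b L" "real (num_intercalates L) \<ge> N" "Phi N = card (dom L)"
    by blast
  then show ?thesis using that[of L] partial_latin_square_imp_latin by simp
qed

lemma Phi_ge_powr:
  assumes "N > 0" shows "real (Phi N) \<ge> (N / 2) powr (2/3)"
proof -
  obtain P where P: "latin P" "N \<le> num_intercalates P" "card (dom P) = Phi N" by (rule Phi_attained)
  have "N / 2 \<le> real (Phi N) powr (3/2)" using num_intercalates_le[OF P(1)] P by simp
  then have "(N / 2) powr (2/3) \<le> (real (Phi N) powr (3/2)) powr (2/3)"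
    using assms by (intro powr_mono2) auto
  then show ?thesis by (simp add: powr_powr)
qed

lemma Phi_mono: "M \<le> N \<Longrightarrow> Phi M \<le> Phi N"
proof -
  assume "M \<le> N"
  obtain P where "latin P" "N \<le> real (num_intercalates P)" "card (dom P) = Phi N" by (rule Phi_attained)
  with \<open>M \<le> N\<close> Phi_le[of P M] show ?thesis by simp
qed

text \<open>Optimal arrays for \<open>M\<close> and \<open>N\<close> are placed as diagonal blocks:
  they share no row or column, so a common symbol does no harm and the intercalates add up.\<close>

lemma Phi_add: "Phi (M + N) \<le> Phi M + Phi N"
proof -
  obtain P where P: "latin P" "M \<le> num_intercalates P" "card (dom P) = Phi M" by (rule Phi_attained)
  obtain Q where Q: "latin Q" "N \<le> num_intercalates Q" "card (dom Q) = Phi N" by (rule Phi_attained)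
  have finP: "finite (dom P)" and finQ: "finite (dom Q)" using P Q latinD_finite by auto
  obtain a where a: "\<And>i x. (i, x) \<in> dom P \<Longrightarrow> i < a" 
    using finite_nat_set_iff_bounded[of "fst ` dom P"] finP by (metis finite_imageI fst_conv image_eqI)
  obtain b where b: "\<And>i x. (i, x) \<in> dom P \<Longrightarrow> x < b"
    using finite_nat_set_iff_bounded[of "snd ` dom P"] finP by (metis finite_imageI snd_conv image_eqI)
  define R where "R = (\<lambda>(i, x). if i < a \<and> x < b then P (i, x) else if i \<ge> a \<and> x \<ge> b then Q (i - a, x - b) else None)"
  have domR: "dom R = dom P \<union> (\<lambda>(i, x). (i + a, x + b)) ` dom Q"
  proof (intro equalityI subsetI)
    fix c assume c: "c \<in> dom R"
    obtain i x where "c = (i, x)" by (cases c)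
    with c show "c \<in> dom P \<union> (\<lambda>(i, x). (i + a, x + b)) ` dom Q"
      by (auto simp: R_def image_iff split: if_splits intro!: bexI[of _ "(i - a, x - b)"])
  next
    fix c assume "c \<in> dom P \<union> (\<lambda>(i, x). (i + a, x + b)) ` dom Q"
    then show "c \<in> dom R"
    proof
      assume "c \<in> dom P" then show ?thesis using a b by (cases c) (force simp: R_def)
    qed (auto simp: R_def)
  qed
  have "latin R" unfolding latin_def
  proof (intro conjI allI impI)
    show "finite (dom R)" unfolding domR using finP finQ by simp
  next
    fix i x y s assume "R (i, x) = Some s \<and> R (i, y) = Some s"
    then show "x = y" using latinD_row[OF P(1)] latinD_row[OF Q(1)]
      unfolding R_def by (auto split: if_splits) (metis add_diff_inverse_nat not_less)
  next
    fix i j x s assume "R (i, x) = Some s \<and> R (j, x) = Some s"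
    then show "i = j" using latinD_col[OF P(1)] latinD_col[OF Q(1)]
      unfolding R_def by (auto split: if_splits) (metis add_diff_inverse_nat not_less)
  qed
  moreover have "M + N \<le> num_intercalates R"
  proof -
    let ?h = "\<lambda>(i, j, x, y). (i + a, j + a, x + b, y + b)"
    have sub1: "intercalates P \<subseteq> intercalates R"
    proof (rule intercalates_mono)
      show "P \<subseteq>\<^sub>m R" unfolding map_le_def R_def using a b by force
    qed
    have sub2: "?h ` intercalates Q \<subseteq> intercalates R"
      unfolding intercalates_def by (auto simp: R_def dom_def)
    have disj: "intercalates P \<inter> ?h ` intercalates Q = {}"
    proof -
      have "i < a" if "(i, j, x, y) \<in> intercalates P" for i j x y
        using that a unfolding intercalates_def by blast
      then show ?thesis by force
    qed
    have "num_intercalates P + num_intercalates Q = card (intercalates P \<union> ?h ` intercalates Q)"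
      unfolding num_intercalates_def
      using disj finP finQ card_image[of ?h "intercalates Q"]
      by (simp add: card_Un_disjoint inj_on_def split_beta prod_eq_iff)
    also have "\<dots> \<le> num_intercalates R"
      unfolding num_intercalates_def using sub1 sub2 \<open>latin R\<close> latinD_finite by (intro card_mono) auto
    finally show ?thesis using P Q by linarith
  qed
  ultimately have "Phi (M + N) \<le> card (dom R)" by (rule Phi_le)
  also have "\<dots> \<le> card (dom P) + card (dom Q)"
    unfolding domR by (meson add_mono_thms_linordered_semiring(2) card_Un_le card_image_le finQ le_trans)
  finally show ?thesis using P Q by simp
qed

section \<open>Switchings in a row\<close>

definition extensions :: "nat \<Rightarrow> nat \<Rightarrow> partial_array \<Rightarrow> partial_array set" where
  "extensions k n P = {L \<in> latin_rectangles k n. P \<subseteq>\<^sub>m L}"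

definition permute_row :: "partial_array \<Rightarrow> nat \<Rightarrow> (nat \<Rightarrow> nat) \<Rightarrow> partial_array" where
  "permute_row L j \<pi> = (\<lambda>(i, z). if i = j then L (j, \<pi> z) else L (i, z))"

lemma finite_latin_rectangles [simp]: "finite (latin_rectangles k n)"
proof (rule finite_subset)
  show "latin_rectangles k n \<subseteq> {L. dom L = {1..k} \<times> {1..n} \<and> ran L \<subseteq> {1..n}}"
    by (auto simp: latin_rectangles_def)
  show "finite {L :: partial_array. dom L = {1..k} \<times> {1..n} \<and> ran L \<subseteq> {1..n}}"
    by (rule finite_set_of_finite_maps) auto
qed

lemma finite_extensions [simp]: "finite (extensions k n P)"
  by (simp add: extensions_def)

lemma latin_rectangles_latin: "L \<in> latin_rectangles k n \<Longrightarrow> latin L"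
  by (auto simp: latin_rectangles_def intro: partial_latin_square_imp_latin)

lemma latin_rectangles_dom: "L \<in> latin_rectangles k n \<Longrightarrow> dom L = {1..k} \<times> {1..n}"
  by (simp add: latin_rectangles_def)

lemma latin_rectangles_Some:
  assumes "L \<in> latin_rectangles k n" "L (i, x) = Some s"
  shows "i \<in> {1..k}" "x \<in> {1..n}" "s \<in> {1..n}"
proof -
  have "(i, x) \<in> dom L" using assms by blast
  then show "i \<in> {1..k}" "x \<in> {1..n}" using latin_rectangles_dom[OF assms(1)] by auto
  have "s \<in> ran L" using assms(2) by (rule ranI)
  then show "s \<in> {1..n}" using assms(1) by (auto simp: latin_rectangles_def)
qed

lemma latin_rectangles_filled:
  assumes "L \<in> latin_rectangles k n" "i \<in> {1..k}" "x \<in> {1..n}"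
  obtains s where "L (i, x) = Some s" "s \<in> {1..n}"
proof -
  have "(i, x) \<in> dom L" using assms latin_rectangles_dom by auto
  then obtain s where "L (i, x) = Some s" by blast
  with that assms(1) latin_rectangles_Some show ?thesis by blast
qed

lemma latin_rectangles_symbol:
  assumes "L \<in> latin_rectangles k n" "i \<in> {1..k}" "s \<in> {1..n}"
  obtains x where "L (i, x) = Some s" "x \<in> {1..n}"
proof -
  define f where "f x = the (L (i, x))" for x
  have f: "L (i, x) = Some (f x) \<and> f x \<in> {1..n}" if x: "x \<in> {1..n}" for x
    by (rule latin_rectangles_filled[OF assms(1,2) x]) (simp add: f_def)
  have "inj_on f {1..n}"
  proof (rule inj_onI)
    fix x y assume "x \<in> {1..n}" "y \<in> {1..n}" "f x = f y"
    then show "x = y" using f[of x] f[of y] latinD_row[OF latin_rectangles_latin[OF assms(1)], of i x "f x" y] by simp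
  qed
  moreover have "f ` {1..n} \<subseteq> {1..n}" using f by blast
  ultimately have "f ` {1..n} = {1..n}" by (intro endo_inj_surj) auto
  then have "s \<in> f ` {1..n}" using assms(3) by simp
  then obtain x where "x \<in> {1..n}" "f x = s" by (elim imageE) simp
  with f[of x] that[of x] show ?thesis by simp
qed

lemma extensionsD:
  assumes "L \<in> extensions k n P"
  shows "L \<in> latin_rectangles k n" "P \<subseteq>\<^sub>m L"
  using assms by (auto simp: extensions_def)

lemma extensions_mono: "P \<subseteq>\<^sub>m P' \<Longrightarrow> extensions k n P' \<subseteq> extensions k n P"
  by (auto simp: extensions_def intro: map_le_trans)

lemma map_le_upd_fresh: "c \<notin> dom P \<Longrightarrow> P \<subseteq>\<^sub>m P(c \<mapsto> s)"
  by (auto simp: map_le_def)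

lemma map_upd_le_iff: "c \<notin> dom P \<Longrightarrow> P(c \<mapsto> s) \<subseteq>\<^sub>m L \<longleftrightarrow> P \<subseteq>\<^sub>m L \<and> L c = Some s"
  by (auto simp: map_le_def dom_def)

lemma extensions_upd:
  "c \<notin> dom P \<Longrightarrow> extensions k n (P(c \<mapsto> s)) = {L \<in> extensions k n P. L c = Some s}"
  by (auto simp: extensions_def map_upd_le_iff)

lemma permute_row_permute_row:
  "permute_row (permute_row L j \<pi>) j \<rho> = permute_row L j (\<pi> \<circ> \<rho>)"
  by (auto simp: permute_row_def)

lemma permute_row_id: "permute_row L j id = L"
  by (auto simp: permute_row_def)

lemma permute_row_inject: "surj \<pi> \<Longrightarrow> permute_row L j \<pi> = permute_row L' j \<pi> \<Longrightarrow> L = L'"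
  by (metis permute_row_id permute_row_permute_row surj_iff)

text \<open>A permuted row is still filled and free of repetitions, so the only possible clash is
  between a moved entry and another row in its new column; \<open>ok\<close> excludes exactly
  that.\<close>

lemma permute_row_latin_rectangles:
  assumes L: "L \<in> latin_rectangles k n" and \<pi>: "\<pi> permutes {1..n}" and j: "j \<in> {1..k}"
    and ok: "\<And>z i. z \<in> {1..n} \<Longrightarrow> \<pi> z \<noteq> z \<Longrightarrow> i \<in> {1..k} - {j} \<Longrightarrow> L (i, z) \<noteq> L (j, \<pi> z)"
  shows "permute_row L j \<pi> \<in> latin_rectangles k n"
proof -
  let ?M = "permute_row L j \<pi>"
  note lat = latin_rectangles_latin[OF L]
  have dom: "dom ?M = {1..k} \<times> {1..n}"
  proof -
    have "(i, z) \<in> dom ?M \<longleftrightarrow> (i, z) \<in> {1..k} \<times> {1..n}" for i z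
    proof (cases "i = j")
      case True
      then have "(i, z) \<in> dom ?M \<longleftrightarrow> (j, \<pi> z) \<in> dom L" by (auto simp: permute_row_def dom_def)
      also have "\<dots> \<longleftrightarrow> \<pi> z \<in> {1..n}" using j unfolding latin_rectangles_dom[OF L] by simp
      also have "\<dots> \<longleftrightarrow> z \<in> {1..n}" by (rule permutes_in_image[OF \<pi>])
      finally show ?thesis using True j by simp
    next
      case False
      then have "(i, z) \<in> dom ?M \<longleftrightarrow> (i, z) \<in> dom L" by (auto simp: permute_row_def dom_def)
      then show ?thesis unfolding latin_rectangles_dom[OF L] .
    qed
    then show ?thesis by (intro set_eqI) (simp only: split_paired_all)
  qed
  have ran: "ran ?M \<subseteq> ran L"
    unfolding ran_def permute_row_def by (auto split: if_splits)
  have row: "x = y" if "?M (i, x) = Some s" "?M (i, y) = Some s" for i x y s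
  proof (cases "i = j")
    case True
    then have "\<pi> x = \<pi> y" using that latinD_row[OF lat, of j "\<pi> x" s "\<pi> y"] by (simp add: permute_row_def)
    then show ?thesis using permutes_inj[OF \<pi>] by (simp add: inj_eq)
  qed (use that latinD_row[OF lat] in \<open>simp add: permute_row_def\<close>)
  have col_j: "i = j" if "?M (i, x) = Some s" "?M (j, x) = Some s" for i x s
  proof (rule ccontr)
    assume ij: "i \<noteq> j"
    have "(i, x) \<in> dom ?M" using that(1) by blast
    then have x: "i \<in> {1..k}" "x \<in> {1..n}" unfolding dom by simp_all
    have eq: "L (i, x) = L (j, \<pi> x)" using that ij by (simp add: permute_row_def)
    then have "\<pi> x = x" using ok[of x i] x ij by auto
    then show False using that ij latinD_col[OF lat, of i x s j] by (simp add: permute_row_def)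
  qed
  have col: "i = i'" if "?M (i, x) = Some s" "?M (i', x) = Some s" for i i' x s
  proof (cases "i = j \<or> i' = j")
    case True
    then show ?thesis using that col_j by metis
  qed (use that latinD_col[OF lat, of i x s i'] in \<open>simp add: permute_row_def\<close>)
  show ?thesis unfolding latin_rectangles_def partial_latin_square_def
  proof (intro CollectI conjI allI impI)
    show "ran ?M \<subseteq> {1..n}" using ran L by (auto simp: latin_rectangles_def)
  qed (use dom row col in \<open>auto simp del: atLeastAtMost_iff\<close>)
qed

text \<open>Serves to count the columns blocked for a switching: every other row \<open>i\<close>
  blocks at most one column \<open>y\<close>.\<close>

lemma card_ex_unique_le:
  assumes "finite I" "\<And>i y y'. i \<in> I \<Longrightarrow> Q i y \<Longrightarrow> Q i y' \<Longrightarrow> y = y'"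
  shows "card {y. \<exists>i\<in>I. Q i y} \<le> card I" "finite {y. \<exists>i\<in>I. Q i y}"
proof -
  have eq: "{y. \<exists>i\<in>I. Q i y} = (\<Union>i\<in>I. {y. Q i y})" by blast
  have fin: "finite {y. Q i y}" and c: "card {y. Q i y} \<le> 1" if i: "i \<in> I" for i
  proof -
    have "\<exists>z. {y. Q i y} \<subseteq> {z}" using assms(2)[OF i] by blast
    then obtain z where z: "{y. Q i y} \<subseteq> {z}" by blast
    then show "finite {y. Q i y}" using finite_subset by blast
    show "card {y. Q i y} \<le> 1" using card_mono[OF _ z] by simp
  qed
  show "finite {y. \<exists>i\<in>I. Q i y}" unfolding eq using assms(1) fin by blast
  have "card (\<Union>i\<in>I. {y. Q i y}) \<le> (\<Sum>i\<in>I. card {y. Q i y})" using assms(1) by (rule card_UN_le)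
  also have "\<dots> \<le> (\<Sum>i\<in>I. 1)" using c by (rule sum_mono)
  finally show "card {y. \<exists>i\<in>I. Q i y} \<le> card I" unfolding eq by simp
qed

lemma finite_row: "finite (dom P) \<Longrightarrow> finite {x. (i, x) \<in> dom P}"
  by (rule finite_subset[of _ "snd ` dom P"]) force+

text \<open>In row \<open>j\<close>, swap the symbol \<open>s\<close> in column \<open>x\<close> with the entry of a column \<open>y\<close>.
  The result determines \<open>y\<close> as the column holding \<open>s\<close>.\<close>

lemma card_extensions_upd_le_nat:
  assumes x: "(j, x) \<notin> dom P"
  shows "card (extensions k n (P((j, x) \<mapsto> s))) * (n - (row_size P j + 2 * k)) \<le> card (extensions k n P)"
proof -
  let ?P = "P((j, x) \<mapsto> s)" and ?I = "{1..k} - {j}"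
  \<comment> \<open>Columns with which the swap is legal: no cell of \<open>P\<close> moves and
    neither moved entry clashes in its new column. At most
    \<open>1 + row_size P j + 2 * (k - 1)\<close> columns violate this.\<close>
  define Y where "Y L = {y \<in> {1..n}. y \<noteq> x \<and> (j, y) \<notin> dom P \<and>
    (\<forall>i\<in>?I. L (i, y) \<noteq> Some s \<and> L (i, x) \<noteq> L (j, y))}" for L :: partial_array
  have LP: "L \<in> latin_rectangles k n" "P \<subseteq>\<^sub>m L" "L (j, x) = Some s" if "L \<in> extensions k n ?P" for L
    using that unfolding extensions_upd[OF x] by (auto dest: extensionsD)
  have Y: "n - (row_size P j + 2 * k) \<le> card (Y L)" if L: "L \<in> extensions k n ?P" for L
  proof -
    note L = LP[OF L] 
    note lat = latin_rectangles_latin[OF L(1)]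
    have j: "j \<in> {1..k}" using L latin_rectangles_Some by blast
    have fin: "finite {y. (j, y) \<in> dom P}"
      by (rule finite_row) (rule finite_subset[OF map_le_implies_dom_le[OF L(2)] latinD_finite[OF lat]])
    let ?A = "{y. \<exists>i\<in>?I. L (i, y) = Some s}" and ?B = "{y. \<exists>i\<in>?I. L (i, x) = L (j, y) \<and> L (j, y) \<noteq> None}"
    have A: "card ?A \<le> card ?I" "finite ?A"
      using latinD_row[OF lat] by (intro card_ex_unique_le; simp)+
    have "y = y'" if "L (i, x) = L (j, y) \<and> L (j, y) \<noteq> None" "L (i, x) = L (j, y') \<and> L (j, y') \<noteq> None" for i y y'
      using that latinD_row[OF lat, of j y _ y'] by auto
    then have B: "card ?B \<le> card ?I" "finite ?B"
      by (intro card_ex_unique_le; simp)+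
    let ?C = "{y. (j, y) \<in> dom P}"
    have "{1..n} \<subseteq> Y L \<union> ({x} \<union> ?C \<union> ?A \<union> ?B)"
    proof
      fix y assume y: "y \<in> {1..n}"
      obtain t where "L (j, y) = Some t" using latin_rectangles_filled[OF L(1) j y] by blast
      then show "y \<in> Y L \<union> ({x} \<union> {y. (j, y) \<in> dom P} \<union> ?A \<union> ?B)"
        using y unfolding Y_def by auto
    qed
    moreover have "finite (Y L)" by (simp add: Y_def)
    ultimately have "card {1..n} \<le> card (Y L \<union> ({x} \<union> ?C \<union> ?A \<union> ?B))"
      using fin A(2) B(2) by (intro card_mono finite_UnI) auto
    also have "\<dots> \<le> card (Y L) + (1 + row_size P j + card ?A + card ?B)"
    proof -
      have "card {x} = 1" by simp
      then show ?thesis unfolding row_size_def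
        using card_Un_le[of "Y L" "{x} \<union> ?C \<union> ?A \<union> ?B"] card_Un_le[of "{x} \<union> ?C \<union> ?A" ?B]
          card_Un_le[of "{x} \<union> ?C" ?A] card_Un_le[of "{x}" ?C] by linarith
    qed
    also have "\<dots> \<le> card (Y L) + (1 + row_size P j + (k - 1) + (k - 1))"
      using A B j by (intro add_mono) auto
    finally show ?thesis using j unfolding card_atLeastAtMost atLeastAtMost_iff by arith
  qed
  let ?f = "\<lambda>(L, y). permute_row L j (Transposition.transpose x y)"
  let ?S = "SIGMA L:extensions k n ?P. Y L"
  have f: "?f (L, y) \<in> latin_rectangles k n" "P \<subseteq>\<^sub>m ?f (L, y)" "?f (L, y) (j, y) = Some s"
    if L: "L \<in> extensions k n ?P" and y: "y \<in> Y L" for L y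
  proof -
    note L = LP[OF L]
    have xj: "j \<in> {1..k}" "x \<in> {1..n}" using L latin_rectangles_Some by blast+
    show "?f (L, y) (j, y) = Some s" using L by (simp add: permute_row_def)
    show "?f (L, y) \<in> latin_rectangles k n"
    proof (simp, rule permute_row_latin_rectangles[OF L(1) _ xj(1)])
      show "Transposition.transpose x y permutes {1..n}" using xj y by (intro permutes_swap_id) (auto simp: Y_def)
      fix z i assume z: "Transposition.transpose x y z \<noteq> z" "i \<in> ?I"
      then have "z = x \<or> z = y" by (metis transpose_apply_other)
      then show "L (i, z) \<noteq> L (j, Transposition.transpose x y z)" using z y L(3) by (auto simp: Y_def)
    qed
    show "P \<subseteq>\<^sub>m ?f (L, y)" unfolding map_le_def
    proof
      fix c assume c: "c \<in> dom P"
      obtain i z where iz: "c = (i, z)" by (cases c)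
      have "i = j \<Longrightarrow> z \<noteq> x \<and> z \<noteq> y" using c x y iz by (auto simp: Y_def)
      then have "permute_row L j (Transposition.transpose x y) c = L c" by (auto simp: iz permute_row_def)
      then show "P c = ?f (L, y) c" using L(2) c by (simp add: map_le_def)
    qed
  qed
  have "inj_on ?f ?S"
  proof (rule inj_onI)
    fix p p' assume p: "p \<in> ?S" "p' \<in> ?S" and eq: "?f p = ?f p'"
    obtain L y where [simp]: "p = (L, y)" by (cases p)
    obtain L' y' where [simp]: "p' = (L', y')" by (cases p')
    have "?f (L, y) (j, y) = Some s" "?f (L, y) (j, y') = Some s" "latin (?f (L, y))"
      using p f[of L y] f[of L' y'] eq latin_rectangles_latin by auto
    then have "y = y'" using latinD_row by blast
    moreover have "surj (Transposition.transpose x y)" by simp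
    ultimately show "p = p'" using eq permute_row_inject[of "Transposition.transpose x y" L j L'] by simp
  qed
  moreover have "?f ` ?S \<subseteq> extensions k n P"
    using f unfolding extensions_def by blast
  ultimately have "card ?S \<le> card (extensions k n P)" by (intro card_inj_on_le) auto
  moreover have "card ?S = (\<Sum>L\<in>extensions k n ?P. card (Y L))"
    by (intro card_SigmaI) (auto simp: Y_def)
  moreover have "card (extensions k n ?P) * (n - (row_size P j + 2 * k)) \<le> (\<Sum>L\<in>extensions k n ?P. card (Y L))"
    using sum_mono[of "extensions k n ?P" "\<lambda>_. n - (row_size P j + 2 * k)", OF Y] by simp
  ultimately show ?thesis by simp
qed

text \<open>Bringing \<open>s\<close> from column \<open>y\<close> to column \<open>x\<close> by a plain swap may be blocked by one particular
  symbol; cycling through a third column \<open>z\<close> leaves enough freedom.\<close>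

lemma card_extensions_avoid_le_nat:
  assumes j: "j \<in> {1..k}" and x: "x \<in> {1..n}" and s: "s \<in> {1..n}"
    and xP: "(j, x) \<notin> dom P" and sP: "\<And>y. P (j, y) \<noteq> Some s"
  shows "card {L \<in> extensions k n P. \<forall>i\<in>{1..k} - {j}. L (i, x) \<noteq> Some s} * (n - (row_size P j + 2 * k))
    \<le> n\<^sup>2 * card (extensions k n (P((j, x) \<mapsto> s)))"
proof -
  let ?P = "P((j, x) \<mapsto> s)" and ?I = "{1..k} - {j}"
  define D where "D = {L \<in> extensions k n P. \<forall>i\<in>?I. L (i, x) \<noteq> Some s}"
  \<comment> \<open>\<open>y\<close> is the column of \<open>s\<close> in row \<open>j\<close>, and
    \<open>z\<close> the auxiliary column of the cycle. When \<open>s\<close> is already in place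
    (\<open>y = x\<close>) nothing moves and \<open>z\<close> is a free label, which keeps the
    number of pairs large in this case as well.\<close>
  define W where "W L = {(y, z). y \<in> {1..n} \<and> z \<in> {1..n} \<and> L (j, y) = Some s \<and>
    (y = x \<or> (z \<noteq> x \<and> z \<noteq> y \<and> (j, z) \<notin> dom P \<and> (\<forall>i\<in>?I. L (i, y) \<noteq> L (j, z) \<and> L (i, z) \<noteq> L (j, x))))}"
    for L :: partial_array
  have finW: "finite (W L)" for L
    by (rule finite_subset[of _ "{1..n} \<times> {1..n}"]) (auto simp: W_def)
  have LD: "L \<in> latin_rectangles k n" "P \<subseteq>\<^sub>m L" "\<And>i. i \<in> ?I \<Longrightarrow> L (i, x) \<noteq> Some s" if "L \<in> D" for L
    using that unfolding D_def extensions_def by auto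
  have W: "n - (row_size P j + 2 * k) \<le> card (W L)" if L: "L \<in> D" for L
  proof -
    note L = LD(1,2)[OF L]
    note lat = latin_rectangles_latin[OF L(1)]
    obtain y where y: "L (j, y) = Some s" "y \<in> {1..n}" by (rule latin_rectangles_symbol[OF L(1) j s])
    show ?thesis
    proof (cases "y = x")
      case True
      then have "{x} \<times> {1..n} \<subseteq> W L" using y x unfolding W_def by auto
      then have "card ({x} \<times> {1..n}) \<le> card (W L)" by (intro card_mono finW)
      then show ?thesis by simp
    next
      case False
      define Z where "Z = {z \<in> {1..n}. z \<noteq> x \<and> z \<noteq> y \<and> (j, z) \<notin> dom P \<and> (\<forall>i\<in>?I. L (i, y) \<noteq> L (j, z) \<and> L (i, z) \<noteq> L (j, x))}"
      obtain t where t: "L (j, x) = Some t" using latin_rectangles_filled[OF L(1) j x] by blast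
      have fin: "finite {y. (j, y) \<in> dom P}"
        by (rule finite_row) (rule finite_subset[OF map_le_implies_dom_le[OF L(2)] latinD_finite[OF lat]])
      let ?A = "{z. \<exists>i\<in>?I. L (i, z) = Some t}" and ?B = "{z. \<exists>i\<in>?I. L (i, y) = L (j, z) \<and> L (j, z) \<noteq> None}"
      have A: "card ?A \<le> card ?I" "finite ?A"
        using latinD_row[OF lat] by (intro card_ex_unique_le; simp)+
      have "z = z'" if "L (i, y) = L (j, z) \<and> L (j, z) \<noteq> None" "L (i, y) = L (j, z') \<and> L (j, z') \<noteq> None" for i z z'
        using that latinD_row[OF lat, of j z _ z'] by auto
      then have B: "card ?B \<le> card ?I" "finite ?B"
        by (intro card_ex_unique_le; simp)+
      let ?C = "{z. (j, z) \<in> dom P}"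
      have "{1..n} \<subseteq> Z \<union> ({x} \<union> {y} \<union> ?C \<union> ?A \<union> ?B)"
      proof
        fix z assume z: "z \<in> {1..n}"
        obtain u where "L (j, z) = Some u" using latin_rectangles_filled[OF L(1) j z] by blast
        then show "z \<in> Z \<union> ({x} \<union> {y} \<union> {z. (j, z) \<in> dom P} \<union> ?A \<union> ?B)"
          using z t unfolding Z_def by auto
      qed
      moreover have "finite Z" by (simp add: Z_def)
      ultimately have "card {1..n} \<le> card (Z \<union> ({x} \<union> {y} \<union> ?C \<union> ?A \<union> ?B))"
        using fin A(2) B(2) by (intro card_mono finite_UnI) auto
      also have "\<dots> \<le> card Z + (1 + 1 + row_size P j + card ?A + card ?B)"
      proof -
        have "card {x} = 1" "card {y} = 1" by simp_all
        then show ?thesis unfolding row_size_def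
          using card_Un_le[of Z "{x} \<union> {y} \<union> ?C \<union> ?A \<union> ?B"] card_Un_le[of "{x} \<union> {y} \<union> ?C \<union> ?A" ?B]
            card_Un_le[of "{x} \<union> {y} \<union> ?C" ?A] card_Un_le[of "{x} \<union> {y}" ?C] card_Un_le[of "{x}" "{y}"]
          by linarith
      qed
      also have "\<dots> \<le> card Z + (1 + 1 + row_size P j + (k - 1) + (k - 1))"
        using A B j by (intro add_mono) auto
      finally have "n - (row_size P j + 2 * k) \<le> card Z"
        using j unfolding card_atLeastAtMost atLeastAtMost_iff by arith
      also have "card Z = card ({y} \<times> Z)" by (rule card_cartesian_product_singleton[symmetric])
      also have "\<dots> \<le> card (W L)"
        by (intro card_mono finW) (use y in \<open>auto simp: W_def Z_def\<close>)
      finally show ?thesis .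
    qed
  qed
  define cyc where "cyc y z = (if y = x then id else Transposition.transpose x y \<circ> Transposition.transpose y z)" for y z :: nat
  \<comment> \<open>Recording \<open>(y, z)\<close> in the value makes injectivity easy. It costs
    the factor \<open>n\<^sup>2\<close>, while every rectangle has nearly \<open>n\<close>
    admissible pairs, so the net loss is about \<open>1 / n\<close>.\<close>
  let ?f = "\<lambda>(L, y, z). (permute_row L j (cyc y z), y, z)"
  let ?S = "SIGMA L:D. W L"
  have f: "permute_row L j (cyc y z) \<in> extensions k n ?P" if L: "L \<in> D" and yz: "(y, z) \<in> W L" for L y z
  proof (cases "y = x")
    case True
    then show ?thesis using L yz xP
      by (simp add: cyc_def permute_row_id extensions_upd D_def W_def)
  next
    case False
    note LD = LD[OF L]
    have yz': "y \<in> {1..n}" "z \<in> {1..n}" "L (j, y) = Some s" "z \<noteq> x" "z \<noteq> y" "(j, z) \<notin> dom P"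
      "\<And>i. i \<in> ?I \<Longrightarrow> L (i, y) \<noteq> L (j, z)" "\<And>i. i \<in> ?I \<Longrightarrow> L (i, z) \<noteq> L (j, x)"
      using yz False unfolding W_def by blast+
    have c: "cyc y z x = y" "cyc y z y = z" "cyc y z z = x" "\<And>w. w \<noteq> x \<Longrightarrow> w \<noteq> y \<Longrightarrow> w \<noteq> z \<Longrightarrow> cyc y z w = w"
      using False yz'(4,5) by (auto simp: cyc_def transpose_def)
    have perm: "cyc y z permutes {1..n}" unfolding cyc_def
      using False x yz' by (auto intro!: permutes_compose permutes_swap_id)
    have "permute_row L j (cyc y z) \<in> latin_rectangles k n"
    proof (rule permute_row_latin_rectangles[OF LD(1) perm j])
      fix w i assume "cyc y z w \<noteq> w" and i: "i \<in> ?I"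
      then consider "w = x" | "w = y" | "w = z" using c(4) by blast
      then show "L (i, w) \<noteq> L (j, cyc y z w)"
        by cases (use c i yz' LD(3) in auto)
    qed
    moreover have "P \<subseteq>\<^sub>m permute_row L j (cyc y z)" unfolding map_le_def
    proof
      fix d assume d: "d \<in> dom P"
      obtain i w where iw: "d = (i, w)" by (cases d)
      have "(j, y) \<notin> dom P"
      proof
        assume "(j, y) \<in> dom P"
        then have "P (j, y) = L (j, y)" using LD(2) by (simp add: map_le_def)
        then show False using yz'(3) sP by simp
      qed
      then have "i = j \<Longrightarrow> w \<noteq> x \<and> w \<noteq> y \<and> w \<noteq> z" using d xP yz' iw by auto
      then have "permute_row L j (cyc y z) d = L d" using c(4) by (auto simp: iw permute_row_def)
      then show "P d = permute_row L j (cyc y z) d" using LD(2) d by (simp add: map_le_def)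
    qed
    moreover have "permute_row L j (cyc y z) (j, x) = Some s" using c yz' by (simp add: permute_row_def)
    ultimately show ?thesis unfolding extensions_upd[OF xP] by (simp add: extensions_def)
  qed
  have "inj_on ?f ?S"
  proof (rule inj_onI)
    fix p p' assume "p \<in> ?S" "p' \<in> ?S" and eq: "?f p = ?f p'"
    obtain L y z where [simp]: "p = (L, y, z)" by (cases p)
    obtain L' y' z' where [simp]: "p' = (L', y', z')" by (cases p')
    have "surj (Transposition.transpose x y \<circ> Transposition.transpose y z)"
      by (rule comp_surj) simp_all
    then have surj: "surj (cyc y z)" by (auto simp only: cyc_def surj_id split: if_splits)
    have yz: "y = y'" "z = z'" and eq': "permute_row L j (cyc y z) = permute_row L' j (cyc y z)"
      using eq by auto
    from eq' have "L = L'" by (rule permute_row_inject[OF surj])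
    with yz show "p = p'" by simp
  qed
  moreover have "?f ` ?S \<subseteq> extensions k n ?P \<times> ({1..n} \<times> {1..n})"
    using f by (auto simp: W_def)
  ultimately have "card ?S \<le> card (extensions k n ?P \<times> ({1..n} \<times> {1..n}))" by (intro card_inj_on_le) auto
  also have "\<dots> = n\<^sup>2 * card (extensions k n ?P)" by (simp add: card_cartesian_product power2_eq_square)
  finally have "card ?S \<le> n\<^sup>2 * card (extensions k n ?P)" .
  moreover have "card ?S = (\<Sum>L\<in>D. card (W L))"
    by (intro card_SigmaI) (auto simp: finW D_def)
  moreover have "card D * (n - (row_size P j + 2 * k)) \<le> (\<Sum>L\<in>D. card (W L))"
    using sum_mono[of D "\<lambda>_. n - (row_size P j + 2 * k)", OF W] by simp
  ultimately show ?thesis unfolding D_def by simp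
qed

section \<open>The cost of prescribing cells\<close>

lemma card_extensions_upd_le:
  fixes d :: real
  assumes "(j, x) \<notin> dom P" "d \<le> real n - row_size P j - 2 * real k"
  shows "d * card (extensions k n (P((j, x) \<mapsto> s))) \<le> card (extensions k n P)"
proof -
  have "d \<le> real (n - (row_size P j + 2 * k))" using assms(2) by linarith
  then have "d * card (extensions k n (P((j, x) \<mapsto> s))) \<le> real (n - (row_size P j + 2 * k)) * card (extensions k n (P((j, x) \<mapsto> s)))"
    by (rule mult_right_mono) simp
  also have "\<dots> \<le> card (extensions k n P)"
    using card_extensions_upd_le_nat[OF assms(1), of k n s] by (metis mult.commute of_nat_le_iff of_nat_mult)
  finally show ?thesis .
qed

text \<open>The switching needs column \<open>x\<close> free of \<open>s\<close> in all other rows.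
  A rectangle with \<open>s\<close> in \<open>(i, x)\<close> violates this, but by the upper bound
  for one cell each of these fewer than \<open>k\<close> events has proportion at most
  \<open>1 / d\<close>. A proportion of at least \<open>1 - k / d\<close> remains, and
  multiplication by \<open>d\<close> yields \<open>d - k\<close>.\<close>

lemma card_extensions_upd_ge:
  fixes d :: real
  assumes j: "j \<in> {1..k}" and x: "x \<in> {1..n}" and s: "s \<in> {1..n}"
    and xP: "(j, x) \<notin> dom P" and sP: "\<And>y. P (j, y) \<noteq> Some s" and xs: "\<And>i. P (i, x) \<noteq> Some s"
    and d: "\<And>i. d \<le> real n - row_size P i - 2 * real k"
  shows "(d - k) * card (extensions k n P) \<le> (real n)\<^sup>2 * card (extensions k n (P((j, x) \<mapsto> s)))"
proof -
  let ?I = "{1..k} - {j}"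
  define D where "D = {L \<in> extensions k n P. \<forall>i\<in>?I. L (i, x) \<noteq> Some s}"
  define B where "B i = {L \<in> extensions k n P. L (i, x) = Some s}" for i
  have "d \<le> real (n - (row_size P j + 2 * k))" using d[of j] by linarith
  then have "d * card D \<le> real (n - (row_size P j + 2 * k)) * card D"
    by (rule mult_right_mono) simp
  also have "\<dots> \<le> real (n\<^sup>2 * card (extensions k n (P((j, x) \<mapsto> s))))"
    using card_extensions_avoid_le_nat[OF j x s xP sP] unfolding D_def
    by (metis (no_types, lifting) mult.commute of_nat_le_iff of_nat_mult)
  finally have 1: "d * card D \<le> (real n)\<^sup>2 * card (extensions k n (P((j, x) \<mapsto> s)))" by simp
  have B: "d * card (B i) \<le> card (extensions k n P)" for i
  proof (cases "(i, x) \<in> dom P")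
    case True
    have "B i = {}"
    proof -
      have False if "L \<in> B i" for L
      proof -
        have "L (i, x) = P (i, x)" using that True unfolding B_def extensions_def map_le_def by auto
        then show False using that xs by (simp add: B_def)
      qed
      then show ?thesis by blast
    qed
    then show ?thesis by simp
  next
    case False
    then show ?thesis using card_extensions_upd_le[OF False d] by (simp add: B_def extensions_upd)
  qed
  have "extensions k n P \<subseteq> D \<union> (\<Union>i\<in>?I. B i)" by (auto simp: D_def B_def)
  then have "card (extensions k n P) \<le> card (D \<union> (\<Union>i\<in>?I. B i))"
    by (intro card_mono) (auto simp: D_def B_def)
  also have "\<dots> \<le> card D + card (\<Union>i\<in>?I. B i)" by (rule card_Un_le)
  also have "\<dots> \<le> card D + (\<Sum>i\<in>?I. card (B i))" by (intro add_left_mono card_UN_le) simp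
  finally have "real (card (extensions k n P)) \<le> real (card D + (\<Sum>i\<in>?I. card (B i)))"
    by (simp only: of_nat_le_iff)
  then have 2: "real (card (extensions k n P)) \<le> card D + (\<Sum>i\<in>?I. real (card (B i)))"
    by (simp only: of_nat_add of_nat_sum)
  have "d * (\<Sum>i\<in>?I. real (card (B i))) \<le> (\<Sum>i\<in>?I. real (card (extensions k n P)))"
    unfolding sum_distrib_left by (intro sum_mono B)
  also have "\<dots> \<le> k * real (card (extensions k n P))"
    using j by (simp add: mult_right_mono)
  finally have 3: "d * (\<Sum>i\<in>?I. real (card (B i))) \<le> k * real (card (extensions k n P))" .
  show ?thesis
  proof (cases "d \<ge> 0")
    case True
    then have "d * card (extensions k n P) \<le> d * card D + d * (\<Sum>i\<in>?I. real (card (B i)))"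
      using mult_left_mono[OF 2 True] by (simp add: distrib_left)
    then show ?thesis using 1 3 by (simp add: left_diff_distrib)
  next
    case False
    then have "(d - k) * card (extensions k n P) \<le> 0" by (intro mult_nonpos_nonneg) auto
    then show ?thesis by (meson mult_nonneg_nonneg of_nat_0_le_iff order_trans zero_le_power2)
  qed
qed

lemma row_size_mono: "P \<subseteq>\<^sub>m Q \<Longrightarrow> finite (dom Q) \<Longrightarrow> row_size P i \<le> row_size Q i"
  unfolding row_size_def by (intro card_mono finite_row) (use map_le_implies_dom_le in blast)+

lemma map_le_induct [consumes 2, case_names refl step]:
  assumes "P \<subseteq>\<^sub>m Q" "finite (dom Q)" "H P"
    and "\<And>R c s. P \<subseteq>\<^sub>m R \<Longrightarrow> c \<notin> dom R \<Longrightarrow> R(c \<mapsto> s) \<subseteq>\<^sub>m Q \<Longrightarrow> H R \<Longrightarrow> H (R(c \<mapsto> s))"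
  shows "H Q"
proof -
  have "H R" if "P \<subseteq>\<^sub>m R" "R \<subseteq>\<^sub>m Q" "card (dom R - dom P) = m" for R m
    using that
  proof (induction m arbitrary: R)
    case 0
    have "finite (dom R)" using 0 assms(2) finite_subset map_le_implies_dom_le by blast
    then have "dom R \<subseteq> dom P" using 0 by simp
    then have "R \<subseteq>\<^sub>m P" using 0(1) unfolding map_le_def by (metis subsetD)
    then have "R = P" using 0(1) by (rule map_le_antisym)
    then show ?case using assms(3) by simp
  next
    case (Suc m)
    have fin: "finite (dom R)" using Suc assms(2) finite_subset map_le_implies_dom_le by blast
    have "dom R - dom P \<noteq> {}" using Suc.prems(3) by (metis card.empty nat.distinct(1))
    then obtain c where c: "c \<in> dom R" "c \<notin> dom P" by blast
    then obtain s where s: "R c = Some s" by blast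
    define R' where "R' = R |` (- {c})"
    have R: "R = R'(c \<mapsto> s)" using s by (auto simp: R'_def restrict_map_def)
    have c': "c \<notin> dom R'" by (auto simp: R'_def)
    have PR': "P \<subseteq>\<^sub>m R'" using Suc.prems(1) c by (auto simp: R'_def map_le_def restrict_map_def)
    have R'Q: "R' \<subseteq>\<^sub>m Q" unfolding R'_def by (rule map_le_trans[OF restrict_map_le Suc.prems(2)])
    have "dom R' - dom P = (dom R - dom P) - {c}" by (auto simp: R'_def)
    then have "card (dom R' - dom P) = m" using Suc.prems(3) c fin by simp
    then have "H R'" using Suc.IH PR' R'Q by blast
    then show ?case using assms(4)[OF PR' c'] Suc.prems(2) unfolding R by blast
  qed
  from this[OF assms(1) map_le_refl refl] show ?thesis .
qed

text \<open>Room is demanded only in rows that receive new cells, since a swap stays in its row.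
  This matters for seeds, which may nearly fill other rows.\<close>

lemma card_extensions_le:
  fixes d :: real
  assumes "P \<subseteq>\<^sub>m Q" "finite (dom Q)" "d \<ge> 0"
    and d: "\<And>i x. (i, x) \<in> dom Q - dom P \<Longrightarrow> d \<le> real n - row_size Q i - 2 * real k"
  shows "d ^ card (dom Q - dom P) * card (extensions k n Q) \<le> card (extensions k n P)"
  using assms(1,2)
proof (induction rule: map_le_induct)
  case (step R c s)
  obtain i x where c: "c = (i, x)" by (cases c)
  have fin: "finite (dom R)" using step(3) assms(2) map_le_implies_dom_le[OF step(3)]
    by (auto intro: finite_subset)
  have RQ: "R \<subseteq>\<^sub>m Q" by (rule map_le_trans[OF map_le_upd_fresh[OF step(2)] step(3)])
  have cP: "c \<notin> dom P" using step(2) map_le_implies_dom_le[OF step(1)] by blast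
  then have "(i, x) \<in> dom Q - dom P" using map_le_implies_dom_le[OF step(3)] c by auto
  then have "d \<le> real n - row_size R i - 2 * real k"
    using d[of i x] row_size_mono[OF RQ assms(2), of i] by linarith
  then have "d * card (extensions k n (R(c \<mapsto> s))) \<le> card (extensions k n R)"
    using card_extensions_upd_le step(2) unfolding c by blast
  then have "d ^ card (dom R - dom P) * (d * card (extensions k n (R(c \<mapsto> s)))) \<le> card (extensions k n P)"
    using step(4) mult_left_mono[of _ _ "d ^ card (dom R - dom P)"] assms(3) by (meson order_trans zero_le_power)
  moreover have "card (dom (R(c \<mapsto> s)) - dom P) = Suc (card (dom R - dom P))"
  proof -
    have "dom (R(c \<mapsto> s)) - dom P = insert c (dom R - dom P)" using cP by auto
    then show ?thesis using fin step(2) by simp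
  qed
  ultimately show ?case by (simp only: power_Suc mult_ac)
qed simp

text \<open>In contrast to the upper bound, room is demanded in every row, because the events that
  block a switching may occur in any other row of the column concerned.\<close>

lemma card_extensions_ge:
  fixes d :: real
  assumes "P \<subseteq>\<^sub>m Q" and Q: "latin Q" and "k \<le> d"
    and box: "dom Q \<subseteq> {1..k} \<times> {1..n}" "ran Q \<subseteq> {1..n}"
    and d: "\<And>i. d \<le> real n - row_size Q i - 2 * real k"
  shows "(d - k) ^ card (dom Q - dom P) * card (extensions k n P)
    \<le> ((real n)\<^sup>2) ^ card (dom Q - dom P) * card (extensions k n Q)"
  using assms(1) latinD_finite[OF Q]
proof (induction rule: map_le_induct)
  case (step R c s)
  obtain i x where c: "c = (i, x)" by (cases c)
  have fin: "finite (dom R)" using step(3) latinD_finite[OF Q] map_le_implies_dom_le[OF step(3)]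
    by (auto intro: finite_subset)
  have RQ: "R \<subseteq>\<^sub>m Q" by (rule map_le_trans[OF map_le_upd_fresh[OF step(2)] step(3)])
  have cP: "c \<notin> dom P" using step(2) map_le_implies_dom_le[OF step(1)] by blast
  have cQ: "Q (i, x) = Some s" using map_le_SomeD[OF step(3), of c s] c by simp
  have "(d - k) * card (extensions k n R) \<le> (real n)\<^sup>2 * card (extensions k n (R(c \<mapsto> s)))"
    unfolding c
  proof (rule card_extensions_upd_ge)
    show "i \<in> {1..k}" "x \<in> {1..n}" "s \<in> {1..n}" using cQ box ranI[of Q "(i, x)" s] by auto
    show "(i, x) \<notin> dom R" using step(2) c by simp
    show "R (i, y) \<noteq> Some s" for y
    proof
      assume R: "R (i, y) = Some s"
      then have "Q (i, y) = Some s" by (rule map_le_SomeD[OF RQ])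
      then have "y = x" using latinD_row[OF Q] cQ by blast
      then show False using R step(2) c by auto
    qed
    show "R (i', x) \<noteq> Some s" for i'
    proof
      assume R: "R (i', x) = Some s"
      then have "Q (i', x) = Some s" by (rule map_le_SomeD[OF RQ])
      then have "i' = i" using latinD_col[OF Q] cQ by blast
      then show False using R step(2) c by auto
    qed
    show "d \<le> real n - row_size R i' - 2 * real k" for i'
      using d[of i'] row_size_mono[OF RQ latinD_finite[OF Q], of i'] by linarith
  qed
  then have "((real n)\<^sup>2) ^ card (dom R - dom P) * ((d - k) * card (extensions k n R))
      \<le> ((real n)\<^sup>2) ^ card (dom R - dom P) * ((real n)\<^sup>2 * card (extensions k n (R(c \<mapsto> s))))"
    by (rule mult_left_mono) simp
  moreover have "(d - k) * ((d - k) ^ card (dom R - dom P) * card (extensions k n P))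
      \<le> (d - k) * (((real n)\<^sup>2) ^ card (dom R - dom P) * card (extensions k n R))"
    using step(4) assms(3) by (intro mult_left_mono) auto
  moreover have "card (dom (R(c \<mapsto> s)) - dom P) = Suc (card (dom R - dom P))"
  proof -
    have "dom (R(c \<mapsto> s)) - dom P = insert c (dom R - dom P)" using cP by auto
    then show ?thesis using fin step(2) by simp
  qed
  ultimately show ?case by (simp only: power_Suc mult_ac)
qed simp

lemma latin_rectangles_nonempty:
  assumes "k \<le> n" "n \<ge> 1" shows "latin_rectangles k n \<noteq> {}"
proof -
  define L :: partial_array where
    "L = (\<lambda>(i, x). if i \<in> {1..k} \<and> x \<in> {1..n} then Some ((i + x) mod n + 1) else None)"
  have inj: "x = y" if "(a + x) mod n = (a + y) mod n" "x \<in> {1..n}" "y \<in> {1..n}" for a x y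
  proof (rule ccontr)
    assume "x \<noteq> y"
    then consider "x < y" | "y < x" by linarith
    then show False
    proof cases
      case 1
      then have "n dvd y - x" using that(1) mod_eq_dvd_iff_nat[of "a + x" "a + y" n] by simp
      then show False using 1 that(2,3) by (auto dest: dvd_imp_le)
    next
      case 2
      then have "n dvd x - y" using that(1) mod_eq_dvd_iff_nat[of "a + y" "a + x" n] by simp
      then show False using 2 that(2,3) by (auto dest: dvd_imp_le)
    qed
  qed
  have "L \<in> latin_rectangles k n"
    unfolding latin_rectangles_def partial_latin_square_def
  proof (intro CollectI conjI allI impI)
    show "dom L = {1..k} \<times> {1..n}" "dom L \<subseteq> {1..k} \<times> {1..n}" by (auto simp: L_def split: if_splits)
    show "ran L \<subseteq> {1..n}" using assms by (auto simp: L_def ran_def Suc_le_eq split: if_splits)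
  next
    fix i x y s assume "L (i, x) = Some s \<and> L (i, y) = Some s"
    then show "x = y" using inj[of i x y] by (auto simp: L_def split: if_splits)
  next
    fix i j x s assume "L (i, x) = Some s \<and> L (j, x) = Some s"
    then show "i = j" using inj[of x i j] assms by (auto simp: L_def add.commute split: if_splits)
  qed
  then show ?thesis by blast
qed

section \<open>Conditional means and moments\<close>

definition quads :: "nat \<Rightarrow> nat \<Rightarrow> (nat \<times> nat \<times> nat \<times> nat) set" where
  "quads k n = {(i, j, x, y). i \<in> {1..k} \<and> j \<in> {1..k} \<and> x \<in> {1..n} \<and> y \<in> {1..n} \<and> i < j \<and> x < y}"

text \<open>The weight allows one factor of a power of the number of intercalates to be expanded as
  a sum over positions while the remaining power is kept.\<close>

lemma sum_weighted_double_count: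
  fixes w :: "'a \<Rightarrow> real"
  assumes "finite A" "finite Q"
  shows "(\<Sum>L\<in>A. real (card {q \<in> Q. E q L}) * w L) = (\<Sum>q\<in>Q. \<Sum>L\<in>{L \<in> A. E q L}. w L)"
proof -
  have "(\<Sum>L\<in>A. real (card {q \<in> Q. E q L}) * w L) = (\<Sum>L\<in>A. \<Sum>q\<in>Q. if E q L then w L else 0)"
    using assms by (intro sum.cong refl) (simp flip: sum.inter_filter)
  also have "\<dots> = (\<Sum>q\<in>Q. \<Sum>L\<in>A. if E q L then w L else 0)" by (rule sum.swap)
  also have "\<dots> = (\<Sum>q\<in>Q. \<Sum>L\<in>{L \<in> A. E q L}. w L)"
    using assms by (intro sum.cong[OF refl, of Q]) (simp flip: sum.inter_filter)
  finally show ?thesis .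
qed

lemma sum_double_count:
  assumes "finite A" "finite Q"
  shows "(\<Sum>L\<in>A. real (card {q \<in> Q. E q L})) = (\<Sum>q\<in>Q. real (card {L \<in> A. E q L}))"
  using sum_weighted_double_count[OF assms, where w = "\<lambda>_. 1"] by simp

lemma card_ordered_pairs:
  fixes X :: "nat set"
  assumes "finite X"
  shows "2 * card {(i, j). i \<in> X \<and> j \<in> X \<and> i < j} = card X * (card X - 1)"
proof -
  let ?U = "{(i, j). i \<in> X \<and> j \<in> X \<and> i < j}" and ?V = "{(i, j). i \<in> X \<and> j \<in> X \<and> j < i}"
  have fin: "finite ?U" "finite ?V" by (rule finite_subset[of _ "X \<times> X"]; use assms in auto)+
  have "bij_betw prod.swap ?U ?V" by (rule bij_betwI[where g = prod.swap]) auto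
  then have "card ?V = card ?U" by (simp add: bij_betw_same_card)
  moreover have "?U \<union> ?V = (SIGMA i:X. X - {i})" by auto
  moreover have "card (?U \<union> ?V) = card ?U + card ?V" by (rule card_Un_disjoint[OF fin]) auto
  moreover have "card (SIGMA i:X. X - {i}) = card X * (card X - 1)"
    using assms by (simp add: card_SigmaI)
  ultimately show ?thesis by simp
qed

lemma finite_quads [simp]: "finite (quads k n)"
  by (rule finite_subset[of _ "{1..k} \<times> {1..k} \<times> {1..n} \<times> {1..n}"]) (auto simp: quads_def)

lemma card_quads_le: "real (card (quads k n)) \<le> (real k)\<^sup>2 * (real n)\<^sup>2 / 4"
proof -
  have half: "real (card {(i, j). i \<in> {1..m} \<and> j \<in> {1..m} \<and> i < j}) \<le> (real m)\<^sup>2 / 2" for m :: nat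
  proof -
    have "2 * card {(i, j). i \<in> {1..m} \<and> j \<in> {1..m} \<and> i < j} \<le> m * m"
      using card_ordered_pairs[of "{1..m}"] by simp
    then have "real (2 * card {(i, j). i \<in> {1..m} \<and> j \<in> {1..m} \<and> i < j}) \<le> real (m * m)"
      by (simp only: of_nat_le_iff)
    then show ?thesis by (simp add: power2_eq_square)
  qed
  let ?I = "\<lambda>m :: nat. {(i, j). i \<in> {1..m} \<and> j \<in> {1..m} \<and> i < j}"
  have fin: "finite (?I m)" for m :: nat by (rule finite_subset[of _ "{1..m} \<times> {1..m}"]) auto
  have "card (quads k n) \<le> card (?I k \<times> ?I n)"
  proof (rule card_inj_on_le[of "\<lambda>(i, j, x, y). ((i, j), (x, y))"])
    show "finite (?I k \<times> ?I n)" using fin by (intro finite_cartesian_product)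
  qed (auto simp: inj_on_def quads_def)
  then have "real (card (quads k n)) \<le> real (card (?I k)) * real (card (?I n))"
    by (simp only: card_cartesian_product of_nat_le_iff flip: of_nat_mult)
  also have "\<dots> \<le> ((real k)\<^sup>2 / 2) * ((real n)\<^sup>2 / 2)" by (intro mult_mono half) auto
  finally show ?thesis by simp
qed

lemma intercalates_latin_rectangle:
  assumes "L \<in> latin_rectangles k n"
  shows "intercalates L = {(i, j, x, y) \<in> quads k n. L (i, x) = L (j, y) \<and> L (i, y) = L (j, x)}"
  unfolding intercalates_def latin_rectangles_dom[OF assms] quads_def by auto

section \<open>Revealing cells and the conditional mean\<close>

text \<open>All rectangles of the given size have the same domain. Hence the rectangles agreeing
  with \<open>L0\<close> on \<open>D\<close> form a set of extensions again, and revealing the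
  entries on \<open>D\<close> partitions \<open>extensions k n S\<close> into sets of the same
  kind.\<close>

lemma extensions_restrict:
  assumes L0: "L0 \<in> extensions k n S" and D: "dom S \<subseteq> D"
  shows "extensions k n (L0 |` D) = {L \<in> extensions k n S. L |` D = L0 |` D}"
proof (intro equalityI subsetI CollectI conjI)
  fix L assume L: "L \<in> extensions k n (L0 |` D)"
  have S: "S \<subseteq>\<^sub>m L0 |` D" using extensionsD(2)[OF L0] D by (auto simp: map_le_def restrict_map_def)
  then show "L \<in> extensions k n S" using L extensions_mono by blast
  have dom: "dom L = dom L0" 
    unfolding latin_rectangles_dom[OF extensionsD(1)[OF L]] latin_rectangles_dom[OF extensionsD(1)[OF L0]] ..
  show "L |` D = L0 |` D"
  proof
    fix c
    show "(L |` D) c = (L0 |` D) c"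
    proof (cases "c \<in> D \<and> c \<in> dom L0")
      case True
      then have "c \<in> dom (L0 |` D)" by auto
      then have "(L0 |` D) c = L c" using extensionsD(2)[OF L] by (simp add: map_le_def)
      then show ?thesis using True by simp
    next
      case False
      moreover have "L c = None \<longleftrightarrow> L0 c = None" using dom by (metis domIff)
      ultimately show ?thesis by (auto simp: restrict_map_def)
    qed
  qed
next
  fix L assume "L \<in> {L \<in> extensions k n S. L |` D = L0 |` D}"
  then show "L \<in> extensions k n (L0 |` D)"
    unfolding extensions_def using restrict_map_le[of L D] by auto
qed

lemma sum_extensions_group:
  fixes w :: "partial_array \<Rightarrow> real"
  assumes "A \<subseteq> extensions k n S" "dom S \<subseteq> D"
  shows "(\<Sum>L\<in>A. w L) = (\<Sum>S'\<in>(\<lambda>L. L |` D) ` A. \<Sum>L\<in>extensions k n S' \<inter> A. w L)"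
proof -
  have "(\<Sum>L\<in>A. w L) = (\<Sum>S'\<in>(\<lambda>L. L |` D) ` A. \<Sum>L\<in>{L \<in> A. L |` D = S'}. w L)"
    by (rule sum.image_gen) (use assms(1) finite_subset in \<open>auto intro: finite_subset\<close>)
  also have "\<dots> = (\<Sum>S'\<in>(\<lambda>L. L |` D) ` A. \<Sum>L\<in>extensions k n S' \<inter> A. w L)"
  proof (rule sum.cong[OF refl], rule sum.cong[OF _ refl])
    fix S' assume "S' \<in> (\<lambda>L. L |` D) ` A"
    then obtain L0 where "L0 \<in> A" "S' = L0 |` D" by blast
    then show "{L \<in> A. L |` D = S'} = extensions k n S' \<inter> A"
      using extensions_restrict[OF _ assms(2), of L0 k n] assms(1) by auto
  qed
  finally show ?thesis .
qed

text \<open>Law of total probability: a bound that holds whatever is revealed on \<open>D\<close>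
  holds without revealing anything. Thus entries that depend on the rectangle may be treated as
  known before further cells are prescribed.\<close>

lemma refine_card_le:
  fixes c :: real
  assumes D: "dom S \<subseteq> D"
    and le: "\<And>L0. L0 \<in> extensions k n S \<Longrightarrow>
      c * card {L \<in> extensions k n (L0 |` D). E L} \<le> card (extensions k n (L0 |` D))"
  shows "c * card {L \<in> extensions k n S. E L} \<le> card (extensions k n S)"
proof -
  let ?A = "extensions k n S" and ?R = "(\<lambda>L. L |` D) ` extensions k n S"
  have sub: "extensions k n S' \<inter> ?A = extensions k n S'" if "S' \<in> ?R" for S'
    using that extensions_restrict[OF _ D] by auto
  have eq: "(\<Sum>L\<in>?A. w L) = (\<Sum>S'\<in>?R. \<Sum>L\<in>extensions k n S'. w L)" for w :: "partial_array \<Rightarrow> real"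
    unfolding sum_extensions_group[OF order_refl D] by (intro sum.cong refl sub)
  have "c * card {L \<in> ?A. E L} = c * (\<Sum>L\<in>?A. if E L then 1 else 0)"
    by (simp flip: sum.inter_filter)
  also have "\<dots> = (\<Sum>S'\<in>?R. c * (\<Sum>L\<in>extensions k n S'. if E L then 1 else 0))"
    unfolding eq sum_distrib_left ..
  also have "\<dots> = (\<Sum>S'\<in>?R. c * card {L \<in> extensions k n S'. E L})"
    by (simp flip: sum.inter_filter)
  also have "\<dots> \<le> (\<Sum>S'\<in>?R. real (card (extensions k n S')))"
    by (rule sum_mono) (use le in auto)
  also have "\<dots> = card ?A" using eq[of "\<lambda>_. 1"] by simp
  finally show ?thesis .
qed

text \<open>Reveal \<open>(b, u)\<close> and \<open>(b, v)\<close>. The event then prescribes the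
  symbols of the two free cells of row \<open>a\<close>, at a cost of \<open>1 / d\<close> each. Row
  \<open>b\<close> may be as full as it likes; the term 2 in the hypothesis makes room for the two
  new cells of row \<open>a\<close>.\<close>

lemma card_extensions_two_cells_le:
  fixes d :: real
  assumes rows: "a \<noteq> b" "b \<in> {1..k}" and cols: "u \<noteq> v" "u \<in> {1..n}" "v \<in> {1..n}"
    and fresh: "(a, u) \<notin> dom S" "(a, v) \<notin> dom S"
    and d: "0 \<le> d" "d \<le> real n - row_size S a - 2 - 2 * real k"
  shows "d\<^sup>2 * card {L \<in> extensions k n S. L (a, u) = L (b, v) \<and> L (a, v) = L (b, u)}
    \<le> card (extensions k n S)"
proof (rule refine_card_le)
  let ?D = "dom S \<union> {(b, u), (b, v)}"
  show "dom S \<subseteq> ?D" by blast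
  fix L0 assume L0: "L0 \<in> extensions k n S"
  note L0' = extensionsD[OF L0]
  obtain s where s: "L0 (b, v) = Some s" by (rule latin_rectangles_filled[OF L0'(1) rows(2) cols(3)])
  obtain t where t: "L0 (b, u) = Some t" by (rule latin_rectangles_filled[OF L0'(1) rows(2) cols(2)])
  let ?S = "L0 |` ?D" 
  let ?T = "?S((a, u) \<mapsto> s, (a, v) \<mapsto> t)"
  have domS: "dom ?S = ?D" using s t map_le_implies_dom_le[OF L0'(2)] by auto
  have fin: "finite (dom S)"
    by (rule finite_subset[OF map_le_implies_dom_le[OF L0'(2)]]) (simp add: latin_rectangles_dom[OF L0'(1)])
  have fresh1: "(a, u) \<notin> dom ?S" unfolding domS using rows fresh by auto
  have fresh2: "(a, v) \<notin> dom (?S((a, u) \<mapsto> s))" unfolding dom_fun_upd domS using rows fresh cols by auto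
  have sub: "{L \<in> extensions k n ?S. L (a, u) = L (b, v) \<and> L (a, v) = L (b, u)} \<subseteq> extensions k n ?T"
  proof
    fix L assume L: "L \<in> {L \<in> extensions k n ?S. L (a, u) = L (b, v) \<and> L (a, v) = L (b, u)}"
    then have le: "?S \<subseteq>\<^sub>m L" by (simp add: extensions_def)
    have "?S (b, v) = Some s" "?S (b, u) = Some t" using s t by simp_all
    then have "L (b, v) = Some s" "L (b, u) = Some t" by (auto intro: map_le_SomeD[OF le])
    with L show "L \<in> extensions k n ?T"
      unfolding extensions_upd[OF fresh2] extensions_upd[OF fresh1] by simp
  qed
  have diff: "dom ?T - dom ?S = {(a, u), (a, v)}"
    unfolding dom_fun_upd domS using rows fresh by auto
  have row: "row_size ?T a \<le> row_size S a + 2"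
  proof -
    have "{x. (a, x) \<in> dom ?T} \<subseteq> {x. (a, x) \<in> dom S} \<union> {u, v}"
      unfolding dom_fun_upd domS using rows by auto
    then have "row_size ?T a \<le> card ({x. (a, x) \<in> dom S} \<union> {u, v})"
      unfolding row_size_def using finite_row[OF fin] by (intro card_mono) auto
    also have "\<dots> \<le> row_size S a + card {u, v}" unfolding row_size_def by (rule card_Un_le)
    finally show ?thesis using cols(1) by simp
  qed
  have "d ^ card (dom ?T - dom ?S) * card (extensions k n ?T) \<le> card (extensions k n ?S)"
  proof (rule card_extensions_le)
    show "?S \<subseteq>\<^sub>m ?T" using fresh1 fresh2 by (meson map_le_trans map_le_upd_fresh)
    show "finite (dom ?T)" unfolding dom_fun_upd domS using fin by simp
    show "0 \<le> d" by (rule d)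
    show "d \<le> real n - row_size ?T i - 2 * real k" if "(i, x) \<in> dom ?T - dom ?S" for i x
      using that row d unfolding diff by auto
  qed
  moreover have "card {L \<in> extensions k n ?S. L (a, u) = L (b, v) \<and> L (a, v) = L (b, u)} \<le> card (extensions k n ?T)"
    by (rule card_mono[OF finite_extensions sub])
  ultimately show "d\<^sup>2 * card {L \<in> extensions k n ?S. L (a, u) = L (b, v) \<and> L (a, v) = L (b, u)}
      \<le> card (extensions k n ?S)"
    using cols(1) unfolding diff
    by (simp add: power2_eq_square) (meson mult_left_mono mult_nonneg_nonneg d(1) of_nat_le_iff order_trans)
qed

text \<open>Reveal all of row \<open>b\<close>. The symbol \<open>s\<close> of \<open>(a, u)\<close>
  occurs there in a single column \<open>w\<close>, so only \<open>v = w\<close> is possible and the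
  event prescribes one cell. The quantifier over \<open>v\<close> therefore costs nothing: a
  prescribed cell contributes \<open>1 / d\<close> per row \<open>b\<close>, not per row and
  column.\<close>

lemma card_extensions_one_cell_le:
  fixes d :: real
  assumes rows: "a \<noteq> b" "b \<in> {1..k}" and u: "u \<in> {1..n}" and s: "S (a, u) = Some s"
    and d: "0 \<le> d" "d \<le> real n - row_size S a - 2 * real k"
  shows "d * card {L \<in> extensions k n S. \<exists>v. (a, v) \<notin> dom S \<and> L (b, v) = Some s \<and> L (a, v) = L (b, u)}
    \<le> card (extensions k n S)"
proof (rule refine_card_le)
  let ?D = "dom S \<union> {b} \<times> {1..n}"
  show "dom S \<subseteq> ?D" by blast
  fix L0 assume L0: "L0 \<in> extensions k n S"
  note L0' = extensionsD[OF L0]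
  note lat = latin_rectangles_latin[OF L0'(1)]
  obtain t where t: "L0 (b, u) = Some t" by (rule latin_rectangles_filled[OF L0'(1) rows(2) u])
  have "L0 (a, u) = Some s" using map_le_SomeD[OF L0'(2) s] .
  then have sn: "s \<in> {1..n}" using latin_rectangles_Some(3)[OF L0'(1)] by blast
  obtain w where w: "L0 (b, w) = Some s" "w \<in> {1..n}" by (rule latin_rectangles_symbol[OF L0'(1) rows(2) sn])
  let ?S = "L0 |` ?D" 
  let ?E = "{L \<in> extensions k n ?S. \<exists>v. (a, v) \<notin> dom S \<and> L (b, v) = Some s \<and> L (a, v) = L (b, u)}"
  have E: "(a, w) \<notin> dom S \<and> L (a, w) = Some t" if L: "L \<in> ?E" for L
  proof -
    from L obtain v where v: "(a, v) \<notin> dom S" "L (b, v) = Some s" "L (a, v) = L (b, u)" by blast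
    from L have LL: "?S \<subseteq>\<^sub>m L" "L \<in> latin_rectangles k n" by (simp_all add: extensions_def)
    have "?S (b, u) = Some t" "?S (b, w) = Some s" using t w u by simp_all
    then have "L (b, u) = Some t" "L (b, w) = Some s" by (auto intro: map_le_SomeD[OF LL(1)])
    moreover have "v = w" using latinD_row[OF latin_rectangles_latin[OF LL(2)] v(2)] calculation by blast
    ultimately show ?thesis using v by simp
  qed
  show "d * card ?E \<le> card (extensions k n ?S)"
  proof (cases "(a, w) \<in> dom S")
    case True
    then have E0: "?E = {}" using E by blast
    show ?thesis unfolding E0 by simp
  next
    case False
    then have fresh: "(a, w) \<notin> dom ?S" using rows by auto
    have "?E \<subseteq> extensions k n (?S((a, w) \<mapsto> t))"
      unfolding extensions_upd[OF fresh] using E by blast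
    then have "card ?E \<le> card (extensions k n (?S((a, w) \<mapsto> t)))" by (rule card_mono[OF finite_extensions])
    then have "d * card ?E \<le> d * card (extensions k n (?S((a, w) \<mapsto> t)))"
      using d(1) by (intro mult_left_mono) auto
    also have "\<dots> \<le> card (extensions k n ?S)"
    proof (rule card_extensions_upd_le[OF fresh])
      have "finite (dom S)"
        by (rule finite_subset[OF map_le_implies_dom_le[OF L0'(2)]]) (simp add: latin_rectangles_dom[OF L0'(1)])
      moreover have "{x. (a, x) \<in> dom ?S} \<subseteq> {x. (a, x) \<in> dom S}" using rows by auto
      ultimately have "row_size ?S a \<le> row_size S a"
        unfolding row_size_def by (intro card_mono finite_row)
      then show "d \<le> real n - row_size ?S a - 2 * real k" using d by linarith
    qed
    finally show ?thesis .
  qed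
qed

text \<open>Rows with more than \<open>r\<close> prescribed cells are bad. The third to fifth summands bound intercalates that have
  a row with exactly one prescribed cell, or a bad row.\<close>

lemma sum_intercalates_extensions_le:
  fixes d r :: real
  assumes finS: "finite (dom S)" and r: "r > 0" and d: "d > 0" "d \<le> real n - r - 2 - 2 * real k"
  defines "\<sigma> \<equiv> real (card (dom S))"
  shows "(\<Sum>L\<in>extensions k n S. real (num_intercalates L)) \<le> card (extensions k n S) *
    (num_intercalates S + (real k)\<^sup>2 * (real n)\<^sup>2 / (4 * d\<^sup>2) + \<sigma> * k / d + \<sigma>\<^sup>2 / r + \<sigma>\<^sup>2 * n / r\<^sup>2)"
proof -
  let ?X = "extensions k n S"
  define good where "good a \<longleftrightarrow> row_size S a \<le> r" for a
  define bad where "bad = {a. \<not> good a}"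
  have row0: "row_size S a = 0" if "a \<notin> fst ` dom S" for a
  proof -
    have "{x. (a, x) \<in> dom S} = {}" using that by force
    then show ?thesis unfolding row_size_def by simp
  qed
  have badsub: "bad \<subseteq> fst ` dom S" unfolding bad_def good_def using row0 r by force
  have finbad: "finite bad" using badsub finS finite_subset by blast
  have bad: "card bad \<le> \<sigma> / r"
  proof -
    have "r * card bad \<le> card (dom S)"
      by (rule card_large_fibres[OF finS badsub]) (simp add: bad_def good_def flip: row_size_fibre)
    then show ?thesis using r by (simp add: \<sigma>_def field_simps)
  qed
  \<comment> \<open>Positions with a good row both of whose cells are free: the bound for two cells
    applies, and they produce the main term.\<close>
  define QA where "QA = {(i, j, x, y) \<in> quads k n. (good j \<and> (j, x) \<notin> dom S \<and> (j, y) \<notin> dom S) \<or>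
      (good i \<and> (i, x) \<notin> dom S \<and> (i, y) \<notin> dom S)}"
  define A where "A L = {q \<in> QA. q \<in> intercalates L}" for L
  \<comment> \<open>A prescribed cell of a good row together with the other row of an intercalate;
    the event \<open>EB\<close> says that they span an intercalate whose second cell in the good row
    is free.\<close>
  define TB where "TB = {((a, u), b). (a, u) \<in> dom S \<and> b \<in> {1..k} \<and> good a \<and> a \<noteq> b \<and> u \<in> {1..n}}"
  define EB where "EB p L = (case p of ((a, u), b) \<Rightarrow> \<exists>v. (a, v) \<notin> dom S \<and> L (b, v) = S (a, u) \<and> L (a, v) = L (b, u))"
    for p and L :: partial_array
  define B where "B L = {p \<in> TB. EB p L}" for L
  have finQA: "finite QA" by (rule finite_subset[of _ "quads k n"]) (auto simp: QA_def)
  have finTB: "finite TB" by (rule finite_subset[of _ "dom S \<times> {1..k}"]) (use finS in \<open>auto simp: TB_def\<close>)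
  have main: "real (num_intercalates L) \<le> num_intercalates S + card (A L) + card (B L) + \<sigma>\<^sup>2 / r + \<sigma>\<^sup>2 * n / r\<^sup>2"
    if L: "L \<in> ?X" for L
  proof -
    note L' = extensionsD[OF L]
    note lat = latin_rectangles_latin[OF L'(1)]
    \<comment> \<open>In a fixed rectangle a corner and the other row determine the intercalate: its
      second column is where the other row holds the symbol of the corner. \<open>F\<close> performs
      this reconstruction, so it suffices to count pairs of a cell and a row.\<close>
    define col where "col b s = (THE v. L (b, v) = Some s)" for b s
    have col: "col b s = v" if "L (b, v) = Some s" for b s v
      unfolding col_def using that latinD_row[OF lat] by blast
    define F where "F = (\<lambda>((a, u), b). sort_quad (a, b, u, col b (the (L (a, u)))))"
    have F: "F ((a, u), b) = sort_quad (a, b, u, v)" if "L (a, u) = L (b, v)" "L (a, u) \<noteq> None" for a u b v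
      using that col[of b v "the (L (a, u))"] by (auto simp: F_def)
    \<comment> \<open>What is left when a bad row occurs: a prescribed cell facing a bad row, or two
      bad rows. There are at most \<open>\<sigma> / r\<close> bad rows, so these are simply counted,
      without any probability.\<close>
    let ?D = "dom S \<times> bad" and ?Z = "(bad \<times> {1..n}) \<times> bad"
    have "intercalates L \<subseteq> intercalates S \<union> A L \<union> F ` B L \<union> F ` ?D \<union> F ` ?Z"
    proof
      fix q assume q: "q \<in> intercalates L"
      obtain i j x y where [simp]: "q = (i, j, x, y)" by (cases q)
      have Q: "q \<in> quads k n" "L (i, x) = L (j, y)" "L (i, y) = L (j, x)"
        using q unfolding intercalates_latin_rectangle[OF L'(1)] by auto
      have ij: "i \<in> {1..k}" "j \<in> {1..k}" "x \<in> {1..n}" "y \<in> {1..n}" "i < j" "x < y"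
        using Q(1) unfolding quads_def by auto
      have nn: "L (i, x) \<noteq> None" "L (i, y) \<noteq> None" "L (j, x) \<noteq> None" "L (j, y) \<noteq> None"
        using latin_rectangles_dom[OF L'(1)] ij by (auto simp: dom_def set_eq_iff)
      have Fq: "F ((i, x), j) = q" "F ((i, y), j) = q" "F ((j, x), i) = q" "F ((j, y), i) = q"
        using F[of i x j y] F[of i y j x] F[of j x i y] F[of j y i x] Q nn ij by (auto simp: sort_quad_def)
      have SL: "c \<in> dom S \<Longrightarrow> S c = L c" for c using L'(2) by (simp add: map_le_def)
      have inB: "q \<in> F ` B L" if "good a" "(a, u) \<in> dom S" "(a, v) \<notin> dom S"
        "(a, b) \<in> {(i, j), (j, i)}" "(u, v) \<in> {(x, y), (y, x)}" for a b u v
      proof -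
        have "((a, u), b) \<in> B L" "F ((a, u), b) = q"
          using that ij Q SL[of "(a, u)"] Fq unfolding B_def TB_def EB_def by auto
        then show ?thesis by (metis image_eqI)
      qed
      have inD: "q \<in> F ` ?D" if "b \<in> bad" "(a, x) \<in> dom S" "(a, b) \<in> {(i, j), (j, i)}" for a b
      proof -
        have "((a, x), b) \<in> ?D" "F ((a, x), b) = q" using that Fq by auto
        then show ?thesis by (metis image_eqI)
      qed
      have inZ: "q \<in> F ` ?Z" if "i \<in> bad" "j \<in> bad"
      proof -
        have "((i, x), j) \<in> ?Z" "F ((i, x), j) = q" using that ij Fq by auto
        then show ?thesis by (metis image_eqI)
      qed
      have inS: "q \<in> intercalates S" if "(i, x) \<in> dom S" "(i, y) \<in> dom S" "(j, x) \<in> dom S" "(j, y) \<in> dom S"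
        using that SL[OF that(1)] SL[OF that(2)] SL[OF that(3)] SL[OF that(4)] Q ij
        unfolding intercalates_def by simp
      show "q \<in> intercalates S \<union> A L \<union> F ` B L \<union> F ` ?D \<union> F ` ?Z"
      proof (cases "q \<in> QA")
        case True
        then show ?thesis using q by (simp add: A_def)
      next
        case False
        then have nj: "good j \<Longrightarrow> (j, x) \<in> dom S \<or> (j, y) \<in> dom S"
          and ni: "good i \<Longrightarrow> (i, x) \<in> dom S \<or> (i, y) \<in> dom S"
          using Q(1) unfolding QA_def by auto
        show ?thesis
        proof (cases "good i"; cases "good j")
          assume g: "good i" "good j"
          then show ?thesis
            using ni nj inS inB[of i x y j] inB[of i y x j] inB[of j x y i] inB[of j y x i] by blast
        next
          assume g: "good i" "\<not> good j"
          then show ?thesis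
            using ni inD[of j i] inB[of i x y j] inB[of i y x j] unfolding bad_def by blast
        next
          assume g: "\<not> good i" "good j"
          then show ?thesis
            using nj inD[of i j] inB[of j x y i] inB[of j y x i] unfolding bad_def by blast
        next
          assume g: "\<not> good i" "\<not> good j"
          then show ?thesis using inZ unfolding bad_def by blast
        qed
      qed
    qed
    moreover have fin: "finite (intercalates S)" "finite (A L)" "finite (B L)" "finite ?D" "finite ?Z"
      using finS finQA finTB finbad unfolding A_def B_def by simp_all
    ultimately have "num_intercalates L \<le> card (intercalates S \<union> A L \<union> F ` B L \<union> F ` ?D \<union> F ` ?Z)"
      unfolding num_intercalates_def by (intro card_mono) auto
    also have "\<dots> \<le> num_intercalates S + card (A L) + card (B L) + card ?D + card ?Z"
      using card_Un_le[of "intercalates S \<union> A L \<union> F ` B L \<union> F ` ?D" "F ` ?Z"]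
        card_Un_le[of "intercalates S \<union> A L \<union> F ` B L" "F ` ?D"] card_Un_le[of "intercalates S \<union> A L" "F ` B L"]
        card_Un_le[of "intercalates S" "A L"] card_image_le[OF fin(3), of F] card_image_le[OF fin(4), of F]
        card_image_le[OF fin(5), of F]
      unfolding num_intercalates_def by linarith
    finally have "real (num_intercalates L) \<le> num_intercalates S + card (A L) + card (B L) + card ?D + card ?Z"
      by (simp only: of_nat_le_iff flip: of_nat_add)
    moreover have "real (card ?D) \<le> \<sigma>\<^sup>2 / r"
    proof -
      have "real (card ?D) = \<sigma> * card bad" by (simp add: card_cartesian_product \<sigma>_def)
      also have "\<dots> \<le> \<sigma> * (\<sigma> / r)" by (intro mult_left_mono bad) (simp add: \<sigma>_def)
      finally show ?thesis by (simp add: power2_eq_square)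
    qed
    moreover have "real (card ?Z) \<le> \<sigma>\<^sup>2 * n / r\<^sup>2"
    proof -
      have "real (card ?Z) = real (card bad) * real (card bad) * real n" by (simp add: card_cartesian_product)
      also have "\<dots> \<le> (\<sigma> / r) * (\<sigma> / r) * n"
        using r by (intro mult_right_mono mult_mono bad) (auto simp: \<sigma>_def)
      finally show ?thesis by (simp add: power2_eq_square)
    qed
    ultimately show ?thesis by linarith
  qed
  have Abound: "(\<Sum>L\<in>?X. real (card (A L))) \<le> card ?X * ((real k)\<^sup>2 * (real n)\<^sup>2 / (4 * d\<^sup>2))"
  proof -
    have "real (card {L \<in> ?X. q \<in> intercalates L}) \<le> card ?X / d\<^sup>2" if q: "q \<in> QA" for q
    proof -
      obtain i j x y where [simp]: "q = (i, j, x, y)" by (cases q)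
      have ij: "i \<in> {1..k}" "j \<in> {1..k}" "x \<in> {1..n}" "y \<in> {1..n}" "i \<noteq> j" "x \<noteq> y"
        using q unfolding QA_def quads_def by auto
      from q consider "good j" "(j, x) \<notin> dom S" "(j, y) \<notin> dom S" | "good i" "(i, x) \<notin> dom S" "(i, y) \<notin> dom S"
        unfolding QA_def by auto
      then obtain a b where ab: "a \<noteq> b" "b \<in> {1..k}" "good a" "(a, x) \<notin> dom S" "(a, y) \<notin> dom S" "(a, b) \<in> {(i, j), (j, i)}"
      proof cases
        case 1 then show ?thesis using that[of j i] ij by simp
      next
        case 2 then show ?thesis using that[of i j] ij by simp
      qed
      have "{L \<in> ?X. q \<in> intercalates L} \<subseteq> {L \<in> ?X. L (a, x) = L (b, y) \<and> L (a, y) = L (b, x)}"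
        using ab(6) by (auto simp: intercalates_def)
      then have "card {L \<in> ?X. q \<in> intercalates L} \<le> card {L \<in> ?X. L (a, x) = L (b, y) \<and> L (a, y) = L (b, x)}"
        by (intro card_mono) auto
      then have "d\<^sup>2 * card {L \<in> ?X. q \<in> intercalates L} \<le> d\<^sup>2 * card {L \<in> ?X. L (a, x) = L (b, y) \<and> L (a, y) = L (b, x)}"
        by (intro mult_left_mono) auto
      also have "\<dots> \<le> card ?X"
        using ab ij d by (intro card_extensions_two_cells_le) (auto simp: good_def)
      finally show ?thesis using d by (simp add: field_simps)
    qed
    then have "(\<Sum>q\<in>QA. real (card {L \<in> ?X. q \<in> intercalates L})) \<le> (\<Sum>q\<in>QA. card ?X / d\<^sup>2)"
      by (rule sum_mono)
    also have "\<dots> = card QA * (card ?X / d\<^sup>2)" by simp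
    also have "\<dots> \<le> ((real k)\<^sup>2 * (real n)\<^sup>2 / 4) * (card ?X / d\<^sup>2)"
    proof (rule mult_right_mono)
      have "card QA \<le> card (quads k n)" by (rule card_mono) (auto simp: QA_def)
      then show "real (card QA) \<le> (real k)\<^sup>2 * (real n)\<^sup>2 / 4" using card_quads_le[of k n] by linarith
    qed simp
    also have "\<dots> = card ?X * ((real k)\<^sup>2 * (real n)\<^sup>2 / (4 * d\<^sup>2))" by simp
    finally show ?thesis unfolding A_def sum_double_count[OF finite_extensions finQA] .
  qed
  have Bbound: "(\<Sum>L\<in>?X. real (card (B L))) \<le> card ?X * (\<sigma> * k / d)"
  proof -
    have "real (card {L \<in> ?X. EB p L}) \<le> card ?X / d" if p: "p \<in> TB" for p
    proof -
      obtain a u b where [simp]: "p = ((a, u), b)" by (metis surj_pair)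
      have ab: "(a, u) \<in> dom S" "b \<in> {1..k}" "good a" "a \<noteq> b" "u \<in> {1..n}" using p unfolding TB_def by auto
      then obtain s where s: "S (a, u) = Some s" by blast
      have "d * card {L \<in> ?X. EB p L} \<le> card ?X"
        using card_extensions_one_cell_le[of a b k u n S s d] ab s d by (simp add: EB_def good_def)
      then show ?thesis using d by (simp add: field_simps)
    qed
    then have "(\<Sum>p\<in>TB. real (card {L \<in> ?X. EB p L})) \<le> (\<Sum>p\<in>TB. card ?X / d)"
      by (rule sum_mono)
    also have "\<dots> = card TB * (card ?X / d)" by simp
    also have "\<dots> \<le> (\<sigma> * k) * (card ?X / d)"
    proof (rule mult_right_mono)
      have "card TB \<le> card (dom S \<times> {1..k})" by (rule card_mono) (use finS in \<open>auto simp: TB_def\<close>)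
      then show "real (card TB) \<le> \<sigma> * k"
        by (simp add: card_cartesian_product \<sigma>_def flip: of_nat_mult)
    qed (use d in simp)
    also have "\<dots> = card ?X * (\<sigma> * k / d)" by simp
    finally show ?thesis unfolding B_def sum_double_count[OF finite_extensions finTB] .
  qed
  have "(\<Sum>L\<in>?X. real (num_intercalates L))
      \<le> (\<Sum>L\<in>?X. num_intercalates S + card (A L) + card (B L) + \<sigma>\<^sup>2 / r + \<sigma>\<^sup>2 * n / r\<^sup>2)"
    by (rule sum_mono) (rule main)
  also have "\<dots> = card ?X * (num_intercalates S + \<sigma>\<^sup>2 / r + \<sigma>\<^sup>2 * n / r\<^sup>2)
      + (\<Sum>L\<in>?X. real (card (A L))) + (\<Sum>L\<in>?X. real (card (B L)))"
    by (simp add: sum.distrib algebra_simps)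
  also have "\<dots> \<le> card ?X * (num_intercalates S + \<sigma>\<^sup>2 / r + \<sigma>\<^sup>2 * n / r\<^sup>2)
      + card ?X * ((real k)\<^sup>2 * (real n)\<^sup>2 / (4 * d\<^sup>2)) + card ?X * (\<sigma> * k / d)"
    by (intro add_mono Abound Bbound order_refl)
  also have "\<dots> = card ?X * (num_intercalates S + (real k)\<^sup>2 * (real n)\<^sup>2 / (4 * d\<^sup>2) + \<sigma> * k / d + \<sigma>\<^sup>2 / r + \<sigma>\<^sup>2 * n / r\<^sup>2)"
    by (simp add: algebra_simps)
  finally show ?thesis .
qed

text \<open>For each intercalate \<open>q\<close>, group the rectangles containing \<open>q\<close> by their restriction to \<open>dom S\<close>
  and \<open>q\<close>, and apply the induction hypothesis to each restriction.\<close>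

lemma sum_power_intercalates_le:
  fixes M :: real
  assumes mean: "\<And>S. finite (dom S) \<Longrightarrow> card (dom S) \<le> m \<Longrightarrow> num_intercalates S < N0 \<Longrightarrow>
      (\<Sum>L\<in>extensions k n S. real (num_intercalates L)) \<le> M * card (extensions k n S)"
    and "M \<ge> 0"
  defines "good \<equiv> \<lambda>L. \<forall>S. S \<subseteq>\<^sub>m L \<longrightarrow> card (dom S) \<le> m \<longrightarrow> num_intercalates S < N0"
  assumes "finite (dom S)" "card (dom S) + 4 * t \<le> m"
  shows "(\<Sum>L\<in>{L \<in> extensions k n S. good L}. real (num_intercalates L) ^ t) \<le> M ^ t * card (extensions k n S)"
  using assms(4,5)
proof (induction t arbitrary: S)
  case 0
  have "card {L \<in> extensions k n S. good L} \<le> card (extensions k n S)" by (rule card_mono) auto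
  then show ?case by simp
next
  case (Suc t)
  let ?G = "{L \<in> extensions k n S. good L}"
  show ?case
  proof (cases "num_intercalates S < N0")
    \<comment> \<open>An array that violates \<open>good\<close> itself has no good extension, so
      the mean is needed for non-seeds only.\<close>
    case False
    then have G: "?G = {}" using Suc.prems unfolding good_def extensions_def by auto
    show ?thesis unfolding G using \<open>M \<ge> 0\<close> by simp
  next
    case True
    have q: "(\<Sum>L\<in>{L \<in> ?G. q \<in> intercalates L}. real (num_intercalates L) ^ t)
        \<le> M ^ t * card {L \<in> extensions k n S. q \<in> intercalates L}" for q
    proof -
      let ?D = "dom S \<union> quad_cells q" and ?A = "{L \<in> extensions k n S. q \<in> intercalates L}"
      let ?R = "(\<lambda>L. L |` ?D) ` ?A" and ?w = "\<lambda>L. if good L then real (num_intercalates L) ^ t else 0"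
      have D: "dom S \<subseteq> ?D" by blast
      have sub: "extensions k n S' \<inter> ?A = extensions k n S'"
        and dom: "finite (dom S')" "card (dom S') + 4 * t \<le> m" if S': "S' \<in> ?R" for S'
      proof -
        obtain L0 where L0: "L0 \<in> ?A" "S' = L0 |` ?D" using S' by blast
        have "q \<in> intercalates (L0 |` ?D)" using L0 by (simp add: intercalates_restrict)
        then have "q \<in> intercalates L" if "L \<in> extensions k n (L0 |` ?D)" for L
          using that intercalates_mono[of "L0 |` ?D" L] unfolding extensions_def by blast
        then show "extensions k n S' \<inter> ?A = extensions k n S'"
          using L0 extensions_restrict[OF _ D, of L0 k n] by auto
        have fin: "finite ?D" using Suc.prems by (simp add: quad_cells_def split: prod.split)
        have "dom S' \<subseteq> ?D" using L0 by simp
        then show "finite (dom S')" using fin finite_subset by blast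
        have "card (dom S') \<le> card ?D" using \<open>dom S' \<subseteq> ?D\<close> fin by (rule card_mono[rotated])
        also have "\<dots> \<le> card (dom S) + card (quad_cells q)" by (rule card_Un_le)
        also have "card (quad_cells q) \<le> 4"
          unfolding quad_cells_def by (auto split: prod.split simp: card_insert_if)
        finally show "card (dom S') + 4 * t \<le> m" using Suc.prems by simp
      qed
      have fin: "finite ?A" by simp
      have "(\<Sum>L\<in>{L \<in> ?G. q \<in> intercalates L}. real (num_intercalates L) ^ t) = (\<Sum>L\<in>?A. ?w L)"
        using sum.inter_filter[OF fin, of "\<lambda>L. real (num_intercalates L) ^ t" good]
        by (simp add: conj_ac)
      also have "\<dots> = (\<Sum>S'\<in>?R. \<Sum>L\<in>extensions k n S' \<inter> ?A. ?w L)"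
        by (rule sum_extensions_group[OF _ D]) auto
      also have "\<dots> = (\<Sum>S'\<in>?R. \<Sum>L\<in>extensions k n S'. ?w L)"
        using sub by (intro sum.cong refl) auto
      also have "\<dots> = (\<Sum>S'\<in>?R. \<Sum>L\<in>{L \<in> extensions k n S'. good L}. real (num_intercalates L) ^ t)"
        by (simp flip: sum.inter_filter)
      also have "\<dots> \<le> (\<Sum>S'\<in>?R. M ^ t * card (extensions k n S'))"
        by (rule sum_mono) (use Suc.IH dom in blast)
      also have "\<dots> = M ^ t * (\<Sum>S'\<in>?R. \<Sum>L\<in>extensions k n S' \<inter> ?A. 1)"
        using sub by (simp add: sum_distrib_left)
      also have "(\<Sum>S'\<in>?R. \<Sum>L\<in>extensions k n S' \<inter> ?A. 1) = (\<Sum>L\<in>?A. 1 :: real)"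
        by (rule sum_extensions_group[OF _ D, symmetric]) auto
      finally show ?thesis by simp
    qed
    have int: "real (num_intercalates L) = real (card {q \<in> quads k n. q \<in> intercalates L})"
      if "L \<in> extensions k n S" for L
    proof -
      have "intercalates L = {q \<in> quads k n. q \<in> intercalates L}"
        using intercalates_latin_rectangle[OF extensionsD(1)[OF that]] by auto
      then show ?thesis unfolding num_intercalates_def by simp
    qed
    have "(\<Sum>L\<in>?G. real (num_intercalates L) ^ Suc t)
        = (\<Sum>L\<in>?G. real (card {q \<in> quads k n. q \<in> intercalates L}) * real (num_intercalates L) ^ t)"
      by (rule sum.cong) (use int in auto)
    also have "\<dots> = (\<Sum>q\<in>quads k n. \<Sum>L\<in>{L \<in> ?G. q \<in> intercalates L}. real (num_intercalates L) ^ t)"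
      by (rule sum_weighted_double_count) auto
    also have "\<dots> \<le> (\<Sum>q\<in>quads k n. M ^ t * card {L \<in> extensions k n S. q \<in> intercalates L})"
      by (rule sum_mono) (rule q)
    also have "\<dots> = M ^ t * (\<Sum>L\<in>extensions k n S. real (card {q \<in> quads k n. q \<in> intercalates L}))"
      unfolding sum_distrib_left[symmetric] by (subst sum_double_count) auto
    also have "\<dots> = M ^ t * (\<Sum>L\<in>extensions k n S. real (num_intercalates L))"
      using int by simp
    also have "\<dots> \<le> M ^ t * (M * card (extensions k n S))"
      using Suc.prems True \<open>M \<ge> 0\<close> by (intro mult_left_mono mean) auto
    finally show ?thesis by (simp add: mult_ac)
  qed
qed

section \<open>Planting a partial Latin square\<close>

text \<open>Rows beyond \<open>a\<close> and columns beyond \<open>b\<close> avoid \<open>P\<close>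
  entirely, so the four new cells cannot clash with it, whichever distinct symbols \<open>s\<close>
  and \<open>t\<close> are used.\<close>

lemma four_cell_extension:
  fixes d :: real
  assumes P: "latin P" and box: "dom P \<subseteq> {1..a} \<times> {1..b}" "ran P \<subseteq> {1..n}" and ab: "a \<le> k" "b \<le> n"
    and d: "real k \<le> d" "d \<le> real n - real b - 2 - 2 * real k"
    and ij: "a < i" "i < j" "j \<le> k" and xy: "b < x" "x < y" "y \<le> n"
    and st: "s \<in> {1..n}" "t \<in> {1..n}" "s \<noteq> t"
  shows "((d - k) / (real n)\<^sup>2) ^ 4 * card (extensions k n P)
    \<le> card {L \<in> extensions k n P. L (i, x) = Some s \<and> L (j, y) = Some s \<and> L (i, y) = Some t \<and> L (j, x) = Some t}"
proof -
  define Q where "Q = P((i, x) \<mapsto> s, (j, y) \<mapsto> s, (i, y) \<mapsto> t, (j, x) \<mapsto> t)"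
  have Pbox: "P (i', x') = Some v \<Longrightarrow> i' \<le> a \<and> x' \<le> b" for i' x' v
    using box(1) by (auto simp: dom_def)
  have PNone: "\<not> (i' \<le> a \<and> x' \<le> b) \<Longrightarrow> P (i', x') = None" for i' x'
    using Pbox by (cases "P (i', x')") auto
  have Qlow: "Q (i', x') = P (i', x')" if "i' \<le> a \<or> x' \<le> b" for i' x'
    using that ij xy by (auto simp: Q_def)
  have Qhigh: "(i', x', v) \<in> {(i, x, s), (j, y, s), (i, y, t), (j, x, t)}"
    if "Q (i', x') = Some v" "\<not> (i' \<le> a \<and> x' \<le> b)" for i' x' v
    using that(1) PNone[OF that(2)] by (auto simp: Q_def split: if_splits)
  have domQ: "dom Q = dom P \<union> {(i, x), (j, y), (i, y), (j, x)}" by (auto simp: Q_def)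
  have latQ: "latin Q" unfolding latin_def
  proof (intro conjI allI impI)
    show "finite (dom Q)" using latinD_finite[OF P] by (simp add: domQ)
  next
    fix i' x' y' v assume H: "Q (i', x') = Some v \<and> Q (i', y') = Some v"
    show "x' = y'"
    proof (cases "i' \<le> a")
      case True
      then show ?thesis using H Qlow latinD_row[OF P, of i' x' v y'] by simp
    next
      case False
      then show ?thesis using H Qhigh[of i' x' v] Qhigh[of i' y' v] ij st by auto
    qed
  next
    fix i' j' x' v assume H: "Q (i', x') = Some v \<and> Q (j', x') = Some v"
    show "i' = j'"
    proof (cases "x' \<le> b")
      case True
      then show ?thesis using H Qlow latinD_col[OF P, of i' x' v j'] by simp
    next
      case False
      then show ?thesis using H Qhigh[of i' x' v] Qhigh[of j' x' v] xy st by auto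
    qed
  qed
  have fresh: "dom P \<inter> {(i, x), (j, y), (i, y), (j, x)} = {}" using box ij by auto
  then have PQ: "P \<subseteq>\<^sub>m Q" unfolding Q_def map_le_def by auto
  have diff: "dom Q - dom P = {(i, x), (j, y), (i, y), (j, x)}" using fresh domQ by auto
  have card4: "card (dom Q - dom P) = 4" unfolding diff using ij xy by simp
  have "(d - k) ^ card (dom Q - dom P) * card (extensions k n P)
      \<le> ((real n)\<^sup>2) ^ card (dom Q - dom P) * card (extensions k n Q)"
  proof (rule card_extensions_ge[OF PQ latQ d(1)])
    show "dom Q \<subseteq> {1..k} \<times> {1..n}" unfolding domQ using box(1) ab ij xy by auto
    show "ran Q \<subseteq> {1..n}"
    proof
      fix v assume "v \<in> ran Q"
      then obtain c where c: "Q c = Some v" by (auto simp: ran_def)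
      then have "v = s \<or> v = t \<or> v \<in> ran P" by (auto simp: Q_def intro: ranI split: if_splits)
      then show "v \<in> {1..n}" using st box(2) by blast
    qed
    show "d \<le> real n - row_size Q i' - 2 * real k" for i'
    proof -
      have "{x'. (i', x') \<in> dom Q} \<subseteq> {1..b} \<union> {x, y}" unfolding domQ using box(1) by auto
      then have "row_size Q i' \<le> card ({1..b} \<union> {x, y})" unfolding row_size_def by (intro card_mono) auto
      also have "\<dots> \<le> card {1..b} + card {x, y}" by (rule card_Un_le)
      also have "\<dots> = b + 2" using xy by simp
      finally show ?thesis using d by linarith
    qed
  qed
  then have le: "(d - k) ^ 4 * card (extensions k n P) \<le> ((real n)\<^sup>2) ^ 4 * card (extensions k n Q)"
    unfolding card4 .
  have n: "real n > 0" using xy by simp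
  have "((d - k) / (real n)\<^sup>2) ^ 4 * card (extensions k n P) = (d - k) ^ 4 * card (extensions k n P) / ((real n)\<^sup>2) ^ 4"
    by (simp add: power_divide)
  also have "\<dots> \<le> card (extensions k n Q)"
    using le n by (simp add: pos_divide_le_eq mult.commute)
  also have "card (extensions k n Q) \<le> card {L \<in> extensions k n P. L (i, x) = Some s \<and> L (j, y) = Some s \<and> L (i, y) = Some t \<and> L (j, x) = Some t}"
  proof (rule card_mono)
    have Q4: "Q (i, x) = Some s" "Q (j, y) = Some s" "Q (i, y) = Some t" "Q (j, x) = Some t"
      using ij xy by (auto simp: Q_def)
    show "extensions k n Q \<subseteq> {L \<in> extensions k n P. L (i, x) = Some s \<and> L (j, y) = Some s \<and> L (i, y) = Some t \<and> L (j, x) = Some t}"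
    proof
      fix L assume L: "L \<in> extensions k n Q"
      note le = extensionsD(2)[OF L]
      have "L (i, x) = Some s" "L (j, y) = Some s" "L (i, y) = Some t" "L (j, x) = Some t"
        using Q4[THEN map_le_SomeD[OF le]] by auto
      with L show "L \<in> {L \<in> extensions k n P. L (i, x) = Some s \<and> L (j, y) = Some s \<and> L (i, y) = Some t \<and> L (j, x) = Some t}"
        using extensions_mono[OF PQ] by blast
    qed
  qed simp
  finally show ?thesis by simp
qed

lemma extensions_empty: "extensions k n Map.empty = latin_rectangles k n"
  by (auto simp: extensions_def)

lemma planted_extensions_ge:
  fixes d :: real
  assumes P: "latin P" and box: "dom P \<subseteq> {1..a} \<times> {1..b}" "ran P \<subseteq> {1..n}" and ab: "a \<le> k" "b \<le> n"
    and d: "real k \<le> d" "d \<le> real n - real b - 2 - 2 * real k"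
  shows "((d - k) / (real n)\<^sup>2) ^ card (dom P) * card (latin_rectangles k n) \<le> card (extensions k n P)"
proof (cases "n = 0")
  case True
  then have "dom P = {}" using box ab by auto
  then show ?thesis by (simp add: extensions_empty)
next
  case False
  have "(d - k) ^ card (dom P - dom (Map.empty :: partial_array)) * card (extensions k n Map.empty)
      \<le> ((real n)\<^sup>2) ^ card (dom P - dom (Map.empty :: partial_array)) * card (extensions k n P)"
  proof (rule card_extensions_ge[OF _ P d(1)])
    show "dom P \<subseteq> {1..k} \<times> {1..n}" using box(1) ab by auto
    show "d \<le> real n - row_size P i - 2 * real k" for i
    proof -
      have "{x. (i, x) \<in> dom P} \<subseteq> {1..b}" using box(1) by auto
      then have "row_size P i \<le> b" unfolding row_size_def using card_mono[of "{1..b}"] by simp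
      then show ?thesis using d by linarith
    qed
  qed (use box in auto)
  then have "(d - k) ^ card (dom P) * card (latin_rectangles k n) \<le> ((real n)\<^sup>2) ^ card (dom P) * card (extensions k n P)"
    by (simp add: extensions_empty)
  then show ?thesis using False by (simp add: power_divide pos_divide_le_eq mult.commute)
qed

text \<open>A mean argument in reverse: the new intercalates number at most
  \<open>(real k)\<^sup>2 * (real n)\<^sup>2\<close> and at least \<open>M\<close> on average, so
  they reach \<open>v\<close> with conditional probability at least \<open>M - v\<close> divided by
  that maximum. In \<open>M\<close>, \<open>p ^ 4\<close> is the cost of four cells; the other
  factor counts pairs of rows, pairs of columns and ordered pairs of symbols, about
  \<open>k^2 n^4 / 4\<close> in total.\<close>

lemma planted_intercalates:
  fixes d v :: real
  assumes P: "latin P" and box: "dom P \<subseteq> {1..a} \<times> {1..b}" "ran P \<subseteq> {1..n}" and ab: "a \<le> k" "b \<le> n"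
    and d: "real k \<le> d" "d \<le> real n - real b - 2 - 2 * real k" and k: "k \<ge> 1"
  defines "p \<equiv> (d - k) / (real n)\<^sup>2"
  defines "M \<equiv> p ^ 4 * ((real k - real a) * (real k - real a - 1) * (real n - real b) * (real n - real b - 1) * real n * (real n - 1) / 4)"
  assumes v: "0 \<le> v" "v \<le> M" and ak: "a < k" and bn: "b < n"
  shows "(M - v) / ((real k)\<^sup>2 * (real n)\<^sup>2) * p ^ card (dom P) * card (latin_rectangles k n)
    \<le> card {L \<in> latin_rectangles k n. num_intercalates P + v \<le> num_intercalates L}"
proof -
  let ?X = "extensions k n P"
  define I where "I = {(i, j). i \<in> {a<..k} \<and> j \<in> {a<..k} \<and> i < j}"
  define J where "J = {(x, y). x \<in> {b<..n} \<and> y \<in> {b<..n} \<and> x < y}"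
  define K where "K = (SIGMA s:{1..n}. {1..n} - {s})"
  define T where "T = I \<times> J \<times> K"
  define E where "E = (\<lambda>((i, j), (x, y), (s, t)) (L :: partial_array). L (i, x) = Some s \<and> L (j, y) = Some s \<and> L (i, y) = Some t \<and> L (j, x) = (Some t :: nat option))"
  \<comment> \<open>The first row exceeds \<open>a\<close>, so both rows avoid \<open>P\<close> and
    these intercalates are disjoint from those of \<open>P\<close>.\<close>
  define N' where "N' L = card {q \<in> intercalates L. fst q > a}" for L :: partial_array
  have fin: "finite I" "finite J" "finite K"
    unfolding I_def J_def K_def
    by (rule finite_subset[of _ "{a<..k} \<times> {a<..k}"], auto)
      (rule finite_subset[of _ "{b<..n} \<times> {b<..n}"], auto)
  then have finT: "finite T" by (simp add: T_def)
  have cI: "2 * real (card I) = (real k - real a) * (real k - real a - 1)"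
  proof -
    have "2 * card I = (k - a) * (k - a - 1)" unfolding I_def using card_ordered_pairs[of "{a<..k}"] by simp
    then have "real (2 * card I) = real ((k - a) * (k - a - 1))" by (simp only:)
    then show ?thesis using ak by (simp add: of_nat_diff)
  qed
  have cJ: "2 * real (card J) = (real n - real b) * (real n - real b - 1)"
  proof -
    have "2 * card J = (n - b) * (n - b - 1)" unfolding J_def using card_ordered_pairs[of "{b<..n}"] by simp
    then have "real (2 * card J) = real ((n - b) * (n - b - 1))" by (simp only:)
    then show ?thesis using bn by (simp add: of_nat_diff)
  qed
  have cK: "real (card K) = real n * (real n - 1)"
    unfolding K_def using bn by (simp add: card_SigmaI of_nat_diff)
  have MT: "M = p ^ 4 * card T"
  proof -
    have "real (card T) = real (card I) * real (card J) * real (card K)"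
      by (simp add: T_def card_cartesian_product)
    moreover have "real (card I) = (real k - real a) * (real k - real a - 1) / 2" using cI by simp
    moreover have "real (card J) = (real n - real b) * (real n - real b - 1) / 2" using cJ by simp
    ultimately show ?thesis unfolding M_def cK by simp
  qed
  have N'T: "card {\<tau> \<in> T. E \<tau> L} \<le> N' L" if L: "L \<in> ?X" for L
    unfolding N'_def
  proof (rule card_inj_on_le[of "\<lambda>((i, j), (x, y), (s, t)). (i, j, x, y)"])
    note L' = extensionsD(1)[OF L]
    show "inj_on (\<lambda>((i, j), (x, y), (s, t)). (i, j, x, y)) {\<tau> \<in> T. E \<tau> L}"
      by (auto simp: inj_on_def E_def)
    show "(\<lambda>((i, j), (x, y), (s, t)). (i, j, x, y)) ` {\<tau> \<in> T. E \<tau> L} \<subseteq> {q \<in> intercalates L. fst q > a}"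
      by (auto simp: T_def I_def J_def E_def intercalates_def)
    show "finite {q \<in> intercalates L. fst q > a}"
      using latinD_finite[OF latin_rectangles_latin[OF L']] by simp
  qed
  have "p ^ 4 * card ?X \<le> card {L \<in> ?X. E \<tau> L}" if \<tau>: "\<tau> \<in> T" for \<tau>
  proof -
    obtain i j x y s t where eq: "\<tau> = ((i, j), (x, y), (s, t))" by (metis surj_pair)
    show ?thesis using four_cell_extension[OF P box ab d, of i j x y s t] \<tau>
      unfolding eq T_def I_def J_def K_def E_def p_def by simp
  qed
  then have "(\<Sum>\<tau>\<in>T. p ^ 4 * card ?X) \<le> (\<Sum>\<tau>\<in>T. real (card {L \<in> ?X. E \<tau> L}))" by (rule sum_mono)
  also have "\<dots> = (\<Sum>L\<in>?X. real (card {\<tau> \<in> T. E \<tau> L}))"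
    by (rule sum_double_count[symmetric]) (use finT in auto)
  also have "\<dots> \<le> (\<Sum>L\<in>?X. real (N' L))" by (rule sum_mono) (use N'T in simp)
  finally have mean: "M * card ?X \<le> (\<Sum>L\<in>?X. real (N' L))" unfolding MT by (simp add: mult_ac)
  define G where "G = {L \<in> ?X. v \<le> real (N' L)}"
  have N'le: "real (N' L) \<le> (real k)\<^sup>2 * (real n)\<^sup>2" if L: "L \<in> ?X" for L
  proof -
    note L' = extensionsD(1)[OF L]
    have "N' L \<le> card (quads k n)"
      unfolding N'_def intercalates_latin_rectangle[OF L'] by (intro card_mono) auto
    then have "real (N' L) \<le> (real k)\<^sup>2 * (real n)\<^sup>2 / 4" using card_quads_le[of k n] by linarith
    moreover have "(real k)\<^sup>2 * (real n)\<^sup>2 \<ge> 0" by simp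
    ultimately show ?thesis by linarith
  qed
  have "(\<Sum>L\<in>?X. real (N' L)) \<le> (\<Sum>L\<in>?X. (if L \<in> G then (real k)\<^sup>2 * (real n)\<^sup>2 else 0) + v)"
    by (rule sum_mono) (use N'le v in \<open>auto simp: G_def add_increasing2\<close>)
  also have "\<dots> = (real k)\<^sup>2 * (real n)\<^sup>2 * card G + v * card ?X"
  proof -
    have "(\<Sum>L\<in>?X. if L \<in> G then (real k)\<^sup>2 * (real n)\<^sup>2 else 0) = (\<Sum>L\<in>?X \<inter> G. (real k)\<^sup>2 * (real n)\<^sup>2)"
      by (rule sum.inter_restrict[symmetric]) simp
    moreover have "?X \<inter> G = G" by (auto simp: G_def)
    ultimately show ?thesis by (simp add: sum.distrib mult_ac)
  qed
  finally have G: "(M - v) * card ?X \<le> (real k)\<^sup>2 * (real n)\<^sup>2 * card G"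
    using mean by (simp add: left_diff_distrib)
  have kn: "(real k)\<^sup>2 * (real n)\<^sup>2 > 0" using k bn by simp
  have "(M - v) / ((real k)\<^sup>2 * (real n)\<^sup>2) * p ^ card (dom P) * card (latin_rectangles k n)
      = (M - v) / ((real k)\<^sup>2 * (real n)\<^sup>2) * (p ^ card (dom P) * card (latin_rectangles k n))" by simp
  also have "\<dots> \<le> (M - v) / ((real k)\<^sup>2 * (real n)\<^sup>2) * card ?X"
    unfolding p_def using v kn planted_extensions_ge[OF P box ab d] by (intro mult_left_mono) auto
  also have "\<dots> \<le> card G" using G kn by (simp add: pos_divide_le_eq mult.commute)
  also have "\<dots> \<le> card {L \<in> latin_rectangles k n. num_intercalates P + v \<le> num_intercalates L}"
  proof (intro of_nat_mono card_mono subsetI)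
    fix L assume L: "L \<in> G"
    then have LX: "L \<in> ?X" and vL: "v \<le> N' L" by (auto simp: G_def)
    note L' = extensionsD[OF LX]
    have finL: "finite (dom L)" by (rule latinD_finite[OF latin_rectangles_latin[OF L'(1)]])
    have "intercalates P \<inter> {q \<in> intercalates L. fst q > a} = {}"
    proof -
      have "i \<le> a" if "(i, j, x, y) \<in> intercalates P" for i j x y
        using that box(1) unfolding intercalates_def by auto
      then show ?thesis by fastforce
    qed
    then have "num_intercalates P + N' L = card (intercalates P \<union> {q \<in> intercalates L. fst q > a})"
      unfolding num_intercalates_def N'_def
      using finL latinD_finite[OF P] by (intro card_Un_disjoint[symmetric]) auto
    also have "\<dots> \<le> num_intercalates L"
      unfolding num_intercalates_def using finL intercalates_mono[OF L'(2)] by (intro card_mono) auto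
    finally have "real (num_intercalates P) + N' L \<le> num_intercalates L" by (simp flip: of_nat_add)
    then show "L \<in> {L \<in> latin_rectangles k n. num_intercalates P + v \<le> num_intercalates L}"
      using L'(1) vL by simp
  qed simp
  finally show ?thesis .
qed

section \<open>Cores\<close>

text \<open>Delete a cell that lies in fewer than \<open>\<beta>\<close> intercalates, and repeat;
  each deletion loses fewer than \<open>\<beta>\<close> of them. In contrast to
  \<open>prune\<close>, degrees are measured in the array that remains, as a core requires.\<close>

lemma core_exists:
  fixes \<beta> :: real
  assumes "finite (dom P)" "\<beta> \<ge> 0"
  shows "\<exists>P'. P' \<subseteq>\<^sub>m P \<and> (\<forall>c\<in>dom P'. \<beta> \<le> card (opposite P' c)) \<and>
    num_intercalates P \<le> num_intercalates P' + \<beta> * card (dom P)"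
proof -
  have "\<exists>P'. P' \<subseteq>\<^sub>m P \<and> (\<forall>c\<in>dom P'. \<beta> \<le> card (opposite P' c)) \<and>
    num_intercalates P \<le> num_intercalates P' + \<beta> * m" if "card (dom P) = m" for m
    using that assms(1)
  proof (induction m arbitrary: P)
    case 0
    then have "P = Map.empty" by simp
    then show ?case by (intro exI[of _ Map.empty]) simp
  next
    case (Suc m)
    show ?case
    proof (cases "\<forall>c\<in>dom P. \<beta> \<le> card (opposite P c)")
      case True
      then show ?thesis using \<open>\<beta> \<ge> 0\<close> by (intro exI[of _ P]) simp
    next
      case False
      then obtain c where c: "c \<in> dom P" "card (opposite P c) < \<beta>" by (meson not_le)
      have "dom (P |` (- {c})) = dom P - {c}" by auto
      then have "card (dom (P |` (- {c}))) = m" "finite (dom (P |` (- {c})))" using Suc.prems c by simp_all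
      then obtain P' where P': "P' \<subseteq>\<^sub>m P |` (- {c})" "\<forall>c\<in>dom P'. \<beta> \<le> card (opposite P' c)"
        "num_intercalates (P |` (- {c})) \<le> num_intercalates P' + \<beta> * m"
        using Suc.IH by blast
      have "num_intercalates P \<le> num_intercalates (P |` (- {c})) + card (opposite P c)"
        using num_intercalates_remove[OF Suc.prems(2), of "{c}"] by simp
      then have "num_intercalates P \<le> num_intercalates P' + \<beta> * Suc m"
        using P'(3) c(2) by (simp add: algebra_simps)
      then show ?thesis using P' map_le_trans restrict_map_le by blast
    qed
  qed
  then show ?thesis by blast
qed

text \<open>A cell in at least \<open>\<beta>\<close> intercalates has at least
  \<open>\<beta>\<close> cells in its row and in its column. Few rows will keep the number of
  candidates small; few columns keep every row of a core sparse.\<close>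

lemma core_rows:
  fixes \<beta> :: real
  assumes P: "latin P" and core: "\<forall>c\<in>dom P. \<beta> \<le> card (opposite P c)"
  shows "\<beta> * card (fst ` dom P) \<le> card (dom P)" "\<beta> * card (snd ` dom P) \<le> card (dom P)"
proof -
  have r: "\<beta> \<le> row_size P (fst c)" "\<beta> \<le> col_size P (snd c)" if "c \<in> dom P" for c
    using core that card_opposite_le_row[OF P, of "fst c" "snd c"] card_opposite_le_col[OF P, of "fst c" "snd c"]
    by force+
  show "\<beta> * card (fst ` dom P) \<le> card (dom P)"
  proof (rule card_large_fibres[OF latinD_finite[OF P] order_refl])
    show "\<beta> \<le> card {c \<in> dom P. fst c = i}" if "i \<in> fst ` dom P" for i
      using that r(1) unfolding row_size_fibre[symmetric] by (metis imageE)
  qed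
  show "\<beta> * card (snd ` dom P) \<le> card (dom P)"
  proof (rule card_large_fibres[OF latinD_finite[OF P] order_refl])
    show "\<beta> \<le> card {c \<in> dom P. snd c = x}" if "x \<in> snd ` dom P" for x
      using that r(2) unfolding col_size_fibre[symmetric] by (metis imageE)
  qed
qed

section \<open>Sparse random subsets of a core\<close>

lemma exists_le_average:
  fixes g :: "'a \<Rightarrow> real" and c :: real
  assumes "finite A" "A \<noteq> {}" "(\<Sum>f\<in>A. g f) \<le> c * card A"
  shows "\<exists>f\<in>A. g f \<le> c"
proof (rule ccontr)
  assume "\<not> ?thesis"
  then have "(\<Sum>f\<in>A. c) < (\<Sum>f\<in>A. g f)" using assms(1,2) by (intro sum_strict_mono) auto
  then show False using assms(3) by (simp add: mult.commute)
qed

text \<open>A uniform colouring with \<open>q\<close> colours models a random subset of density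
  \<open>1 / q\<close>, namely the class of colour 0. Probabilities become finite counts, and
  distinct cells are independent.\<close>

lemma card_colourings_zero_on:
  assumes "finite V" "T \<subseteq> V" "q \<ge> 1"
  shows "real (card {f \<in> V \<rightarrow>\<^sub>E {..<q}. \<forall>c\<in>T. f c = 0}) = real (q ^ card V) * (1 / real q) ^ card T"
proof -
  have eq: "{f \<in> V \<rightarrow>\<^sub>E {..<q}. \<forall>c\<in>T. f c = 0} = (\<Pi>\<^sub>E c\<in>V. if c \<in> T then {0} else {..<q})"
    using assms by (auto simp: PiE_def Pi_def extensional_def split: if_splits)
  have "card (\<Pi>\<^sub>E c\<in>V. if c \<in> T then {0} else {..<q}) = (\<Prod>c\<in>V. card (if c \<in> T then {0} else {..<q}))"
    by (rule card_PiE) fact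
  also have "\<dots> = (\<Prod>c\<in>V. if c \<in> T then 1 else q)" by (rule prod.cong) auto
  also have "\<dots> = (\<Prod>c\<in>V - T. q)"
    using assms by (simp add: prod.If_cases Diff_eq)
  also have "\<dots> = q ^ (card V - card T)"
    using assms by (simp add: card_Diff_subset finite_subset)
  finally have "real (card {f \<in> V \<rightarrow>\<^sub>E {..<q}. \<forall>c\<in>T. f c = 0}) = real q ^ (card V - card T)"
    unfolding eq by simp
  also have "\<dots> = real q ^ card V / real q ^ card T"
    using assms by (intro power_diff) (auto intro: card_mono)
  finally show ?thesis by (simp add: power_divide)
qed

definition corner_triple :: "nat \<times> nat \<Rightarrow> nat \<times> nat \<Rightarrow> (nat \<times> nat) set" where
  "corner_triple = (\<lambda>(i, x) (j, y). {(i, y), (j, x), (j, y)})"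

lemma card_corner_triple:
  "p \<in> opposite P c \<Longrightarrow> card (corner_triple c p) = 3" "p \<in> opposite P c \<Longrightarrow> corner_triple c p \<subseteq> dom P"
  unfolding opposite_def corner_triple_def by (auto split: prod.splits)

text \<open>Cells opposite to \<open>c\<close> all carry the symbol of \<open>c\<close>, so two of
  them differ in both row and column. Disjointness makes the corresponding events independent under
  a random colouring.\<close>

lemma corner_triple_disjoint:
  assumes "latin P" "p \<in> opposite P c" "p' \<in> opposite P c" "p \<noteq> p'"
  shows "corner_triple c p \<inter> corner_triple c p' = {}"
proof -
  obtain i x where c: "c = (i, x)" by (cases c)
  obtain j y where p: "p = (j, y)" by (cases p)
  obtain j' y' where p': "p' = (j', y')" by (cases p')
  from assms(2) obtain s t where 1: "j \<noteq> i" "y \<noteq> x" "P (i, x) = Some s" "P (j, y) = Some s" "P (i, y) = Some t" "P (j, x) = Some t"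
    unfolding opposite_def c p by auto
  from assms(3) obtain t' where 2: "j' \<noteq> i" "y' \<noteq> x" "P (j', y') = Some s" "P (i, y') = Some t'" "P (j', x) = Some t'"
    unfolding opposite_def c p' using 1(3) by auto
  have "y = y' \<Longrightarrow> j = j'" using latinD_col[OF assms(1) 1(4), of j'] 2(3) by simp
  moreover have "j = j' \<Longrightarrow> y = y'" using latinD_row[OF assms(1) 1(4), of y'] 2(3) by simp
  ultimately have "y \<noteq> y'" "j \<noteq> j'" using assms(4) p p' by auto
  then show ?thesis unfolding corner_triple_def c p p' using 1(1,2) 2(1,2) by auto
qed

text \<open>Chebyshev's inequality. The number \<open>X\<close> of triples coloured 0 is a sum of
  \<open>D \<ge> \<beta>\<close> pairwise independent indicators of probability
  \<open>w = 1 / q^3\<close>, so its variance is at most \<open>D w\<close>. The threshold is at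
  most half the mean, whence the failure probability is at most \<open>4 / (D w)\<close>.\<close>

lemma colour_chebyshev:
  fixes \<beta> :: real and q :: nat
  assumes P: "latin P" and c: "\<beta> \<le> card (opposite P c)" and \<beta>: "\<beta> > 0" and q: "q \<ge> 1"
  shows "real (card {f \<in> dom P \<rightarrow>\<^sub>E {..<q}. real (card {p \<in> opposite P c. \<forall>t\<in>corner_triple c p. f t = 0}) < \<beta> / (2 * real q ^ 3)})
    \<le> real (q ^ card (dom P)) * (4 * real q ^ 3 / \<beta>)"
proof -
  let ?V = "dom P" and ?O = "opposite P c"
  define \<Omega> where "\<Omega> = ?V \<rightarrow>\<^sub>E {..<q}"
  define w where "w = (1 / real q) ^ 3"
  define D where "D = real (card ?O)"
  define X where "X f = real (card {p \<in> ?O. \<forall>t\<in>corner_triple c p. f t = 0})" for f :: "nat \<times> nat \<Rightarrow> nat"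
  define W where "W = real (q ^ card ?V)"
  have finV: "finite ?V" using P by (rule latinD_finite)
  have finO: "finite ?O" using finV by (rule finite_opposite)
  have fin\<Omega>: "finite \<Omega>" unfolding \<Omega>_def using finV by (intro finite_PiE) auto
  have W: "W > 0" "real (card \<Omega>) = W" using q finV by (simp_all add: W_def \<Omega>_def card_PiE)
  have w: "w > 0" using q by (simp add: w_def)
  have D: "D \<ge> \<beta>" "D > 0" using c \<beta> by (simp_all add: D_def)
  have one: "real (card {f \<in> \<Omega>. \<forall>t\<in>corner_triple c p. f t = 0}) = W * w" if "p \<in> ?O" for p
    unfolding \<Omega>_def W_def w_def
    using card_colourings_zero_on[OF finV card_corner_triple(2)[OF that] q] card_corner_triple(1)[OF that] by simp
  have two: "real (card {f \<in> \<Omega>. (\<forall>t\<in>corner_triple c p. f t = 0) \<and> (\<forall>t\<in>corner_triple c p'. f t = 0)}) = W * w\<^sup>2"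
    if "p \<in> ?O" "p' \<in> ?O" "p \<noteq> p'" for p p'
  proof -
    have "finite (corner_triple c p)" for p by (simp add: corner_triple_def split: prod.split)
    then have "card (corner_triple c p \<union> corner_triple c p') = 6"
      using card_Un_disjoint[OF _ _ corner_triple_disjoint[OF P that]] card_corner_triple(1)[OF that(1)] card_corner_triple(1)[OF that(2)]
      by simp
    moreover have "{f \<in> \<Omega>. (\<forall>t\<in>corner_triple c p. f t = 0) \<and> (\<forall>t\<in>corner_triple c p'. f t = 0)}
        = {f \<in> ?V \<rightarrow>\<^sub>E {..<q}. \<forall>t\<in>corner_triple c p \<union> corner_triple c p'. f t = 0}"
      unfolding \<Omega>_def by blast
    moreover have "corner_triple c p \<union> corner_triple c p' \<subseteq> ?V" using card_corner_triple(2) that by blast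
    ultimately show ?thesis using card_colourings_zero_on[OF finV _ q, of "corner_triple c p \<union> corner_triple c p'"]
      unfolding W_def w_def by (simp flip: power_mult)
  qed
  have EX: "(\<Sum>f\<in>\<Omega>. X f) = W * (D * w)"
  proof -
    have "(\<Sum>f\<in>\<Omega>. X f) = (\<Sum>p\<in>?O. real (card {f \<in> \<Omega>. \<forall>t\<in>corner_triple c p. f t = 0}))"
      unfolding X_def by (rule sum_double_count[OF fin\<Omega> finO])
    also have "\<dots> = (\<Sum>p\<in>?O. W * w)" by (rule sum.cong[OF refl one])
    finally show ?thesis by (simp add: D_def)
  qed
  have EXX: "(\<Sum>f\<in>\<Omega>. X f * X f) \<le> W * (D * w + D\<^sup>2 * w\<^sup>2)"
  proof -
    have "(\<Sum>f\<in>\<Omega>. X f * X f) = (\<Sum>p\<in>?O. \<Sum>f\<in>{f \<in> \<Omega>. \<forall>t\<in>corner_triple c p. f t = 0}. X f)"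
      unfolding X_def by (rule sum_weighted_double_count[OF fin\<Omega> finO])
    also have "\<dots> \<le> (\<Sum>p\<in>?O. W * w + D * (W * w\<^sup>2))"
    proof (rule sum_mono)
      fix p assume p: "p \<in> ?O"
      let ?A = "{f \<in> \<Omega>. \<forall>t\<in>corner_triple c p. f t = 0}"
      have "(\<Sum>f\<in>?A. X f) = (\<Sum>p'\<in>?O. real (card {f \<in> ?A. \<forall>t\<in>corner_triple c p'. f t = 0}))"
        unfolding X_def by (rule sum_double_count) (use fin\<Omega> finO in auto)
      also have "\<dots> = real (card {f \<in> ?A. \<forall>t\<in>corner_triple c p. f t = 0})
          + (\<Sum>p'\<in>?O - {p}. real (card {f \<in> ?A. \<forall>t\<in>corner_triple c p'. f t = 0}))"
        by (rule sum.remove[OF finO p])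
      also have "{f \<in> ?A. \<forall>t\<in>corner_triple c p. f t = 0} = ?A" by blast
      also have "(\<Sum>p'\<in>?O - {p}. real (card {f \<in> ?A. \<forall>t\<in>corner_triple c p'. f t = 0})) = (\<Sum>p'\<in>?O - {p}. W * w\<^sup>2)"
      proof (rule sum.cong[OF refl])
        fix p' assume "p' \<in> ?O - {p}"
        then have "p' \<in> ?O" "p \<noteq> p'" by auto
        then show "real (card {f \<in> ?A. \<forall>t\<in>corner_triple c p'. f t = 0}) = W * w\<^sup>2"
          using two[OF p, of p'] by (simp add: conj_ac)
      qed
      also have "\<dots> \<le> (\<Sum>p'\<in>?O. W * w\<^sup>2)"
        using finO W w by (intro sum_mono2) auto
      finally show "(\<Sum>f\<in>?A. X f) \<le> W * w + D * (W * w\<^sup>2)" using one[OF p] by (simp add: D_def)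
    qed
    also have "\<dots> = W * (D * w + D\<^sup>2 * w\<^sup>2)" by (simp add: D_def power2_eq_square algebra_simps)
    finally show ?thesis .
  qed
  have var: "(\<Sum>f\<in>\<Omega>. (X f - D * w)\<^sup>2) \<le> W * (D * w)"
  proof -
    have "(\<Sum>f\<in>\<Omega>. (X f - D * w)\<^sup>2) = (\<Sum>f\<in>\<Omega>. X f * X f - 2 * (D * w) * X f + (D * w)\<^sup>2)"
      by (rule sum.cong) (auto simp: power2_eq_square algebra_simps)
    also have "\<dots> = (\<Sum>f\<in>\<Omega>. X f * X f) - 2 * (D * w) * (\<Sum>f\<in>\<Omega>. X f) + W * (D * w)\<^sup>2"
      using W(2) by (simp add: sum.distrib sum_subtractf sum_distrib_left)
    also have "\<dots> \<le> W * (D * w + D\<^sup>2 * w\<^sup>2) - 2 * (D * w) * (W * (D * w)) + W * (D * w)\<^sup>2"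
      unfolding EX using EXX by simp
    also have "\<dots> = W * (D * w)" by (simp add: power2_eq_square algebra_simps)
    finally show ?thesis .
  qed
  define B where "B = {f \<in> \<Omega>. X f < \<beta> / (2 * real q ^ 3)}"
  have "(D * w / 2)\<^sup>2 * card B = (\<Sum>f\<in>B. (D * w / 2)\<^sup>2)" by simp
  also have "\<dots> \<le> (\<Sum>f\<in>B. (X f - D * w)\<^sup>2)"
  proof (rule sum_mono)
    fix f assume "f \<in> B"
    then have "X f < \<beta> * w / 2" by (simp add: B_def w_def power_divide)
    also have "\<dots> \<le> D * w / 2" using D w by (simp add: mult_right_mono)
    finally have "D * w / 2 \<le> D * w - X f" by simp
    moreover have "0 \<le> D * w / 2" using D w by simp
    ultimately have "(D * w / 2)\<^sup>2 \<le> (D * w - X f)\<^sup>2" by (rule power_mono)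
    then show "(D * w / 2)\<^sup>2 \<le> (X f - D * w)\<^sup>2" by (simp add: power2_commute)
  qed
  also have "\<dots> \<le> (\<Sum>f\<in>\<Omega>. (X f - D * w)\<^sup>2)"
    by (rule sum_mono2[OF fin\<Omega>]) (auto simp: B_def)
  also have "\<dots> \<le> W * (D * w)" by (rule var)
  finally have "(D * w) * (D * w * card B) \<le> (D * w) * (4 * W)" by (simp add: power2_eq_square algebra_simps)
  moreover have "D * w > 0" using D w by simp
  ultimately have "D * w * card B \<le> 4 * W" by (simp only: mult_le_cancel_left_pos)
  moreover have "\<beta> * w * card B \<le> D * w * card B" using D w by (intro mult_right_mono) auto
  ultimately have "\<beta> * w * card B \<le> 4 * W" by linarith
  then have "card B \<le> 4 * W / (\<beta> * w)" using \<beta> w by (simp add: pos_le_divide_eq mult.commute)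
  also have "\<dots> = W * (4 * real q ^ 3 / \<beta>)" using q by (simp add: w_def power_divide)
  finally show ?thesis unfolding B_def X_def \<Omega>_def W_def .
qed

text \<open>Divide the sizes of the random subset and of the set of badly covered cells by the
  bounds for their means. The sum of the two ratios averages at most 2, so some colouring keeps both
  ratios at most 2; this doubles the constants of the two expectations.\<close>

lemma sparse_generating_subset:
  fixes \<beta> :: real and q :: nat
  assumes P: "latin P" and core: "\<forall>c\<in>dom P. \<beta> \<le> card (opposite P c)" and \<beta>: "\<beta> > 0" and q: "q \<ge> 1"
  obtains R where "R \<subseteq> dom P" "card R \<le> 2 * real (card (dom P)) / real q"
    "card {c \<in> dom P. real (card {p \<in> opposite P c. corner_triple c p \<subseteq> R}) < \<beta> / (2 * real q ^ 3)}
      \<le> 8 * real q ^ 3 * card (dom P) / \<beta>"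
proof (cases "dom P = {}")
  case True
  then show ?thesis using that[of "{}"] by simp
next
  case False
  let ?V = "dom P" and ?\<Omega> = "dom P \<rightarrow>\<^sub>E {..<q}"
  define m where "m = real (card ?V)"
  define W where "W = real (q ^ card ?V)"
  define R where "R f = {c \<in> ?V. f c = 0}" for f :: "nat \<times> nat \<Rightarrow> nat"
  define U where "U f = {c \<in> ?V. real (card {p \<in> opposite P c. \<forall>t\<in>corner_triple c p. f t = 0}) < \<beta> / (2 * real q ^ 3)}"
    for f :: "nat \<times> nat \<Rightarrow> nat"
  have finV: "finite ?V" using P by (rule latinD_finite)
  have fin\<Omega>: "finite ?\<Omega>" using finV by (intro finite_PiE) auto
  have m: "m > 0" using False finV by (simp add: m_def card_gt_0_iff)
  have W: "W > 0" "real (card ?\<Omega>) = W" using q finV by (simp_all add: W_def card_PiE)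
  have ne: "?\<Omega> \<noteq> {}" using W by auto
  have R: "(\<Sum>f\<in>?\<Omega>. real (card (R f))) = W * (m / real q)"
  proof -
    have "(\<Sum>f\<in>?\<Omega>. real (card (R f))) = (\<Sum>c\<in>?V. real (card {f \<in> ?\<Omega>. f c = 0}))"
      unfolding R_def by (rule sum_double_count[OF fin\<Omega> finV])
    also have "\<dots> = (\<Sum>c\<in>?V. W * (1 / real q))"
    proof (rule sum.cong[OF refl])
      fix c assume "c \<in> ?V"
      then show "real (card {f \<in> ?\<Omega>. f c = 0}) = W * (1 / real q)"
        using card_colourings_zero_on[OF finV _ q, of "{c}"] by (simp add: W_def)
    qed
    finally show ?thesis by (simp add: m_def)
  qed
  have U: "(\<Sum>f\<in>?\<Omega>. real (card (U f))) \<le> W * (4 * real q ^ 3 * m / \<beta>)"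
  proof -
    have "(\<Sum>f\<in>?\<Omega>. real (card (U f))) = (\<Sum>c\<in>?V. real (card {f \<in> ?\<Omega>. real (card {p \<in> opposite P c. \<forall>t\<in>corner_triple c p. f t = 0}) < \<beta> / (2 * real q ^ 3)}))"
      unfolding U_def by (rule sum_double_count[OF fin\<Omega> finV])
    also have "\<dots> \<le> (\<Sum>c\<in>?V. W * (4 * real q ^ 3 / \<beta>))"
      unfolding W_def by (rule sum_mono) (use core in \<open>intro colour_chebyshev[OF P _ \<beta> q], blast\<close>)
    finally show ?thesis by (simp add: m_def algebra_simps)
  qed
  let ?r = "m / real q" and ?u = "4 * real q ^ 3 * m / \<beta>"
  have pos: "?r > 0" "?u > 0" using m q \<beta> by simp_all
  have "(\<Sum>f\<in>?\<Omega>. card (R f) / ?r + card (U f) / ?u) = (\<Sum>f\<in>?\<Omega>. real (card (R f))) / ?r + (\<Sum>f\<in>?\<Omega>. real (card (U f))) / ?u"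
    by (simp only: sum.distrib sum_divide_distrib)
  also have "\<dots> \<le> W * ?r / ?r + W * ?u / ?u"
    unfolding R using U pos by (intro add_mono divide_right_mono) auto
  also have "\<dots> = 2 * real (card ?\<Omega>)"
  proof -
    have c: "W * a / a = W" if "a > 0" for a :: real using that by simp
    show ?thesis unfolding c[OF pos(1)] c[OF pos(2)] using W by simp
  qed
  finally obtain f where f: "f \<in> ?\<Omega>" "card (R f) / ?r + card (U f) / ?u \<le> 2"
    using exists_le_average[OF fin\<Omega> ne] by blast
  have nn: "0 \<le> card (R f) / ?r" "0 \<le> card (U f) / ?u" by (intro divide_nonneg_pos of_nat_0_le_iff pos)+
  have "card (R f) / ?r \<le> 2" "card (U f) / ?u \<le> 2" using f(2) nn by linarith+
  then have bounds: "card (R f) \<le> 2 * ?r" "card (U f) \<le> 2 * ?u"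
    using pos by (simp_all only: pos_divide_le_eq)
  have "U f = {c \<in> ?V. real (card {p \<in> opposite P c. corner_triple c p \<subseteq> R f}) < \<beta> / (2 * real q ^ 3)}"
  proof -
    have "{p \<in> opposite P c. \<forall>t\<in>corner_triple c p. f t = 0} = {p \<in> opposite P c. corner_triple c p \<subseteq> R f}" for c
      using card_corner_triple(2)[of _ P c] by (auto simp: R_def)
    then show ?thesis by (simp add: U_def)
  qed
  then show ?thesis using that[of "R f"] bounds by (simp add: R_def m_def)
qed

section \<open>Counting cores\<close>

text \<open>The entries, that is cells with a symbol, that complete at least \<open>\<tau>\<close>
  triples of entries of \<open>A\<close> to intercalates. The result is a set of entries rather than
  an array because one cell may be a candidate with several symbols.\<close>

definition candidates :: "real \<Rightarrow> ((nat \<times> nat) \<times> nat) set \<Rightarrow> ((nat \<times> nat) \<times> nat) set" where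
  "candidates \<tau> A = {((i, x), s). \<tau> \<le> real (card {(j, y). \<exists>t. ((j, y), s) \<in> A \<and> ((i, y), t) \<in> A \<and> ((j, x), t) \<in> A})}"

text \<open>A completed triple is determined by the cell \<open>(j, y)\<close> opposite to the new
  one and by the row \<open>i\<close>: \<open>(i, y)\<close> yields \<open>t\<close>, and the place
  of \<open>t\<close> in row \<open>j\<close> yields \<open>x\<close>. This bounds the number of
  triples by the number of cells times the number of rows, and each candidate consumes
  \<open>\<tau>\<close> of them.\<close>

lemma candidates_card:
  assumes R: "latin R" and \<tau>: "\<tau> > 0"
  shows "finite (candidates \<tau> (Map.graph R))"
    "\<tau> * card (candidates \<tau> (Map.graph R)) \<le> real (card (dom R)) * card (fst ` dom R)"
proof -
  define W where "W = {(((i, x), s), (j, y)). \<exists>t. R (j, y) = Some s \<and> R (i, y) = Some t \<and> R (j, x) = Some t}"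
  let ?h = "\<lambda>(((i, x), s), (j, y)). ((j, y), i)"
  have finR: "finite (dom R)" using R by (rule latinD_finite)
  have inj: "inj_on ?h W"
  proof (rule inj_onI)
    fix a a' assume a: "a \<in> W" "a' \<in> W" and eq: "?h a = ?h a'"
    obtain i x s j y where 1: "a = (((i, x), s), (j, y))" by (metis surj_pair)
    obtain i' x' s' j' y' where 2: "a' = (((i', x'), s'), (j', y'))" by (metis surj_pair)
    have ij: "i' = i" "j' = j" "y' = y" using eq 1 2 by auto
    from a 1 obtain t where t: "R (j, y) = Some s" "R (i, y) = Some t" "R (j, x) = Some t" unfolding W_def by auto
    from a 2 have t': "R (j, y) = Some s'" "R (j, x') = Some t" unfolding W_def ij using t by auto
    have "x' = x" using latinD_row[OF R t'(2) t(3)] .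
    then show "a = a'" using t t' ij 1 2 by simp
  qed
  have sub: "?h ` W \<subseteq> dom R \<times> fst ` dom R" unfolding W_def by (force simp: image_iff)
  have finW: "finite W" using inj sub finR by (meson finite_SigmaI finite_imageD finite_imageI finite_subset)
  have cW: "card W \<le> card (dom R) * card (fst ` dom R)"
    using card_inj_on_le[OF inj sub] finR by (simp add: card_cartesian_product)
  let ?C = "candidates \<tau> (Map.graph R)"
  have fib: "\<tau> \<le> card {w \<in> W. fst w = a}" if "a \<in> ?C" for a
  proof -
    obtain i x s where a: "a = ((i, x), s)" by (metis surj_pair)
    have "{w \<in> W. fst w = a} = Pair a ` {(j, y). \<exists>t. ((j, y), s) \<in> Map.graph R \<and> ((i, y), t) \<in> Map.graph R \<and> ((j, x), t) \<in> Map.graph R}"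
      unfolding W_def a Map.graph_def by auto
    then have "card {w \<in> W. fst w = a} = card {(j, y). \<exists>t. ((j, y), s) \<in> Map.graph R \<and> ((i, y), t) \<in> Map.graph R \<and> ((j, x), t) \<in> Map.graph R}"
      by (simp add: card_image inj_on_def)
    then show ?thesis using that unfolding candidates_def a by simp
  qed
  have subC: "?C \<subseteq> fst ` W"
  proof
    fix a assume "a \<in> ?C"
    then have "0 < card {w \<in> W. fst w = a}" using fib[of a] \<tau> by (simp del: Collect_conj_eq)
    then show "a \<in> fst ` W" by (metis (mono_tags, lifting) card_gt_0_iff empty_Collect_eq image_eqI)
  qed
  show "finite ?C" using subC finW finite_subset by blast
  have "\<tau> * card ?C \<le> card W" by (rule card_large_fibres[OF finW subC fib])
  also have "\<dots> \<le> real (card (dom R)) * card (fst ` dom R)" using cW by (simp flip: of_nat_mult)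
  finally show "\<tau> * card ?C \<le> real (card (dom R)) * card (fst ` dom R)" .
qed

lemma card_small_subsets_le:
  assumes "finite U"
  shows "card {A. A \<subseteq> U \<and> card A \<le> r} \<le> (card U + 1) ^ r"
proof (induction r)
  case 0
  have "A = {}" if "A \<subseteq> U" "card A = 0" for A using that assms by (metis card_0_eq finite_subset)
  then have "{A. A \<subseteq> U \<and> card A \<le> 0} = {{}}" by auto
  then show ?case by simp
next
  case (Suc r)
  let ?S = "\<lambda>r. {A. A \<subseteq> U \<and> card A \<le> r}"
  let ?O = "insert None (Some ` U)" and ?h = "\<lambda>(A, z). case z of None \<Rightarrow> A | Some u \<Rightarrow> insert u A"
  have fin: "finite (?S r)" by (rule finite_subset[of _ "Pow U"]) (use assms in auto)
  have "?S (Suc r) \<subseteq> ?h ` (?S r \<times> ?O)"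
  proof
    fix A assume A: "A \<in> ?S (Suc r)"
    show "A \<in> ?h ` (?S r \<times> ?O)"
    proof (cases "A = {}")
      case True
      then show ?thesis by (intro image_eqI[of _ _ "({}, None)"]) auto
    next
      case False
      then obtain u where u: "u \<in> A" by blast
      have "card (A - {u}) \<le> r" using A u assms finite_subset by (auto simp: card_Diff_singleton)
      then show ?thesis using A u by (intro image_eqI[of _ _ "(A - {u}, Some u)"]) auto
    qed
  qed
  then have "card (?S (Suc r)) \<le> card (?h ` (?S r \<times> ?O))"
    using fin assms by (intro card_mono) auto
  also have "\<dots> \<le> card (?S r \<times> ?O)" using fin assms by (intro card_image_le) auto
  also have "\<dots> = card (?S r) * (card U + 1)"
    using assms by (simp add: card_cartesian_product card_image)
  also have "\<dots> \<le> (card U + 1) ^ r * (card U + 1)" by (rule mult_right_mono[OF Suc.IH]) simp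
  finally show ?case by (simp only: power_Suc mult.commute)
qed

text \<open>Give each subset \<open>A\<close> of \<open>C\<close> the weight
  \<open>p ^ card A\<close> with \<open>p = m / X\<close>. The total weight is
  \<open>(1 + p) ^ card C \<le> exp m\<close>, while every counted set weighs at least
  \<open>p ^ m\<close>; this is the usual bound for sums of binomial coefficients.\<close>

lemma card_subsets_of_small_le:
  fixes X :: real
  assumes "finite C" "card C \<le> X" "real m \<le> X" "m > 0"
  shows "card {A. A \<subseteq> C \<and> card A \<le> m} \<le> (exp 1 * X / m) ^ m"
proof -
  let ?S = "{A. A \<subseteq> C \<and> card A \<le> m}"
  define p where "p = real m / X"
  have X: "X > 0" using assms by linarith
  have p: "0 < p" "p \<le> 1" using X assms by (simp_all add: p_def)
  have "p ^ m * card ?S = (\<Sum>A\<in>?S. p ^ m)" by simp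
  also have "\<dots> \<le> (\<Sum>A\<in>?S. p ^ card A)"
    by (rule sum_mono) (use p in \<open>auto intro: power_decreasing\<close>)
  also have "\<dots> \<le> (\<Sum>A\<in>Pow C. p ^ card A)"
    using assms(1) p by (intro sum_mono2) auto
  also have "\<dots> = (1 + p) ^ card C"
    using assms(1)
  proof (induction rule: finite_induct)
    case (insert x F)
    have "(\<Sum>A\<in>Pow (insert x F). p ^ card A) = (\<Sum>A\<in>Pow F. p ^ card A) + (\<Sum>A\<in>insert x ` Pow F. p ^ card A)"
      unfolding Pow_insert using insert by (intro sum.union_disjoint) auto
    also have "(\<Sum>A\<in>insert x ` Pow F. p ^ card A) = (\<Sum>A\<in>Pow F. p ^ card (insert x A))"
      using insert by (intro sum.reindex_cong[of "insert x"]) (auto simp: inj_on_def)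
    also have "\<dots> = (\<Sum>A\<in>Pow F. p * p ^ card A)"
    proof (rule sum.cong[OF refl])
      fix A assume "A \<in> Pow F"
      then have "finite A" "x \<notin> A" using insert finite_subset by auto
      then show "p ^ card (insert x A) = p * p ^ card A" by simp
    qed
    finally show ?case using insert by (simp add: sum_distrib_left[symmetric] algebra_simps)
  qed simp
  also have "\<dots> \<le> exp p ^ card C"
    using p by (intro power_mono) (auto simp: exp_ge_add_one_self)
  also have "\<dots> = exp (card C * p)" by (simp add: exp_of_nat_mult)
  also have "\<dots> \<le> exp m"
  proof -
    have "real (card C) * p \<le> X * p" using assms p by (intro mult_right_mono) auto
    also have "\<dots> = m" using X by (simp add: p_def)
    finally show ?thesis by simp
  qed
  finally have "p ^ m * card ?S \<le> exp m" .
  then have "card ?S \<le> exp m / p ^ m" using p by (simp add: pos_le_divide_eq mult.commute)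
  also have "exp m / p ^ m = (exp 1 * X / m) ^ m"
    using X assms(4) exp_of_nat_mult[of m "1::real"] by (simp add: p_def power_divide power_mult_distrib)
  finally show ?thesis .
qed

definition cores :: "nat \<Rightarrow> nat \<Rightarrow> real \<Rightarrow> nat \<Rightarrow> partial_array set" where
  "cores k n \<beta> m = {P. latin P \<and> dom P \<subseteq> {1..k} \<times> {1..n} \<and> ran P \<subseteq> {1..n} \<and> card (dom P) = m \<and>
     (\<forall>c\<in>dom P. \<beta> \<le> card (opposite P c))}"

lemma card_graph: "card (Map.graph P) = card (dom P)"
  by (simp add: graph_eq_to_snd_dom card_image inj_on_def)

lemma inj_graph: "inj Map.graph"
proof (rule injI)
  fix P Q :: "'a \<Rightarrow> 'b option" assume eq: "Map.graph P = Map.graph Q"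
  have "P c = Some s \<longleftrightarrow> Q c = Some s" for c s using eq unfolding Map.graph_def set_eq_iff by auto
  then show "P = Q" by (intro ext) (metis not_Some_eq)
qed

text \<open>A core is encoded by its sparse subset \<open>A\<close>, the set \<open>B\<close> of cells not generated by \<open>A\<close>, and
  a subset \<open>W\<close> of the candidates of \<open>A\<close>. Requiring a candidate to complete at least \<open>\<tau>\<close> triples, rather than
  just one, keeps the number of candidates within a factor \<open>max 1 (m / (\<beta> \<tau>))\<close> of \<open>m\<close>.\<close>

lemma card_cores_le:
  fixes \<beta> :: real and q :: nat
  assumes \<beta>: "\<beta> > 0" and q: "q \<ge> 1" and m: "m > 0"
  shows "finite (cores k n \<beta> m)"
    "card (cores k n \<beta> m) \<le> (real k * real n * real n + 1) powr (2 * real m / q + 8 * real q ^ 3 * m / \<beta>) *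
      (exp 1 * max 1 (2 * real q ^ 3 * m / \<beta>\<^sup>2)) ^ m"
proof -
  let ?U = "({1..k} \<times> {1..n}) \<times> {1..n}"
  define \<tau> where "\<tau> = \<beta> / (2 * real q ^ 3)"
  have \<tau>: "\<tau> > 0" using \<beta> q by (simp add: \<tau>_def)
  define r1 where "r1 = nat \<lfloor>2 * real m / q\<rfloor>"
  define r2 where "r2 = nat \<lfloor>8 * real q ^ 3 * m / \<beta>\<rfloor>"
  \<comment> \<open>The sparse part inherits from the core that it has at most
    \<open>m / \<beta>\<close> rows; this feeds the row factor of
    \<open>candidates_card\<close>.\<close>
  define \<A> where "\<A> = {A. A \<subseteq> ?U \<and> card A \<le> r1 \<and> (\<exists>R. A = Map.graph R \<and> latin R \<and> card (dom R) \<le> m \<and> \<beta> * card (fst ` dom R) \<le> m)}"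
  define \<B> where "\<B> = {A. A \<subseteq> ?U \<and> card A \<le> r2}"
  define \<W> where "\<W> A = {W. W \<subseteq> candidates \<tau> A \<and> card W \<le> m}" for A
  let ?N = "real k * real n * real n + 1"
  \<comment> \<open>Bound for the number of candidates, raised to \<open>m\<close> if necessary, as
    \<open>card_subsets_of_small_le\<close> asks for \<open>m \<le> X\<close>.\<close>
  let ?X = "max (real m) (real m * (real m / \<beta>) / \<tau>)"
  have cU: "card ?U = k * n * n" by (simp add: card_cartesian_product)
  have A0: "\<A> \<subseteq> {A. A \<subseteq> ?U \<and> card A \<le> r1}" by (auto simp: \<A>_def)
  have fin0: "finite {A. A \<subseteq> ?U \<and> card A \<le> r}" for r by (rule finite_subset[of _ "Pow ?U"]) auto
  have finA: "finite \<A>" by (rule finite_subset[OF A0 fin0])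
  have finB: "finite \<B>" unfolding \<B>_def by (rule fin0)
  have small: "real (card {A. A \<subseteq> ?U \<and> card A \<le> r}) \<le> ?N powr x" if "real r \<le> x" for r x
  proof -
    have "card {A. A \<subseteq> ?U \<and> card A \<le> r} \<le> (k * n * n + 1) ^ r"
      using card_small_subsets_le[of ?U r] unfolding cU by simp
    then have "real (card {A. A \<subseteq> ?U \<and> card A \<le> r}) \<le> real ((k * n * n + 1) ^ r)" by (simp only: of_nat_le_iff)
    also have "\<dots> = ?N ^ r" by (simp add: add.commute)
    also have "\<dots> = ?N powr real r" by (rule powr_realpow[symmetric]) (simp add: add_nonneg_pos)
    also have "\<dots> \<le> ?N powr x" using that by (intro powr_mono) auto
    finally show ?thesis .
  qed
  have cA: "real (card \<A>) \<le> ?N powr (2 * real m / q)"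
  proof -
    have "real (card \<A>) \<le> real (card {A. A \<subseteq> ?U \<and> card A \<le> r1})"
      by (intro of_nat_mono card_mono fin0 A0)
    also have "\<dots> \<le> ?N powr (2 * real m / q)" by (rule small) (simp add: r1_def)
    finally show ?thesis .
  qed
  have cB: "real (card \<B>) \<le> ?N powr (8 * real q ^ 3 * m / \<beta>)"
    unfolding \<B>_def by (rule small) (use \<beta> in \<open>simp add: r2_def\<close>)
  have cand: "finite (candidates \<tau> A)" "real (card (candidates \<tau> A)) \<le> ?X" if A: "A \<in> \<A>" for A
  proof -
    obtain R where R: "A = Map.graph R" "latin R" "card (dom R) \<le> m" "\<beta> * card (fst ` dom R) \<le> m"
      using A unfolding \<A>_def by blast
    show "finite (candidates \<tau> A)" unfolding R(1) by (rule candidates_card(1)[OF R(2) \<tau>])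
    have "\<tau> * card (candidates \<tau> A) \<le> real (card (dom R)) * card (fst ` dom R)"
      unfolding R(1) by (rule candidates_card(2)[OF R(2) \<tau>])
    also have "\<dots> \<le> real m * (real m / \<beta>)"
    proof (rule mult_mono)
      show "real (card (fst ` dom R)) \<le> real m / \<beta>" using R(4) \<beta> by (simp add: pos_le_divide_eq mult.commute)
    qed (use R(3) in auto)
    finally have "real (card (candidates \<tau> A)) \<le> real m * (real m / \<beta>) / \<tau>"
      using \<tau> by (simp only: pos_le_divide_eq mult.commute)
    then show "real (card (candidates \<tau> A)) \<le> ?X" by simp
  qed
  have cW: "finite (\<W> A)" "real (card (\<W> A)) \<le> (exp 1 * ?X / m) ^ m" if A: "A \<in> \<A>" for A
  proof -
    show "finite (\<W> A)" unfolding \<W>_def by (rule finite_subset[of _ "Pow (candidates \<tau> A)"]) (use cand[OF A] in auto)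
    show "real (card (\<W> A)) \<le> (exp 1 * ?X / m) ^ m"
      unfolding \<W>_def by (rule card_subsets_of_small_le[OF cand[OF A] _ m]) simp
  qed
  let ?S = "SIGMA A:\<A>. \<B> \<times> \<W> A" and ?h = "\<lambda>(A, B, W). A \<union> B \<union> W"
  have finS: "finite ?S" using finA finB cW by (intro finite_SigmaI finite_cartesian_product)
  have sub: "Map.graph ` cores k n \<beta> m \<subseteq> ?h ` ?S"
  proof clarify
    fix P assume "P \<in> cores k n \<beta> m"
    then have P: "latin P" "dom P \<subseteq> {1..k} \<times> {1..n}" "ran P \<subseteq> {1..n}" "card (dom P) = m"
      "\<forall>c\<in>dom P. \<beta> \<le> card (opposite P c)" unfolding cores_def by auto
    obtain R where R: "R \<subseteq> dom P" "card R \<le> 2 * real m / real q"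
      "card {c \<in> dom P. real (card {p \<in> opposite P c. corner_triple c p \<subseteq> R}) < \<tau>} \<le> 8 * real q ^ 3 * m / \<beta>"
      by (rule sparse_generating_subset[OF P(1,5) \<beta> q, unfolded P(4), folded \<tau>_def])
    define V where "V = {c \<in> dom P. real (card {p \<in> opposite P c. corner_triple c p \<subseteq> R}) < \<tau>}"
    have finP: "finite (dom P)" by (rule latinD_finite[OF P(1)])
    define A where "A = Map.graph (P |` R)"
    define B where "B = Map.graph (P |` V)"
    \<comment> \<open>An entry outside \<open>A\<close> and \<open>B\<close> belongs to a cell
      outside \<open>V\<close>, which \<open>R\<close> covers with at least \<open>\<tau>\<close>
      triples. Hence it is a candidate, and \<open>W\<close> can be chosen from that short
      list.\<close>
    define W where "W = Map.graph P - A - B"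
    have dR: "dom (P |` R) = R" "dom (P |` V) = V" using R(1) by (auto simp: V_def)
    have gU: "Map.graph P \<subseteq> ?U"
    proof clarify
      fix i x s assume "((i, x), s) \<in> Map.graph P"
      then have "P (i, x) = Some s" by (simp add: Map.graph_def)
      then show "(i, x) \<in> {1..k} \<times> {1..n} \<and> s \<in> {1..n}" using P(2,3) ranI[of P "(i, x)" s] domI[of P "(i, x)" s] by blast
    qed
    have AP: "A \<subseteq> Map.graph P" "B \<subseteq> Map.graph P"
      unfolding A_def B_def Map.graph_def by (auto simp: restrict_map_def split: if_splits)
    have "A \<in> \<A>"
    proof -
      have "card A = card R" unfolding A_def using card_graph[of "P |` R"] dR by simp
      then have "card A \<le> r1" using R(2) by (simp add: r1_def le_nat_floor)
      moreover have "A = Map.graph (P |` R) \<and> latin (P |` R) \<and> card (dom (P |` R)) \<le> m \<and> \<beta> * card (fst ` dom (P |` R)) \<le> m"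
      proof (intro conjI)
        show "card (dom (P |` R)) \<le> m" unfolding dR using card_mono[OF finP R(1)] P(4) by simp
        have "card (fst ` R) \<le> card (fst ` dom P)" using finP R(1) by (intro card_mono) auto
        then have "\<beta> * card (fst ` R) \<le> \<beta> * card (fst ` dom P)" using \<beta> by simp
        also have "\<dots> \<le> m" using core_rows(1)[OF P(1,5)] P(4) by simp
        finally show "\<beta> * card (fst ` dom (P |` R)) \<le> m" unfolding dR .
      qed (auto simp: A_def intro: latin_restrict[OF P(1)])
      ultimately show ?thesis unfolding \<A>_def using AP gU by blast
    qed
    moreover have "B \<in> \<B>"
    proof -
      have "card B = card V" unfolding B_def using card_graph[of "P |` V"] dR by simp
      then have "card B \<le> r2" using R(3) by (simp add: r2_def le_nat_floor V_def)
      then show ?thesis unfolding \<B>_def using AP gU by blast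
    qed
    moreover have "W \<in> \<W> A"
    proof -
      have "card W \<le> card (Map.graph P)"
        unfolding W_def using finP by (intro card_mono) auto
      then have "card W \<le> m" using card_graph[of P] P(4) by simp
      moreover have "W \<subseteq> candidates \<tau> A"
      proof clarify
        fix i x s assume w: "((i, x), s) \<in> W"
        then have Ps: "P (i, x) = Some s" by (simp add: W_def Map.graph_def)
        have "(i, x) \<notin> V" using w Ps unfolding W_def B_def Map.graph_def by (auto simp: restrict_map_def)
        then have "\<tau> \<le> real (card {p \<in> opposite P (i, x). corner_triple (i, x) p \<subseteq> R})"
          using Ps unfolding V_def by (auto simp: not_less)
        also have "\<dots> \<le> real (card {(j, y). \<exists>t. ((j, y), s) \<in> A \<and> ((i, y), t) \<in> A \<and> ((j, x), t) \<in> A})"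
        proof (intro of_nat_mono card_mono)
          show "finite {(j, y). \<exists>t. ((j, y), s) \<in> A \<and> ((i, y), t) \<in> A \<and> ((j, x), t) \<in> A}"
            by (rule finite_subset[of _ "dom P"]) (use finP AP in \<open>auto simp: Map.graph_def\<close>)
          show "{p \<in> opposite P (i, x). corner_triple (i, x) p \<subseteq> R} \<subseteq> {(j, y). \<exists>t. ((j, y), s) \<in> A \<and> ((i, y), t) \<in> A \<and> ((j, x), t) \<in> A}"
            using Ps by (auto simp: opposite_def corner_triple_def A_def Map.graph_def)
        qed
        finally show "((i, x), s) \<in> candidates \<tau> A" unfolding candidates_def by simp
      qed
      ultimately show ?thesis unfolding \<W>_def by blast
    qed
    moreover have "Map.graph P = ?h (A, B, W)" using AP by (auto simp: W_def)
    ultimately show "Map.graph P \<in> ?h ` ?S" by (intro image_eqI[of _ _ "(A, B, W)"]) auto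
  qed
  have injg: "inj_on Map.graph (cores k n \<beta> m)" using inj_graph by (rule inj_on_subset) simp
  show fin: "finite (cores k n \<beta> m)" using sub finS injg by (meson finite_imageD finite_imageI finite_subset)
  have "card (cores k n \<beta> m) = card (Map.graph ` cores k n \<beta> m)" using injg by (simp add: card_image)
  also have "\<dots> \<le> card (?h ` ?S)" using finS by (intro card_mono[OF _ sub]) auto
  also have "\<dots> \<le> card ?S" using finS by (rule card_image_le)
  also have "\<dots> = (\<Sum>A\<in>\<A>. card (\<B> \<times> \<W> A))" using finA finB cW by (intro card_SigmaI) auto
  finally have "real (card (cores k n \<beta> m)) \<le> (\<Sum>A\<in>\<A>. real (card \<B>) * real (card (\<W> A)))"
    by (simp add: card_cartesian_product flip: of_nat_mult of_nat_sum)
  also have "\<dots> \<le> (\<Sum>A\<in>\<A>. ?N powr (8 * real q ^ 3 * m / \<beta>) * (exp 1 * ?X / m) ^ m)"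
    by (intro sum_mono mult_mono cB cW) auto
  also have "\<dots> = card \<A> * (?N powr (8 * real q ^ 3 * m / \<beta>) * (exp 1 * ?X / m) ^ m)" by simp
  also have "\<dots> \<le> ?N powr (2 * real m / q) * (?N powr (8 * real q ^ 3 * m / \<beta>) * (exp 1 * ?X / m) ^ m)"
    by (intro mult_right_mono cA) auto
  also have "\<dots> = ?N powr (2 * real m / q + 8 * real q ^ 3 * m / \<beta>) * (exp 1 * (?X / m)) ^ m"
    by (simp add: powr_add)
  also have "?X / m = max 1 (2 * real q ^ 3 * m / \<beta>\<^sup>2)"
  proof -
    have "?X / m = max (real m / m) ((real m * (real m / \<beta>) / \<tau>) / m)"
      using m by (simp add: max_divide_distrib_right)
    also have "(real m * (real m / \<beta>) / \<tau>) / m = 2 * real q ^ 3 * m / \<beta>\<^sup>2"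
      using m by (simp add: \<tau>_def power2_eq_square)
    finally show ?thesis using m by simp
  qed
  finally show "card (cores k n \<beta> m) \<le> ?N powr (2 * real m / q + 8 * real q ^ 3 * m / \<beta>) *
      (exp 1 * max 1 (2 * real q ^ 3 * m / \<beta>\<^sup>2)) ^ m" .
qed

text \<open>A core has at most \<open>m / \<beta>\<close> columns, hence rows of at most that size,
  so each of its \<open>m\<close> cells costs a factor \<open>1 / d\<close>. A union bound over all
  cores follows.\<close>

lemma card_containing_core_le:
  fixes \<beta> d :: real
  assumes \<beta>: "\<beta> > 0" and m: "m > 0" and d: "d > 0" "d \<le> real n - m / \<beta> - 2 * real k"
  shows "card {L \<in> latin_rectangles k n. \<exists>P\<in>cores k n \<beta> m. P \<subseteq>\<^sub>m L}
    \<le> card (cores k n \<beta> m) * (card (latin_rectangles k n) / d ^ m)"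
proof -
  have fin: "finite (cores k n \<beta> m)" by (rule card_cores_le(1)[OF \<beta> order_refl m])
  have "card {L \<in> latin_rectangles k n. \<exists>P\<in>cores k n \<beta> m. P \<subseteq>\<^sub>m L} \<le> card (\<Union>P\<in>cores k n \<beta> m. extensions k n P)"
    using fin by (intro card_mono) (auto simp: extensions_def)
  also have "\<dots> \<le> (\<Sum>P\<in>cores k n \<beta> m. card (extensions k n P))" by (rule card_UN_le[OF fin])
  finally have "real (card {L \<in> latin_rectangles k n. \<exists>P\<in>cores k n \<beta> m. P \<subseteq>\<^sub>m L}) \<le> (\<Sum>P\<in>cores k n \<beta> m. real (card (extensions k n P)))"
    by (simp flip: of_nat_sum)
  also have "\<dots> \<le> (\<Sum>P\<in>cores k n \<beta> m. card (latin_rectangles k n) / d ^ m)"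
  proof (rule sum_mono)
    fix P assume "P \<in> cores k n \<beta> m"
    then have P: "latin P" "card (dom P) = m" "\<forall>c\<in>dom P. \<beta> \<le> card (opposite P c)" unfolding cores_def by auto
    have finP: "finite (dom P)" by (rule latinD_finite[OF P(1)])
    have row: "row_size P i \<le> m / \<beta>" for i
    proof -
      have "{x. (i, x) \<in> dom P} \<subseteq> snd ` dom P" by force
      then have "row_size P i \<le> card (snd ` dom P)" unfolding row_size_def using finP by (intro card_mono) auto
      then have "\<beta> * row_size P i \<le> \<beta> * card (snd ` dom P)" using \<beta> by simp
      also have "\<dots> \<le> m" using core_rows(2)[OF P(1,3)] P(2) by simp
      finally show ?thesis using \<beta> by (simp add: pos_le_divide_eq mult.commute)
    qed
    have "d ^ card (dom P - dom (Map.empty :: partial_array)) * card (extensions k n P) \<le> card (extensions k n (Map.empty :: partial_array))"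
    proof (rule card_extensions_le[OF map_le_empty finP])
      show "d \<le> real n - row_size P i - 2 * real k" for i using row[of i] d by linarith
    qed (use d in simp)
    then have "d ^ m * card (extensions k n P) \<le> card (latin_rectangles k n)"
      using P(2) by (simp add: extensions_def)
    then show "real (card (extensions k n P)) \<le> card (latin_rectangles k n) / d ^ m"
      using d by (simp add: pos_le_divide_eq mult.commute)
  qed
  finally show ?thesis by simp
qed

section \<open>Tail bounds\<close>

text \<open>The moment of order \<open>h\<close> fixes at most \<open>4 * h\<close> cells, so only
  seeds up to that size matter. If no seed is present, Markov's inequality for the moment gives the
  first summand. Otherwise a core is extracted at a loss of
  \<open>\<beta> * (4 * h) = \<epsilon> * \<mu>\<close>, and its size lies between \<open>m0\<close>
  and \<open>4 * h\<close>, which gives the second.\<close>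

lemma many_intercalates_le:
  fixes \<epsilon> \<delta> \<rho> d r m0 :: real and h q k n :: nat
  defines "\<mu> \<equiv> (real k)\<^sup>2 / 4"
  defines "\<beta> \<equiv> \<epsilon> * \<mu> / real (4 * h)"
  assumes k: "k > 0" and \<epsilon>: "\<epsilon> > 0" "3 * \<epsilon> < \<delta>" and h: "h > 0" and q: "q \<ge> 1"
    and r: "r > 0" and d: "d > 0" "d \<le> real n - r - 2 - 2 * real k"
    and mean: "(real k)\<^sup>2 * (real n)\<^sup>2 / (4 * d\<^sup>2) + real (4 * h) * k / d + (real (4 * h))\<^sup>2 / r
        + (real (4 * h))\<^sup>2 * n / r\<^sup>2 \<le> (1 + \<epsilon>) * \<mu>"
    and n2: "n > 0" "real n / 2 \<le> real n - real (4 * h) / \<beta> - 2 * real k"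
    and count: "\<And>m. 0 < m \<Longrightarrow> m \<le> 4 * h \<Longrightarrow>
      (real k * real n * real n + 1) powr (2 * real m / q + 8 * real q ^ 3 * m / \<beta>) *
      (exp 1 * max 1 (2 * real q ^ 3 * m / \<beta>\<^sup>2)) ^ m * (2 / real n) ^ m \<le> exp (- \<rho> * m)"
    and \<rho>: "\<rho> \<ge> 0" and m0: "m0 \<le> Phi ((\<delta> - 3 * \<epsilon>) * \<mu>)"
  shows "card {L \<in> latin_rectangles k n. (1 + \<delta>) * \<mu> \<le> num_intercalates L}
    \<le> card (latin_rectangles k n) * (((1 + \<delta> - \<epsilon>) / (1 + \<delta>)) ^ h + real (4 * h) * exp (- \<rho> * m0))"
proof -
  let ?LR = "latin_rectangles k n"
  have \<mu>: "\<mu> > 0" using k by (simp add: \<mu>_def)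
  have \<beta>: "\<beta> > 0" using \<epsilon> \<mu> h by (simp add: \<beta>_def)
  define M where "M = (1 + \<delta> - \<epsilon>) * \<mu>"
  \<comment> \<open>A non-seed has fewer than \<open>(\<delta> - 2 * \<epsilon>) * \<mu>\<close>
    intercalates; with the bound \<open>(1 + \<epsilon>) * \<mu>\<close> for the mean of the rest
    this adds up to \<open>M\<close>, which stays below the target by
    \<open>\<epsilon> * \<mu>\<close>. A third \<open>\<epsilon>\<close> is spent on passing from a
    seed to its core.\<close>
  define N0 where "N0 = nat \<lceil>(\<delta> - 2 * \<epsilon>) * \<mu>\<rceil>"
  define good where "good L \<longleftrightarrow> (\<forall>S. S \<subseteq>\<^sub>m L \<longrightarrow> card (dom S) \<le> 4 * h \<longrightarrow> num_intercalates S < N0)" for L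
  have N0: "real (num_intercalates S) < (\<delta> - 2 * \<epsilon>) * \<mu>" if "num_intercalates S < N0" for S
    using that unfolding N0_def by linarith
  have "(\<Sum>L\<in>{L \<in> extensions k n Map.empty. good L}. real (num_intercalates L) ^ h) \<le> M ^ h * card (extensions k n Map.empty)"
    unfolding good_def
  proof (rule sum_power_intercalates_le)
    fix S :: partial_array assume S: "finite (dom S)" "card (dom S) \<le> 4 * h" "num_intercalates S < N0"
    define \<sigma> where "\<sigma> = real (card (dom S))"
    have \<sigma>: "0 \<le> \<sigma>" "\<sigma> \<le> real (4 * h)" using S(2) unfolding \<sigma>_def by (simp_all only: of_nat_le_iff of_nat_0_le_iff)
    have \<sigma>2: "\<sigma>\<^sup>2 \<le> (real (4 * h))\<^sup>2" using \<sigma> by (intro power_mono)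
    have "\<sigma> * k / d \<le> real (4 * h) * k / d" using \<sigma> d by (intro divide_right_mono mult_right_mono) auto
    moreover have "\<sigma>\<^sup>2 / r \<le> (real (4 * h))\<^sup>2 / r" using \<sigma>2 r by (intro divide_right_mono) auto
    moreover have "\<sigma>\<^sup>2 * n / r\<^sup>2 \<le> (real (4 * h))\<^sup>2 * n / r\<^sup>2" using \<sigma>2 r by (intro divide_right_mono mult_right_mono) auto
    ultimately have "num_intercalates S + (real k)\<^sup>2 * (real n)\<^sup>2 / (4 * d\<^sup>2) + \<sigma> * k / d + \<sigma>\<^sup>2 / r + \<sigma>\<^sup>2 * n / r\<^sup>2 \<le> (\<delta> - 2 * \<epsilon>) * \<mu> + (1 + \<epsilon>) * \<mu>"
      using mean N0[OF S(3)] by linarith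
    also have "\<dots> = M" by (simp add: M_def algebra_simps)
    finally have "card (extensions k n S) * (num_intercalates S + (real k)\<^sup>2 * (real n)\<^sup>2 / (4 * d\<^sup>2) + \<sigma> * k / d + \<sigma>\<^sup>2 / r + \<sigma>\<^sup>2 * n / r\<^sup>2) \<le> card (extensions k n S) * M"
      by (intro mult_left_mono) auto
    then show "(\<Sum>L\<in>extensions k n S. real (num_intercalates L)) \<le> M * card (extensions k n S)"
      using sum_intercalates_extensions_le[OF S(1) r d] unfolding \<sigma>_def by (simp only: mult.commute)
  next
    show "M \<ge> 0" using \<epsilon> \<mu> by (simp add: M_def)
  qed auto
  then have moment: "(\<Sum>L\<in>{L \<in> ?LR. good L}. real (num_intercalates L) ^ h) \<le> M ^ h * card ?LR"
    unfolding extensions_empty .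
  define T where "T = (1 + \<delta>) * \<mu>"
  have T: "T > 0" using \<epsilon> \<mu> by (simp add: T_def)
  define G where "G = {L \<in> ?LR. good L \<and> T \<le> num_intercalates L}"
  define B where "B = {L \<in> ?LR. \<not> good L}"
  have "T ^ h * card G = (\<Sum>L\<in>G. T ^ h)" by simp
  also have "\<dots> \<le> (\<Sum>L\<in>G. real (num_intercalates L) ^ h)"
    by (rule sum_mono, rule power_mono) (use T in \<open>auto simp: G_def\<close>)
  also have "\<dots> \<le> (\<Sum>L\<in>{L \<in> ?LR. good L}. real (num_intercalates L) ^ h)"
    by (rule sum_mono2) (auto simp: G_def)
  also note moment
  finally have "card G \<le> M ^ h * card ?LR / T ^ h" using T by (simp add: pos_le_divide_eq mult.commute)
  also have "M ^ h * card ?LR / T ^ h = card ?LR * (M / T) ^ h" by (simp add: power_divide)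
  also have "M / T = (1 + \<delta> - \<epsilon>) / (1 + \<delta>)" using \<mu> by (simp add: M_def T_def)
  finally have cG: "card G \<le> card ?LR * ((1 + \<delta> - \<epsilon>) / (1 + \<delta>)) ^ h" .
  let ?I = "{m \<in> {1..4 * h}. m0 \<le> real m}"
  let ?C = "\<lambda>m. {L \<in> ?LR. \<exists>P\<in>cores k n \<beta> m. P \<subseteq>\<^sub>m L}"
  have "B \<subseteq> (\<Union>m\<in>?I. ?C m)"
  proof
    fix L assume "L \<in> B"
    then obtain S where L: "L \<in> ?LR" and S: "S \<subseteq>\<^sub>m L" "card (dom S) \<le> 4 * h" "N0 \<le> num_intercalates S"
      unfolding B_def good_def by (auto simp: not_less)
    have latL: "latin L" by (rule latin_rectangles_latin[OF L])
    have finS: "finite (dom S)" using latinD_finite[OF latL] map_le_implies_dom_le[OF S(1)] finite_subset by blast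
    obtain P where P: "P \<subseteq>\<^sub>m S" "\<forall>c\<in>dom P. \<beta> \<le> card (opposite P c)"
      "num_intercalates S \<le> num_intercalates P + \<beta> * card (dom S)"
      using core_exists[OF finS, of \<beta>] \<beta> by auto
    have PL: "P \<subseteq>\<^sub>m L" by (rule map_le_trans[OF P(1) S(1)])
    have latP: "latin P" by (rule latin_map_le[OF latL PL])
    have "\<beta> * card (dom S) \<le> \<beta> * real (4 * h)" using S(2) \<beta> by (intro mult_left_mono) (simp_all only: of_nat_le_iff less_imp_le)
    also have "\<dots> = \<epsilon> * \<mu>" using h by (simp add: \<beta>_def)
    finally have "\<beta> * card (dom S) \<le> \<epsilon> * \<mu>" .
    moreover have "(\<delta> - 2 * \<epsilon>) * \<mu> \<le> num_intercalates S" using S(3) unfolding N0_def by linarith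
    ultimately have NP: "(\<delta> - 3 * \<epsilon>) * \<mu> \<le> num_intercalates P" using P(3) by (simp add: algebra_simps)
    define m where "m = card (dom P)"
    have "m0 \<le> m" using m0 Phi_le[OF latP NP] unfolding m_def by linarith
    moreover have "m \<le> 4 * h"
      using card_mono[OF finS map_le_implies_dom_le[OF P(1)]] S(2) unfolding m_def by linarith
    moreover have "m > 0"
    proof (rule ccontr)
      assume "\<not> m > 0"
      then have "P = Map.empty" using latinD_finite[OF latP] by (simp add: m_def)
      then have "(\<delta> - 3 * \<epsilon>) * \<mu> \<le> 0" using NP by (simp add: num_intercalates_def)
      moreover have "(\<delta> - 3 * \<epsilon>) * \<mu> > 0" using \<epsilon> \<mu> by simp
      ultimately show False by linarith
    qed
    moreover have "P \<in> cores k n \<beta> m"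
    proof -
      have "dom P \<subseteq> {1..k} \<times> {1..n}" using map_le_implies_dom_le[OF PL] latin_rectangles_dom[OF L] by simp
      moreover have "ran P \<subseteq> {1..n}"
      proof
        fix s assume "s \<in> ran P"
        then obtain i x where "P (i, x) = Some s" by (auto simp: ran_def)
        then have "L (i, x) = Some s" by (rule map_le_SomeD[OF PL])
        then show "s \<in> {1..n}" by (rule latin_rectangles_Some(3)[OF L])
      qed
      ultimately show ?thesis using latP P(2) unfolding cores_def m_def by simp
    qed
    ultimately have "m \<in> ?I" "L \<in> ?C m" using L PL by auto
    then show "L \<in> (\<Union>m\<in>?I. ?C m)" by blast
  qed
  then have "card B \<le> card (\<Union>m\<in>?I. ?C m)" by (intro card_mono) auto
  also have "\<dots> \<le> (\<Sum>m\<in>?I. card (?C m))" by (intro card_UN_le) simp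
  finally have "real (card B) \<le> (\<Sum>m\<in>?I. real (card (?C m)))" by (simp flip: of_nat_sum)
  also have "\<dots> \<le> (\<Sum>m\<in>?I. card ?LR * exp (- \<rho> * m0))"
  proof (rule sum_mono)
    fix m assume m: "m \<in> ?I"
    then have m': "0 < m" "m \<le> 4 * h" "m0 \<le> m" by auto
    have "m / \<beta> \<le> real (4 * h) / \<beta>" using m'(2) \<beta> by (intro divide_right_mono) (simp_all only: of_nat_le_iff less_imp_le)
    then have "card (?C m) \<le> card (cores k n \<beta> m) * (card ?LR / (real n / 2) ^ m)"
      using n2 by (intro card_containing_core_le[OF \<beta> m'(1)]) auto
    also have "\<dots> = card ?LR * (card (cores k n \<beta> m) * (2 / real n) ^ m)" by (simp add: power_divide)
    also have "\<dots> \<le> card ?LR * ((real k * real n * real n + 1) powr (2 * real m / q + 8 * real q ^ 3 * m / \<beta>) *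
        (exp 1 * max 1 (2 * real q ^ 3 * m / \<beta>\<^sup>2)) ^ m * (2 / real n) ^ m)"
      by (intro mult_left_mono mult_right_mono card_cores_le(2)[OF \<beta> q m'(1)]) auto
    also have "\<dots> \<le> card ?LR * exp (- \<rho> * m)"
      by (intro mult_left_mono count m') auto
    also have "\<dots> \<le> card ?LR * exp (- \<rho> * m0)"
      using m' \<rho> by (intro mult_left_mono) (auto simp: mult_left_mono)
    finally show "real (card (?C m)) \<le> card ?LR * exp (- \<rho> * m0)" .
  qed
  also have "\<dots> = card ?I * (card ?LR * exp (- \<rho> * m0))" by simp
  also have "\<dots> \<le> real (4 * h) * (card ?LR * exp (- \<rho> * m0))"
  proof (rule mult_right_mono)
    have "card ?I \<le> card {1..4 * h}" by (rule card_mono) auto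
    then show "real (card ?I) \<le> real (4 * h)" by simp
  qed simp
  finally have cB: "card B \<le> card ?LR * (real (4 * h) * exp (- \<rho> * m0))" by (simp only: mult_ac)
  have "card {L \<in> ?LR. T \<le> num_intercalates L} \<le> card (G \<union> B)"
    by (rule card_mono) (auto simp: G_def B_def)
  also have "\<dots> \<le> card G + card B" by (rule card_Un_le)
  finally have "real (card {L \<in> ?LR. T \<le> num_intercalates L}) \<le> real (card G) + real (card B)"
    by (simp only: of_nat_le_iff flip: of_nat_add)
  also have "\<dots> \<le> card ?LR * ((1 + \<delta> - \<epsilon>) / (1 + \<delta>)) ^ h + card ?LR * (real (4 * h) * exp (- \<rho> * m0))"
    using cG cB by (rule add_mono)
  finally show ?thesis unfolding T_def by (simp only: distrib_left)
qed

lemma pruned_optimal_array: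
  fixes \<theta> z :: real
  assumes \<theta>: "\<theta> \<ge> 0"
  obtains P a b c where "latin P" "dom P \<subseteq> {1..a} \<times> {1..b}" "ran P \<subseteq> {1..c}"
    "card (dom P) \<le> Phi z" "z - \<theta> * Phi z \<le> num_intercalates P"
    "\<theta> * a \<le> Phi z" "\<theta> * b \<le> Phi z" "\<theta> * c \<le> Phi z"
proof -
  obtain P0 where P0: "latin P0" "z \<le> real (num_intercalates P0)" "card (dom P0) = Phi z"
    by (rule Phi_attained)
  obtain P1 where P1: "P1 \<subseteq>\<^sub>m P0" "num_intercalates P0 \<le> num_intercalates P1 + \<theta> * card (dom P0)"
    "\<theta> * card (fst ` dom P1) \<le> card (dom P0)" "\<theta> * card (snd ` dom P1) \<le> card (dom P0)"
    "\<theta> * card (ran P1) \<le> card (dom P0)"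
    by (rule prune[OF P0(1) \<theta>])
  have lat1: "latin P1" by (rule latin_map_le[OF P0(1) P1(1)])
  obtain P2 where P2: "latin P2" "dom P2 \<subseteq> {1..card (fst ` dom P1)} \<times> {1..card (snd ` dom P1)}"
    "ran P2 \<subseteq> {1..card (ran P1)}" "card (dom P2) \<le> card (dom P1)"
    "num_intercalates P1 \<le> num_intercalates P2"
    by (rule relabel[OF lat1])
  have "card (dom P1) \<le> card (dom P0)"
    by (rule card_mono[OF latinD_finite[OF P0(1)] map_le_implies_dom_le[OF P1(1)]])
  then have "card (dom P2) \<le> Phi z" using P2(4) P0(3) by linarith
  moreover have "z - \<theta> * Phi z \<le> num_intercalates P2" using P0(2,3) P1(2) P2(5) by simp
  ultimately show ?thesis using that[OF P2(1,2,3)] P1(3-5) P0(3) by simp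
qed

section \<open>Growth rates and constants\<close>

text \<open>With \<open>k = a ^ 3\<close> no fractional powers occur: \<open>\<mu>\<close> has order
  \<open>a ^ 6\<close>, \<open>Phi\<close> order \<open>a ^ 4\<close> and \<open>\<beta>\<close>
  order \<open>a\<^sup>2 / ln n\<close>. A single constant \<open>C\<close> stands for every
  condition that \<open>n\<close> be large. The bound on \<open>a\<^sup>2 * (ln n)\<^sup>2\<close>
  comes from \<open>k \<le> n\<close>, that is, from
  \<open>a\<^sup>2 \<le> n powr (2/3)\<close>.\<close>

lemma asymptotic_regime:
  fixes k :: "nat \<Rightarrow> nat" and C :: real
  assumes small: "(\<lambda>n. real (k n)) \<in> o(\<lambda>n. real n)"
    and large: "(\<lambda>n. real (k n)) \<in> \<omega>(\<lambda>n. ln (real n) powr (3 / 2))" and C: "C \<ge> 1"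
  shows "\<forall>\<^sub>F n in sequentially. \<exists>a\<ge>0. real (k n) = a ^ 3 \<and> C \<le> a \<and> C * ln (real n) \<le> a\<^sup>2 \<and>
    C * a ^ 3 \<le> real n \<and> C * (a\<^sup>2 * (ln (real n))\<^sup>2) \<le> real n \<and> C \<le> ln (real n) \<and>
    C * (1 + ln (real n) ^ 3) \<le> exp (ln (real n) / C) \<and> C \<le> real n"
proof -
  have 1: "\<forall>\<^sub>F n in sequentially. real (k n) \<le> (1 / C) * real n"
    using landau_o.smallD[OF small, of "1 / C"] C by simp
  have 2: "\<forall>\<^sub>F n in sequentially. (C powr (3 / 2)) * (ln (real n) powr (3 / 2)) \<le> real (k n)"
    using landau_omega.smallD[OF large, of "C powr (3 / 2)"] C by simp
  have 3: "\<forall>\<^sub>F n in sequentially. C * (ln (real n))\<^sup>2 \<le> real n powr (1 / 3)" by real_asymp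
  have 4: "\<forall>\<^sub>F n in sequentially. C \<le> ln (real n)" by real_asymp
  have 5: "\<forall>\<^sub>F n in sequentially. C * (1 + ln (real n) ^ 3) \<le> real n powr (1 / C)" using C by real_asymp
  have 6: "\<forall>\<^sub>F n in sequentially. C \<le> real n" by real_asymp
  show ?thesis using 1 2 3 4 5 6
  proof eventually_elim
    case (elim n)
    define l where "l = ln (real n)"
    define a where "a = real (k n) powr (1 / 3)"
    have l: "l \<ge> C" "l \<ge> 1" using elim(4) C by (simp_all add: l_def)
    have n: "real n > 0" using elim(6) C by linarith
    have a0: "a \<ge> 0" by (simp add: a_def)
    have p: "(x powr y) ^ j = x powr (y * real j)" if "x > 0" for x y :: real and j :: nat
      using that powr_realpow[of "x powr y" j] powr_powr[of x y "real j"] by simp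
    have kpos: "real (k n) > 0"
    proof -
      have "0 < C powr (3/2) * l powr (3/2)" using C l by simp
      then show ?thesis using elim(2) unfolding l_def by linarith
    qed
    have a3: "real (k n) = a ^ 3"
      unfolding a_def p[OF kpos] using kpos by simp
    have a2: "a\<^sup>2 = real (k n) powr (2/3)" unfolding a_def p[OF kpos] by simp
    have "C * l = ((C * l) powr (3/2)) powr (2/3)" using C l by (simp add: powr_powr)
    also have "\<dots> \<le> real (k n) powr (2/3)"
      by (rule powr_mono2) (use elim(2) C l in \<open>auto simp: powr_mult l_def\<close>)
    finally have al: "C * l \<le> a\<^sup>2" unfolding a2 .
    have "C * C \<le> C * l" using l C by (intro mult_left_mono) auto
    then have "C\<^sup>2 \<le> a\<^sup>2" using al by (simp add: power2_eq_square)
    then have Ca: "C \<le> a" using a0 by (rule power2_le_imp_le)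
    have kn: "C * a ^ 3 \<le> real n" using elim(1) C by (simp add: a3[symmetric] field_simps)
    have "a\<^sup>2 \<le> real n powr (2/3)"
    proof -
      have "real (k n) \<le> C * real (k n)" using C by (simp add: mult_le_cancel_right1)
      then have "real (k n) \<le> real n" using kn by (simp add: a3)
      then show ?thesis unfolding a2 by (intro powr_mono2) auto
    qed
    then have "a\<^sup>2 * (C * l\<^sup>2) \<le> real n powr (2/3) * real n powr (1/3)"
      using elim(3) C by (intro mult_mono) (auto simp: l_def)
    also have "\<dots> = real n" using n by (simp flip: powr_add)
    finally have "C * (a\<^sup>2 * l\<^sup>2) \<le> real n" by (simp add: mult_ac)
    moreover have "C * (1 + l ^ 3) \<le> exp (l / C)" using elim(5) n by (simp add: powr_def l_def mult.commute)
    ultimately show ?case using a0 a3 Ca al kn l elim(6) unfolding l_def by blast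
  qed
qed

text \<open>Both order bounds for \<open>Phi\<close> have exponent 2/3, so one
  \<open>\<epsilon>\<close> works for all \<open>\<mu>\<close>: it solves \<open>16 (\<epsilon>
  \<mu>)^(2/3) = \<eta> (\<delta> \<mu> / 2)^(2/3)\<close>. Together with \<open>Phi_add\<close>
  this acts as continuity of \<open>Phi\<close> up to a factor close to 1.\<close>

lemma Phi_small_ratio:
  fixes \<delta> \<eta> :: real
  assumes "\<delta> > 0" "\<eta> > 0"
  obtains \<epsilon> where "\<epsilon> > 0" "\<And>x \<mu>. 0 \<le> x \<Longrightarrow> x \<le> \<epsilon> \<Longrightarrow> 1 \<le> \<epsilon> * \<mu> \<Longrightarrow> 0 < \<mu> \<Longrightarrow> Phi (x * \<mu>) \<le> \<eta> * Phi (\<delta> * \<mu>)"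
proof
  define \<epsilon> where "\<epsilon> = (\<delta> / 2) * (\<eta> / 16) powr (3/2)"
  show "\<epsilon> > 0" using assms by (simp add: \<epsilon>_def)
  fix x \<mu> :: real assume x: "0 \<le> x" "x \<le> \<epsilon>" "1 \<le> \<epsilon> * \<mu>" "0 < \<mu>"
  have "Phi (x * \<mu>) \<le> Phi (\<epsilon> * \<mu>)" using x by (intro Phi_mono mult_right_mono) auto
  then have "real (Phi (x * \<mu>)) \<le> Phi (\<epsilon> * \<mu>)" by simp
  also have "\<dots> \<le> 16 * (\<epsilon> * \<mu>) powr (2/3)" using x by (intro Phi_le_powr)
  also have "\<epsilon> * \<mu> = (\<delta> * \<mu> / 2) * (\<eta> / 16) powr (3/2)" by (simp add: \<epsilon>_def)
  also have "\<dots> powr (2/3) = (\<delta> * \<mu> / 2) powr (2/3) * ((\<eta> / 16) powr (3/2)) powr (2/3)"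
    by (rule powr_mult)
  also have "((\<eta> / 16) powr (3/2)) powr (2/3) = \<eta> / 16" using assms by (simp add: powr_powr)
  also have "16 * ((\<delta> * \<mu> / 2) powr (2/3) * (\<eta> / 16)) = \<eta> * (\<delta> * \<mu> / 2) powr (2/3)" by simp
  also have "\<dots> \<le> \<eta> * Phi (\<delta> * \<mu>)"
    using assms x by (intro mult_left_mono Phi_ge_powr) auto
  finally show "Phi (x * \<mu>) \<le> \<eta> * Phi (\<delta> * \<mu>)" .
qed

lemma Phi_cube_bounds:
  fixes \<delta> a :: real
  assumes \<delta>: "\<delta> > 0" and a: "a > 0"
  shows "(\<delta> / 8) powr (2/3) * a ^ 4 \<le> Phi (\<delta> * ((a ^ 3)\<^sup>2 / 4))"
    "1 \<le> \<delta> * ((a ^ 3)\<^sup>2 / 4) \<Longrightarrow> Phi (\<delta> * ((a ^ 3)\<^sup>2 / 4)) \<le> 16 * (\<delta> / 4) powr (2/3) * a ^ 4"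
proof -
  have p: "((a ^ 3)\<^sup>2) powr (2/3) = a ^ 4"
  proof -
    have "(a ^ 3)\<^sup>2 = a powr 6" using a by (simp add: powr_numeral flip: power_mult)
    then have "((a ^ 3)\<^sup>2) powr (2/3) = a powr (6 * (2/3))" by (simp only: powr_powr)
    also have "6 * (2/3) = (4::real)" by simp
    finally show ?thesis using a by (simp add: powr_numeral)
  qed
  have "(\<delta> / 8 * (a ^ 3)\<^sup>2) powr (2/3) = (\<delta> / 8) powr (2/3) * a ^ 4" unfolding powr_mult p ..
  moreover have "\<delta> * ((a ^ 3)\<^sup>2 / 4) / 2 = \<delta> / 8 * (a ^ 3)\<^sup>2" by simp
  ultimately show "(\<delta> / 8) powr (2/3) * a ^ 4 \<le> Phi (\<delta> * ((a ^ 3)\<^sup>2 / 4))"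
    using Phi_ge_powr[of "\<delta> * ((a ^ 3)\<^sup>2 / 4)"] \<delta> a by simp
  have "(\<delta> / 4 * (a ^ 3)\<^sup>2) powr (2/3) = (\<delta> / 4) powr (2/3) * a ^ 4" unfolding powr_mult p ..
  moreover have "\<delta> * ((a ^ 3)\<^sup>2 / 4) = \<delta> / 4 * (a ^ 3)\<^sup>2" by simp
  ultimately show "Phi (\<delta> * ((a ^ 3)\<^sup>2 / 4)) \<le> 16 * (\<delta> / 4) powr (2/3) * a ^ 4"
    if "1 \<le> \<delta> * ((a ^ 3)\<^sup>2 / 4)"
    using Phi_le_powr[OF that] by simp
qed

section \<open>Upper tail for large \<open>n\<close>\<close>

text \<open>The constants are fixed beforehand; the work is to verify the hypotheses of
  \<open>many_intercalates_le\<close>. The exponent loses \<open>\<eta> / 2\<close> in the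
  enumeration of cores, \<open>\<eta> / 4\<close> in replacing \<open>\<delta>\<close> by
  \<open>\<delta> - 3 * \<epsilon>\<close>, and the last \<open>\<eta> / 4\<close> in absorbing the
  prefactor \<open>s + 1\<close>.\<close>

lemma upper_tail_at:
  fixes \<epsilon> \<delta> \<eta> \<xi> C D E H a l c1 c2 :: real and k n q :: nat
  assumes \<delta>: "\<delta> > 0" and \<eta>: "0 < \<eta>" "\<eta> \<le> 1" and \<epsilon>: "\<epsilon> > 0" "3 * \<epsilon> < \<delta>"
    and ratio: "Phi (3 * \<epsilon> * ((real k)\<^sup>2 / 4)) \<le> \<eta> / 4 * Phi (\<delta> * ((real k)\<^sup>2 / 4))"
    and \<xi>: "\<xi> > 0" "\<xi> \<le> 1 / 40" "20 * \<xi> \<le> \<epsilon>" and q: "q \<ge> 1" "64 / \<eta> \<le> q"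
    and c1: "c1 = (\<delta> / 8) powr (2/3)" and c2: "c2 = 16 * (\<delta> / 4) powr (2/3)"
    and D: "D = (1 + \<delta>) / \<epsilon> + 1" and E: "E = 4 * D * c2" and H: "H = 32 * real q ^ 3 * E ^ 3 / \<epsilon>\<^sup>2"
    and C: "1 \<le> C" "2 / \<xi> \<le> C" "48 * E / \<epsilon> \<le> C" "24 * E\<^sup>2 / (\<xi> * \<epsilon>) \<le> C" "24 * E\<^sup>2 / (\<xi>\<^sup>2 * \<epsilon>) \<le> C"
      "1024 * E * real q ^ 3 / (\<eta> * \<epsilon>) \<le> C" "16 * E\<^sup>2 / \<epsilon> \<le> C" "8 \<le> C" "6 * (1 + H) \<le> C" "4 / \<eta> \<le> C"
      "4 / \<epsilon> \<le> C" "(160 * D / \<eta>\<^sup>2 + 1) / c1 \<le> C"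
    and a: "a \<ge> 0" "real k = a ^ 3" "C \<le> a" "C * l \<le> a\<^sup>2" "C * a ^ 3 \<le> n" "C * (a\<^sup>2 * l\<^sup>2) \<le> n"
      "C \<le> l" "C * (1 + l ^ 3) \<le> exp (l / C)" "C \<le> n" and l: "real n = exp l"
  shows "card {L \<in> latin_rectangles k n. (1 + \<delta>) * ((real k)\<^sup>2 / 4) \<le> num_intercalates L}
    \<le> card (latin_rectangles k n) * exp (- (1 - \<eta>) * Phi (\<delta> * ((real k)\<^sup>2 / 4)) * l)"
proof -
  define \<mu> where "\<mu> = (real k)\<^sup>2 / 4"
  define F where "F = real (Phi (\<delta> * \<mu>))"
  define y where "y = F * l"
  \<comment> \<open>The moment ratio is \<open>1 - \<epsilon> / (1 + \<delta>)\<close>, so this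
    order brings its power of exponent \<open>h\<close> below \<open>exp (- F * l)\<close>.\<close>
  define h where "h = nat \<lceil>(1 + \<delta>) / \<epsilon> * y\<rceil>"
  define s where "s = real (4 * h)"
  define \<beta> where "\<beta> = \<epsilon> * \<mu> / s"
  let ?N = "real n"
  have a1: "a \<ge> 1" "a > 0" "l \<ge> 1" "l > 0" "?N > 0" using a(3,7,9) C(1) by linarith+
  have \<mu>a: "\<mu> = a ^ 6 / 4" by (simp add: \<mu>_def a(2) flip: power_mult)
  have \<mu>: "\<mu> > 0" using a1 by (simp add: \<mu>a)
  have apow: "C \<le> a ^ j" if "j > 0" for j :: nat
  proof -
    have "a ^ 1 \<le> a ^ j" using a1 that by (intro power_increasing) auto
    then show ?thesis using a(3) by simp
  qed
  have "4 / \<epsilon> \<le> a ^ 6" using C(11) apow[of 6] by simp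
  then have \<epsilon>\<mu>: "1 \<le> \<epsilon> * \<mu>" using \<epsilon> by (simp add: \<mu>a field_simps)
  have "\<epsilon> * \<mu> \<le> \<delta> * \<mu>" using \<epsilon> \<mu> by (intro mult_right_mono) auto
  then have \<delta>\<mu>: "1 \<le> \<delta> * \<mu>" using \<epsilon>\<mu> by linarith
  have F1: "c1 * a ^ 4 \<le> F"
    unfolding c1 F_def \<mu>_def a(2) by (rule Phi_cube_bounds(1)[OF \<delta> a1(2)])
  have F2: "F \<le> c2 * a ^ 4"
    using Phi_cube_bounds(2)[OF \<delta> a1(2)] \<delta>\<mu> unfolding c2 F_def \<mu>_def a(2) by simp
  have c: "c1 > 0" "c2 > 0" using \<delta> by (simp_all add: c1 c2)
  have D1: "D > 1" using \<epsilon> \<delta> by (simp add: D)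
  have E0: "E > 0" using D1 c by (simp add: E)
  have "c1 * C \<le> c1 * a ^ 4" using c apow[of 4] by (intro mult_left_mono) auto
  moreover have "160 * D / \<eta>\<^sup>2 + 1 \<le> c1 * C" using C(12) c by (simp add: pos_divide_le_eq mult.commute)
  ultimately have FD: "160 * D / \<eta>\<^sup>2 + 1 \<le> F" using F1 by linarith
  have D\<eta>: "160 * D / \<eta>\<^sup>2 > 0" using D1 \<eta> by simp
  have F0: "F \<ge> 1" "F > 0" using FD D\<eta> by linarith+
  have Fy: "F \<le> y" unfolding y_def using F0 a1 by (simp add: mult_le_cancel_left1)
  have y: "y \<ge> 1" "160 * D / \<eta>\<^sup>2 + 1 \<le> y" using Fy F0 FD by linarith+
  have hy: "(1 + \<delta>) / \<epsilon> * y \<le> h" unfolding h_def by linarith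
  have "0 \<le> (1 + \<delta>) / \<epsilon> * y" using \<delta> \<epsilon> y by simp
  then have "h \<le> (1 + \<delta>) / \<epsilon> * y + 1" unfolding h_def by linarith
  also have "\<dots> \<le> D * y" using y by (simp add: D algebra_simps)
  finally have hD: "h \<le> D * y" .
  have h0: "h > 0"
  proof -
    have "0 < (1 + \<delta>) / \<epsilon> * y" using \<delta> \<epsilon> y by simp
    then show ?thesis using hy by linarith
  qed
  have s0: "s > 0" using h0 by (simp add: s_def)
  have sE: "s \<le> E * a ^ 4 * l"
  proof -
    have "s \<le> 4 * (D * (F * l))" using hD by (simp add: s_def y_def)
    also have "\<dots> \<le> 4 * (D * ((c2 * a ^ 4) * l))"
      using F2 D1 a1 by (intro mult_left_mono mult_right_mono) auto
    finally show ?thesis by (simp add: E mult_ac)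
  qed
  have s2: "s\<^sup>2 \<le> E\<^sup>2 * a ^ 8 * l\<^sup>2"
  proof -
    have "s\<^sup>2 \<le> (E * a ^ 4 * l)\<^sup>2" using sE s0 by (intro power_mono) auto
    then show ?thesis by (simp add: power_mult_distrib flip: power_mult)
  qed
  have alN: "C * (a\<^sup>2 * l\<^sup>2 / ?N) \<le> 1" using a(6) a1 by (simp add: field_simps)
  \<comment> \<open>\<open>s\<^sup>2 / n\<close> is at most a constant times
    \<open>a ^ 6 * u\<close>. So the error terms caused by prescribed cells are, relative to
    \<open>\<mu>\<close>, at most a constant times \<open>u\<close>, and
    \<open>u \<le> 1 / C\<close>.\<close>
  define u where "u = a\<^sup>2 * l\<^sup>2 / ?N"
  have u: "0 \<le> u" "C * u \<le> 1" using alN a1 by (simp_all add: u_def)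
  have uC: "x * u \<le> t" if "0 \<le> x" "0 < t" "x / t \<le> C" for x t
  proof -
    have "x \<le> C * t" using that by (simp add: pos_divide_le_eq)
    then have "x * u \<le> C * t * u" using u by (intro mult_right_mono) auto
    also have "\<dots> = t * (C * u)" by simp
    also have "\<dots> \<le> t * 1" using that u by (intro mult_left_mono) auto
    finally show ?thesis by simp
  qed
  \<comment> \<open>The loss \<open>4 * \<xi> * n\<close> pays for \<open>r\<close>, for the
    constant 2 and for \<open>2 * k\<close>, with shares \<open>\<xi> * n\<close>,
    \<open>\<xi> * n\<close> and \<open>2 * \<xi> * n\<close>.\<close>
  define d where "d = (1 - 4 * \<xi>) * ?N"
  define r where "r = \<xi> * ?N"
  have r0: "r > 0" using \<xi> a1 by (simp add: r_def)
  have d2: "?N / 2 \<le> d" unfolding d_def using \<xi> a1 by (simp add: field_simps)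
  have d0: "d > 0" using d2 a1 by linarith
  have \<xi>C: "1 \<le> \<xi> * C / 2" using C(2) \<xi> by (simp add: pos_divide_le_eq mult.commute)
  have k\<xi>: "real k \<le> \<xi> * ?N"
  proof -
    have "real k * 1 \<le> real k * (\<xi> * C / 2)" using \<xi>C by (intro mult_left_mono) auto
    also have "\<dots> = \<xi> / 2 * (C * a ^ 3)" by (simp add: a(2))
    also have "\<dots> \<le> \<xi> / 2 * ?N" using a(5) \<xi> by (intro mult_left_mono) auto
    finally show ?thesis using \<xi> a1 by simp
  qed
  have two\<xi>: "2 \<le> \<xi> * ?N"
  proof -
    have "\<xi> * C \<le> \<xi> * ?N" using a(9) \<xi> by (intro mult_left_mono) auto
    then show ?thesis using \<xi>C by linarith
  qed
  have dle: "d \<le> ?N - r - 2 - 2 * real k"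
    using k\<xi> two\<xi> unfolding d_def r_def by (simp add: algebra_simps)
  have t1: "(real k)\<^sup>2 * ?N\<^sup>2 / (4 * d\<^sup>2) \<le> (1 + \<epsilon> / 2) * \<mu>"
  proof -
    have "(real k)\<^sup>2 * ?N\<^sup>2 / (4 * d\<^sup>2) = \<mu> / (1 - 4 * \<xi>)\<^sup>2"
      using a1 \<xi> by (simp add: d_def \<mu>_def power_mult_distrib)
    also have "\<dots> \<le> (1 + \<epsilon> / 2) * \<mu>"
    proof -
      have "1 \<le> (1 + 10 * \<xi>) * (1 - 8 * \<xi>)"
      proof -
        have "\<xi> * (80 * \<xi>) \<le> \<xi> * 2" using \<xi> by (intro mult_left_mono) auto
        then show ?thesis by (simp add: algebra_simps)
      qed
      also have "\<dots> \<le> (1 + \<epsilon> / 2) * (1 - 4 * \<xi>)\<^sup>2"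
        using \<xi> by (intro mult_mono) (auto simp: power2_eq_square algebra_simps)
      finally have "\<mu> * 1 \<le> \<mu> * ((1 + \<epsilon> / 2) * (1 - 4 * \<xi>)\<^sup>2)" using \<mu> by (intro mult_left_mono) auto
      moreover have "(1 - 4 * \<xi>)\<^sup>2 > 0" using \<xi> by simp
      ultimately show ?thesis by (simp add: pos_divide_le_eq mult_ac)
    qed
    finally show ?thesis .
  qed
  have t2: "s * k / d \<le> \<epsilon> / 6 * \<mu>"
  proof -
    have "s * k / d \<le> (E * a ^ 4 * l) * a ^ 3 / (?N / 2)"
      using sE d2 a1 s0 E0 by (intro frac_le mult_mono) (auto simp: a(2))
    also have "\<dots> = 2 * E * a ^ 6 * (a * l / ?N)" using a1 by (simp add: power_numeral_reduce field_simps)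
    also have "\<dots> \<le> 2 * E * a ^ 6 * u"
    proof (rule mult_left_mono)
      have "1 * 1 \<le> a * l" using a1 by (intro mult_mono) auto
      then have "(a * l) * 1 \<le> (a * l) * (a * l)" using a1 by (intro mult_left_mono) auto
      then show "a * l / ?N \<le> u" unfolding u_def using a1
        by (intro divide_right_mono) (auto simp: power2_eq_square algebra_simps)
    qed (use E0 a1 in simp)
    also have "\<dots> = a ^ 6 * (2 * E * u)" by simp
    also have "\<dots> \<le> a ^ 6 * (\<epsilon> / 24)"
      using uC[of "2 * E" "\<epsilon> / 24"] C(3) \<epsilon> E0 a1 by (intro mult_left_mono) (auto simp: field_simps)
    finally show ?thesis by (simp add: \<mu>a mult.commute[of "a ^ 6"])
  qed
  have s2N: "s\<^sup>2 / ?N \<le> a ^ 6 * (E\<^sup>2 * u)"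
  proof -
    have "s\<^sup>2 / ?N \<le> E\<^sup>2 * a ^ 8 * l\<^sup>2 / ?N" using s2 by (intro divide_right_mono) auto
    also have "\<dots> = a ^ 6 * (E\<^sup>2 * u)" by (simp add: u_def power_numeral_reduce)
    finally show ?thesis .
  qed
  have t3: "s\<^sup>2 / r \<le> \<epsilon> / 6 * \<mu>"
  proof -
    have "s\<^sup>2 / r = s\<^sup>2 / ?N / \<xi>" by (simp add: r_def)
    also have "\<dots> \<le> a ^ 6 * (E\<^sup>2 * u) / \<xi>" using s2N \<xi> by (intro divide_right_mono) auto
    also have "\<dots> = a ^ 6 * (E\<^sup>2 / \<xi> * u)" by simp
    also have "\<dots> \<le> a ^ 6 * (\<epsilon> / 24)"
      using uC[of "E\<^sup>2 / \<xi>" "\<epsilon> / 24"] C(4) \<epsilon> E0 \<xi> a1 by (intro mult_left_mono) (auto simp: field_simps)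
    finally show ?thesis by (simp add: \<mu>a mult.commute[of "a ^ 6"])
  qed
  have t4: "s\<^sup>2 * n / r\<^sup>2 \<le> \<epsilon> / 6 * \<mu>"
  proof -
    have "s\<^sup>2 * n / r\<^sup>2 = s\<^sup>2 / ?N / \<xi>\<^sup>2" using a1 by (simp add: r_def power2_eq_square)
    also have "\<dots> \<le> a ^ 6 * (E\<^sup>2 * u) / \<xi>\<^sup>2" using s2N \<xi> by (intro divide_right_mono) auto
    also have "\<dots> = a ^ 6 * (E\<^sup>2 / \<xi>\<^sup>2 * u)" by simp
    also have "\<dots> \<le> a ^ 6 * (\<epsilon> / 24)"
      using uC[of "E\<^sup>2 / \<xi>\<^sup>2" "\<epsilon> / 24"] C(5) \<epsilon> E0 \<xi> a1 by (intro mult_left_mono) (auto simp: field_simps)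
    finally show ?thesis by (simp add: \<mu>a mult.commute[of "a ^ 6"])
  qed
  have mean: "(real k)\<^sup>2 * ?N\<^sup>2 / (4 * d\<^sup>2) + s * k / d + s\<^sup>2 / r + s\<^sup>2 * n / r\<^sup>2 \<le> (1 + \<epsilon>) * \<mu>"
    using t1 t2 t3 t4 by (simp add: algebra_simps)
  have \<beta>0: "\<beta> > 0" using \<epsilon> \<mu> s0 by (simp add: \<beta>_def)
  \<comment> \<open>The growth of \<open>k\<close> beyond \<open>(log n)^(3/2)\<close> enters here:
    \<open>\<beta>\<close> is at least a constant times \<open>a\<^sup>2 / l\<close>, hence at least
    a constant times \<open>C\<close>.\<close>
  have \<beta>C: "256 * real q ^ 3 / \<eta> \<le> \<beta>"
  proof -
    have "256 * real q ^ 3 / \<eta> \<le> \<epsilon> / (4 * E) * C"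
      using C(6) \<epsilon> E0 \<eta> by (simp add: field_simps)
    also have "\<dots> \<le> \<epsilon> / (4 * E) * (a\<^sup>2 / l)"
      using a(4) a1 \<epsilon> E0 by (intro mult_left_mono) (auto simp: pos_le_divide_eq)
    also have "\<dots> = \<epsilon> * \<mu> / (E * a ^ 4 * l)"
      using a1 E0 by (simp add: \<mu>a power_numeral_reduce field_simps)
    also have "\<dots> \<le> \<beta>" unfolding \<beta>_def using sE s0 \<epsilon> \<mu> by (intro divide_left_mono) auto
    finally show ?thesis .
  qed
  have s\<beta>: "s / \<beta> = s\<^sup>2 / (\<epsilon> * \<mu>)" using s0 by (simp add: \<beta>_def power2_eq_square)
  have n2: "?N / 2 \<le> ?N - s / \<beta> - 2 * real k"
  proof -
    have "s / \<beta> \<le> E\<^sup>2 * a ^ 8 * l\<^sup>2 / (\<epsilon> * \<mu>)"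
      unfolding s\<beta> using s2 \<epsilon> \<mu> by (intro divide_right_mono) auto
    also have "\<dots> = ?N * (4 * E\<^sup>2 / \<epsilon> * u)"
      using a1 \<epsilon> by (simp add: \<mu>a u_def power_numeral_reduce field_simps)
    also have "\<dots> \<le> ?N * (1 / 4)"
      using uC[of "4 * E\<^sup>2 / \<epsilon>" "1 / 4"] C(7) \<epsilon> E0 a1 by (intro mult_left_mono) auto
    finally have "s / \<beta> \<le> ?N / 4" by simp
    moreover have "8 * real k \<le> ?N"
    proof -
      have "8 * real k \<le> C * real k" using C(8) by (intro mult_right_mono) auto
      then show ?thesis using a(2,5) by simp
    qed
    ultimately show ?thesis by linarith
  qed
  have H0: "H \<ge> 0" using E0 by (simp add: H)
  define \<rho> where "\<rho> = (1 - \<eta> / 2) * l"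
  \<comment> \<open>The first factor is at most \<open>exp (\<eta> / 4 * l * m)\<close>, since both
    parts of its exponent are small fractions of \<open>m\<close>. The factor per candidate is
    bounded by a power of \<open>l\<close> and thus by \<open>exp (\<eta> / 4 * l)\<close>. Against
    \<open>n^(-m)\<close> this leaves \<open>exp (- \<rho> * m)\<close>.\<close>
  have count: "(real k * ?N * ?N + 1) powr (2 * real m / q + 8 * real q ^ 3 * m / \<beta>) *
      (exp 1 * max 1 (2 * real q ^ 3 * m / \<beta>\<^sup>2)) ^ m * (2 / ?N) ^ m \<le> exp (- \<rho> * m)"
    if m: "0 < m" "m \<le> 4 * h" for m
  proof -
    have ms: "real m \<le> s" unfolding s_def using m by (simp only: of_nat_le_iff)
    let ?x = "2 * real m / q + 8 * real q ^ 3 * m / \<beta>"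
    have x: "0 \<le> ?x" "?x \<le> \<eta> / 16 * m"
    proof -
      show "0 \<le> ?x" using \<beta>0 by simp
      have "64 \<le> q * \<eta>" using q \<eta> by (simp add: pos_divide_le_eq)
      then have "2 / q \<le> \<eta> / 32" using q by (simp add: field_simps)
      moreover have "8 * real q ^ 3 / \<beta> \<le> \<eta> / 32"
        using \<beta>C \<beta>0 \<eta> by (simp add: field_simps)
      ultimately have "2 / q + 8 * real q ^ 3 / \<beta> \<le> \<eta> / 16" by linarith
      then have "(2 / q + 8 * real q ^ 3 / \<beta>) * m \<le> \<eta> / 16 * m" by (intro mult_right_mono) auto
      then show "?x \<le> \<eta> / 16 * m" by (simp add: algebra_simps)
    qed
    have base: "real k * ?N * ?N + 1 \<le> exp (4 * l)"
    proof -
      have "\<xi> * ?N \<le> 1 * ?N" using \<xi> by (intro mult_right_mono) auto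
      then have "real k \<le> ?N" using k\<xi> by linarith
      then have "real k * ?N * ?N + 1 \<le> ?N * ?N * ?N + ?N * ?N * ?N"
        using a(9) C(1) mult_mono[of 1 ?N 1 ?N] mult_mono[of 1 "?N * ?N" 1 ?N]
        by (intro add_mono mult_right_mono) auto
      also have "\<dots> = 2 * (?N * ?N * ?N)" by simp
      also have "\<dots> \<le> ?N * (?N * ?N * ?N)" using a(9) C(8) by (intro mult_right_mono) auto
      also have "\<dots> = exp (4 * l)" unfolding l by (simp flip: exp_add)
      finally show ?thesis .
    qed
    have "(real k * ?N * ?N + 1) powr ?x \<le> exp (4 * l) powr ?x"
      using base x(1) by (intro powr_mono2) auto
    also have "\<dots> = exp (4 * l * ?x)" by (simp add: powr_def mult.commute)
    also have "\<dots> \<le> exp (4 * l * (\<eta> / 16 * m))" using x a1 by (simp only: exp_le_cancel_iff) (intro mult_left_mono, auto)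
    finally have f1: "(real k * ?N * ?N + 1) powr ?x \<le> exp (\<eta> / 4 * l * m)" by (simp add: mult_ac)
    \<comment> \<open>All powers of \<open>a\<close> cancel: \<open>s ^ 3\<close> is at most of
      order \<open>a ^ 12 * l ^ 3\<close>, and \<open>\<mu>\<^sup>2\<close> has order
      \<open>a ^ 12\<close>.\<close>
    have "2 * real q ^ 3 * m / \<beta>\<^sup>2 \<le> H * l ^ 3"
    proof -
      have "2 * real q ^ 3 * m / \<beta>\<^sup>2 \<le> 2 * real q ^ 3 * s / \<beta>\<^sup>2"
        using ms by (intro divide_right_mono mult_left_mono) auto
      also have "\<dots> = 2 * real q ^ 3 * s ^ 3 / (\<epsilon> * \<mu>)\<^sup>2"
        using s0 \<epsilon> \<mu> by (simp add: \<beta>_def power2_eq_square power3_eq_cube)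
      also have "\<dots> \<le> 2 * real q ^ 3 * (E * a ^ 4 * l) ^ 3 / (\<epsilon> * \<mu>)\<^sup>2"
        using sE s0 by (intro divide_right_mono mult_left_mono power_mono) auto
      also have "\<dots> = H * l ^ 3"
      proof -
        have "(a ^ 4) ^ 3 = (a ^ 6)\<^sup>2" by (simp flip: power_mult)
        then show ?thesis using a1 \<epsilon>
          by (simp add: \<mu>a H power_mult_distrib power_divide)
      qed
      finally show ?thesis .
    qed
    moreover have "0 \<le> l ^ 3" "0 \<le> H * l ^ 3" using H0 a1 by simp_all
    moreover have "(1 + H) * (1 + l ^ 3) = 1 + H + l ^ 3 + H * l ^ 3" by (simp add: algebra_simps)
    ultimately have "max 1 (2 * real q ^ 3 * m / \<beta>\<^sup>2) \<le> (1 + H) * (1 + l ^ 3)"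
      using H0 by (intro max.boundedI) linarith+
    moreover have "exp 1 \<le> (3 :: real)" using exp_le .
    ultimately have "exp 1 * max 1 (2 * real q ^ 3 * m / \<beta>\<^sup>2) * 2 \<le> 3 * ((1 + H) * (1 + l ^ 3)) * 2"
      by (intro mult_mono mult_right_mono) auto
    also have "\<dots> = (6 * (1 + H)) * (1 + l ^ 3)" by simp
    also have "\<dots> \<le> C * (1 + l ^ 3)" using C(9) a1 by (intro mult_right_mono) auto
    also have "\<dots> \<le> exp (l / C)" by (rule a)
    also have "\<dots> \<le> exp (\<eta> / 4 * l)"
    proof -
      have "1 / C \<le> \<eta> / 4" using C(1,10) \<eta> by (simp add: field_simps)
      then have "1 / C * l \<le> \<eta> / 4 * l" using a1 by (intro mult_right_mono) auto
      then show ?thesis by simp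
    qed
    finally have "exp 1 * max 1 (2 * real q ^ 3 * m / \<beta>\<^sup>2) * 2 / ?N \<le> exp (\<eta> / 4 * l) / ?N"
      by (intro divide_right_mono) auto
    also have "\<dots> = exp (\<eta> / 4 * l - l)" unfolding l by (simp add: exp_diff)
    finally have "(exp 1 * max 1 (2 * real q ^ 3 * m / \<beta>\<^sup>2) * 2 / ?N) ^ m \<le> exp (\<eta> / 4 * l - l) ^ m"
      by (intro power_mono) auto
    also have "(exp 1 * max 1 (2 * real q ^ 3 * m / \<beta>\<^sup>2) * 2 / ?N) ^ m
        = (exp 1 * max 1 (2 * real q ^ 3 * m / \<beta>\<^sup>2)) ^ m * (2 / ?N) ^ m"
      by (simp add: power_mult_distrib power_divide)
    also have "exp (\<eta> / 4 * l - l) ^ m = exp ((\<eta> / 4 * l - l) * m)" by (simp add: exp_of_nat_mult mult.commute)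
    finally have f2: "(exp 1 * max 1 (2 * real q ^ 3 * m / \<beta>\<^sup>2)) ^ m * (2 / ?N) ^ m \<le> exp ((\<eta> / 4 * l - l) * m)" .
    have "(real k * ?N * ?N + 1) powr ?x * ((exp 1 * max 1 (2 * real q ^ 3 * m / \<beta>\<^sup>2)) ^ m * (2 / ?N) ^ m)
        \<le> exp (\<eta> / 4 * l * m) * exp ((\<eta> / 4 * l - l) * m)"
      by (rule mult_mono[OF f1 f2]) auto
    also have "\<dots> = exp (- \<rho> * m)" unfolding \<rho>_def by (simp add: algebra_simps flip: exp_add)
    finally show ?thesis by (simp only: mult.assoc)
  qed
  have "F \<le> Phi ((\<delta> - 3 * \<epsilon>) * \<mu>) + Phi (3 * \<epsilon> * \<mu>)"
  proof -
    have "\<delta> * \<mu> = (\<delta> - 3 * \<epsilon>) * \<mu> + 3 * \<epsilon> * \<mu>" by (simp add: algebra_simps)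
    then show ?thesis unfolding F_def using Phi_add[of "(\<delta> - 3 * \<epsilon>) * \<mu>" "3 * \<epsilon> * \<mu>"] by simp
  qed
  then have m0: "(1 - \<eta> / 4) * F \<le> Phi ((\<delta> - 3 * \<epsilon>) * \<mu>)"
    using ratio unfolding \<mu>_def[symmetric] F_def[symmetric] by (simp add: algebra_simps)
  have k0: "k > 0" using a(2) a1 by (metis of_nat_0_less_iff zero_less_power)
  have "card {L \<in> latin_rectangles k n. (1 + \<delta>) * \<mu> \<le> num_intercalates L}
    \<le> card (latin_rectangles k n) * (((1 + \<delta> - \<epsilon>) / (1 + \<delta>)) ^ h + s * exp (- \<rho> * ((1 - \<eta> / 4) * F)))"
    unfolding \<mu>_def s_def
  proof (rule many_intercalates_le[where d = d and r = r and q = q])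
    show "0 \<le> \<rho>" using \<eta> a1 by (simp add: \<rho>_def)
    show "0 < n" using a1 by simp
  qed (use k0 \<epsilon> h0 q r0 d0 dle mean n2 count m0 in \<open>unfold \<mu>_def s_def \<beta>_def, auto\<close>)
  also have "\<dots> \<le> card (latin_rectangles k n) * exp (- (1 - \<eta>) * y)"
  proof (rule mult_left_mono)
    have "((1 + \<delta> - \<epsilon>) / (1 + \<delta>)) ^ h \<le> exp (- (\<epsilon> / (1 + \<delta>))) ^ h"
    proof (rule power_mono)
      have "(1 + \<delta> - \<epsilon>) / (1 + \<delta>) = 1 + - (\<epsilon> / (1 + \<delta>))" using \<delta> by (simp add: field_simps)
      then show "(1 + \<delta> - \<epsilon>) / (1 + \<delta>) \<le> exp (- (\<epsilon> / (1 + \<delta>)))" using exp_ge_add_one_self by metis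
      show "0 \<le> (1 + \<delta> - \<epsilon>) / (1 + \<delta>)" using \<delta> \<epsilon> by simp
    qed
    also have "\<dots> = exp (- (\<epsilon> / (1 + \<delta>) * h))" by (simp add: exp_of_nat_mult[symmetric] mult.commute)
    also have "\<dots> \<le> exp (- y)"
    proof -
      have "y = \<epsilon> / (1 + \<delta>) * ((1 + \<delta>) / \<epsilon> * y)" using \<delta> \<epsilon> by simp
      also have "\<dots> \<le> \<epsilon> / (1 + \<delta>) * h" using hy \<delta> \<epsilon> by (intro mult_left_mono) auto
      finally show ?thesis by simp
    qed
    also have "\<dots> \<le> exp (- (1 - 3 * \<eta> / 4) * y)" using y \<eta> by (simp add: algebra_simps)
    finally have g1: "((1 + \<delta> - \<epsilon>) / (1 + \<delta>)) ^ h \<le> exp (- (1 - 3 * \<eta> / 4) * y)" .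
    have "(1 - 3 * \<eta> / 4) * y \<le> ((1 - \<eta> / 2) * (1 - \<eta> / 4)) * y"
      using y \<eta> by (intro mult_right_mono) (auto simp: algebra_simps)
    also have "\<dots> = \<rho> * ((1 - \<eta> / 4) * F)" by (simp add: \<rho>_def y_def mult_ac)
    finally have g2: "exp (- \<rho> * ((1 - \<eta> / 4) * F)) \<le> exp (- (1 - 3 * \<eta> / 4) * y)"
      by (simp only: exp_le_cancel_iff mult_minus_left neg_le_iff_le)
    have "((1 + \<delta> - \<epsilon>) / (1 + \<delta>)) ^ h + s * exp (- \<rho> * ((1 - \<eta> / 4) * F))
        \<le> exp (- (1 - 3 * \<eta> / 4) * y) + s * exp (- (1 - 3 * \<eta> / 4) * y)"
      using g1 g2 s0 by (intro add_mono mult_left_mono) auto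
    also have "\<dots> = (s + 1) * exp (- (1 - 3 * \<eta> / 4) * y)" by (simp add: algebra_simps)
    also have "\<dots> \<le> exp (\<eta> / 4 * y) * exp (- (1 - 3 * \<eta> / 4) * y)"
    proof (rule mult_right_mono)
      \<comment> \<open>\<open>s + 1\<close> is at most linear in \<open>y\<close>, so the quadratic
        Taylor term of \<open>exp (\<eta> / 4 * y)\<close> dominates it once
        \<open>y \<ge> 160 * D / \<eta>\<^sup>2\<close>.\<close>
      have "s + 1 \<le> 4 * (D * y) + D * y" using hD y D1 mult_mono[of 1 D 1 y] by (simp add: s_def)
      also have "\<dots> = 5 * D * y" by simp
      also have "\<dots> \<le> (\<eta> / 4 * y)\<^sup>2 / 2"
      proof -
        have "160 * D / \<eta>\<^sup>2 \<le> y" using y(2) by linarith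
        then have "160 * D \<le> y * \<eta>\<^sup>2" using \<eta> by (simp add: pos_divide_le_eq)
        then have "(160 * D) * y \<le> (y * \<eta>\<^sup>2) * y" using y by (intro mult_right_mono) auto
        then show ?thesis by (simp add: power2_eq_square algebra_simps)
      qed
      also have "\<dots> \<le> exp (\<eta> / 4 * y)"
      proof -
        have "0 \<le> \<eta> / 4 * y" using \<eta> y by simp
        then show ?thesis using exp_lower_Taylor_quadratic[of "\<eta> / 4 * y"] by linarith
      qed
      finally show "s + 1 \<le> exp (\<eta> / 4 * y)" .
    qed simp
    also have "\<dots> = exp (- (1 - \<eta>) * y)" by (simp add: algebra_simps flip: exp_add)
    finally show "((1 + \<delta> - \<epsilon>) / (1 + \<delta>)) ^ h + s * exp (- \<rho> * ((1 - \<eta> / 4) * F)) \<le> exp (- (1 - \<eta>) * y)" .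
  qed simp
  finally show ?thesis unfolding y_def F_def \<mu>_def by (simp only: mult.assoc)
qed

lemma upper_tail:
  fixes \<delta> \<eta> :: real and k :: "nat \<Rightarrow> nat"
  assumes \<delta>: "\<delta> > 0" and small: "(\<lambda>n. real (k n)) \<in> o(\<lambda>n. real n)"
    and large: "(\<lambda>n. real (k n)) \<in> \<omega>(\<lambda>n. ln (real n) powr (3 / 2))" and \<eta>: "0 < \<eta>" "\<eta> \<le> 1"
  shows "\<forall>\<^sub>F n in sequentially.
    card {L \<in> latin_rectangles (k n) n. (1 + \<delta>) * ((real (k n))\<^sup>2 / 4) \<le> num_intercalates L}
      \<le> card (latin_rectangles (k n) n) * exp (- (1 - \<eta>) * Phi (\<delta> * ((real (k n))\<^sup>2 / 4)) * ln (real n))"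
proof -
  obtain \<epsilon>0 where \<epsilon>0: "\<epsilon>0 > 0"
    "\<And>x \<mu>. 0 \<le> x \<Longrightarrow> x \<le> \<epsilon>0 \<Longrightarrow> 1 \<le> \<epsilon>0 * \<mu> \<Longrightarrow> 0 < \<mu> \<Longrightarrow> Phi (x * \<mu>) \<le> \<eta> / 4 * Phi (\<delta> * \<mu>)"
    using Phi_small_ratio[OF \<delta>, of "\<eta> / 4"] \<eta> by auto
  define \<epsilon> where "\<epsilon> = min (\<epsilon>0 / 3) (\<delta> / 8)"
  have \<epsilon>: "\<epsilon> > 0" "3 * \<epsilon> < \<delta>" "3 * \<epsilon> \<le> \<epsilon>0" using \<epsilon>0 \<delta> by (auto simp: \<epsilon>_def)
  define \<xi> where "\<xi> = min \<epsilon> 1 / 40"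
  have \<xi>: "\<xi> > 0" "\<xi> \<le> 1 / 40" "20 * \<xi> \<le> \<epsilon>" using \<epsilon> by (auto simp: \<xi>_def min_def)
  obtain q :: nat where q0: "64 / \<eta> \<le> q" using real_arch_simple by blast
  have q: "q \<ge> 1"
  proof -
    have "0 < 64 / \<eta>" using \<eta> by simp
    then show ?thesis using q0 by (cases q) auto
  qed
  define c1 where "c1 = (\<delta> / 8) powr (2/3)"
  define c2 where "c2 = 16 * (\<delta> / 4) powr (2/3)"
  define D where "D = (1 + \<delta>) / \<epsilon> + 1"
  define E where "E = 4 * D * c2"
  define H where "H = 32 * real q ^ 3 * E ^ 3 / \<epsilon>\<^sup>2"
  have pos: "c1 > 0" "c2 > 0" "D > 0" "E > 0" "H \<ge> 0"
    using \<delta> \<epsilon> by (simp_all add: c1_def c2_def D_def E_def H_def add_pos_pos)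
  define X where "X = [1, 2 / \<xi>, 48 * E / \<epsilon>, 24 * E\<^sup>2 / (\<xi> * \<epsilon>), 24 * E\<^sup>2 / (\<xi>\<^sup>2 * \<epsilon>),
    1024 * E * real q ^ 3 / (\<eta> * \<epsilon>), 16 * E\<^sup>2 / \<epsilon>, 8, 6 * (1 + H), 4 / \<eta>, 4 / \<epsilon>, (160 * D / \<eta>\<^sup>2 + 1) / c1]"
  define C where "C = Max (set X)"
  have CX: "x \<le> C" if "x \<in> set X" for x unfolding C_def using that by (intro Max_ge) auto
  have C: "1 \<le> C" "2 / \<xi> \<le> C" "48 * E / \<epsilon> \<le> C" "24 * E\<^sup>2 / (\<xi> * \<epsilon>) \<le> C" "24 * E\<^sup>2 / (\<xi>\<^sup>2 * \<epsilon>) \<le> C"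
      "1024 * E * real q ^ 3 / (\<eta> * \<epsilon>) \<le> C" "16 * E\<^sup>2 / \<epsilon> \<le> C" "8 \<le> C" "6 * (1 + H) \<le> C" "4 / \<eta> \<le> C"
      "4 / \<epsilon> \<le> C" "(160 * D / \<eta>\<^sup>2 + 1) / c1 \<le> C"
    by (rule CX, simp add: X_def)+
  show ?thesis using asymptotic_regime[OF small large C(1)]
  proof eventually_elim
    case (elim n)
    then obtain a where a: "a \<ge> 0" "real (k n) = a ^ 3" "C \<le> a" "C * ln (real n) \<le> a\<^sup>2"
      "C * a ^ 3 \<le> real n" "C * (a\<^sup>2 * (ln (real n))\<^sup>2) \<le> real n" "C \<le> ln (real n)"
      "C * (1 + ln (real n) ^ 3) \<le> exp (ln (real n) / C)" "C \<le> real n" by blast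
    have n: "real n = exp (ln (real n))" using a(9) C(1) by simp
    define \<mu> where "\<mu> = (real (k n))\<^sup>2 / 4"
    have "a \<ge> 1" using a(3) C(1) by linarith
    then have "a ^ 1 \<le> a ^ 6" by (intro power_increasing) auto
    then have a6: "4 / \<epsilon> \<le> a ^ 6" using C(11) a(3) by simp
    have \<mu>a: "\<mu> = a ^ 6 / 4" by (simp add: \<mu>_def a(2) flip: power_mult)
    have \<mu>: "\<mu> > 0" using \<open>a \<ge> 1\<close> by (simp add: \<mu>a)
    have "1 \<le> \<epsilon> * \<mu>" using a6 \<epsilon> by (simp add: \<mu>a field_simps)
    also have "\<dots> \<le> \<epsilon>0 * \<mu>" using \<epsilon> \<mu> by (intro mult_right_mono) auto
    finally have ratio: "Phi (3 * \<epsilon> * \<mu>) \<le> \<eta> / 4 * Phi (\<delta> * \<mu>)"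
      using \<epsilon> \<mu> by (intro \<epsilon>0(2)) auto
    show ?case
      by (rule upper_tail_at[OF \<delta> \<eta> \<epsilon>(1,2) ratio[unfolded \<mu>_def] \<xi> q q0 c1_def c2_def D_def E_def H_def C a n])
  qed
qed

section \<open>Lower tail for large \<open>n\<close>\<close>

text \<open>The count of intercalates is \<open>(\<delta> + 2 * \<epsilon>) * \<mu>\<close> in an
  optimal array, minus \<open>\<epsilon> * \<mu>\<close> lost by pruning, plus
  \<open>(1 - \<epsilon>) * \<mu>\<close> found outside it, which makes
  \<open>(1 + \<delta>) * \<mu>\<close>.\<close>

lemma lower_tail_at:
  fixes \<epsilon> \<delta> \<eta> \<xi> C H a l c1 c2 :: real and k n :: nat
  assumes \<delta>: "\<delta> > 0" and \<eta>: "0 < \<eta>" "\<eta> \<le> 1" and \<epsilon>: "\<epsilon> > 0" "\<epsilon> \<le> 1"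
    and ratio: "Phi (2 * \<epsilon> * ((real k)\<^sup>2 / 4)) \<le> \<eta> / 4 * Phi (\<delta> * ((real k)\<^sup>2 / 4))"
    and \<xi>: "\<xi> = \<epsilon> / 90"
    and c1: "c1 = (\<delta> / 8) powr (2/3)" and c2: "c2 = 16 * (\<delta> / 4) powr (2/3)"
    and H: "H = 16 * c2\<^sup>2 / \<epsilon>"
    and C: "1 \<le> C" "2 / \<xi> \<le> C" "H / \<xi> \<le> C" "8 / \<epsilon> \<le> C" "8 / \<eta> \<le> C" "4 / \<delta> \<le> C" "6 / \<eta> / c1 \<le> C"
    and a: "a \<ge> 0" "real k = a ^ 3" "C \<le> a" "C * a ^ 3 \<le> n" "C \<le> l" "C \<le> n" and l: "real n = exp l"
  shows "card (latin_rectangles k n) * exp (- (1 + \<eta>) * Phi (\<delta> * ((real k)\<^sup>2 / 4)) * l)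
    \<le> card {L \<in> latin_rectangles k n. (1 + \<delta>) * ((real k)\<^sup>2 / 4) \<le> num_intercalates L}"
proof -
  define \<mu> where "\<mu> = (real k)\<^sup>2 / 4"
  define F where "F = real (Phi (\<delta> * \<mu>))"
  let ?N = "real n" and ?\<kappa> = "real k"
  have \<xi>0: "\<xi> > 0" "\<xi> \<le> 1 / 90" using \<epsilon> by (simp_all add: \<xi>)
  have a1: "a \<ge> 1" "a > 0" "l \<ge> 1" "l > 0" "?N > 0" using a(3,5,6) C(1) by linarith+
  have \<mu>a: "\<mu> = a ^ 6 / 4" by (simp add: \<mu>_def a(2) flip: power_mult)
  have \<mu>: "\<mu> > 0" using a1 by (simp add: \<mu>a)
  have apow: "C \<le> a ^ j" if "j > 0" for j :: nat
  proof -
    have "a ^ 1 \<le> a ^ j" using a1 that by (intro power_increasing) auto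
    then show ?thesis using a(3) by simp
  qed
  have "4 / \<delta> \<le> a ^ 6" using C(6) apow[of 6] by simp
  then have \<delta>\<mu>: "1 \<le> \<delta> * \<mu>" using \<delta> by (simp add: \<mu>a field_simps)
  have F1: "c1 * a ^ 4 \<le> F"
    unfolding c1 F_def \<mu>_def a(2) by (rule Phi_cube_bounds(1)[OF \<delta> a1(2)])
  have F2: "F \<le> c2 * a ^ 4"
    using Phi_cube_bounds(2)[OF \<delta> a1(2)] \<delta>\<mu> unfolding c2 F_def \<mu>_def a(2) by simp
  have c: "c1 > 0" "c2 > 0" using \<delta> by (simp_all add: c1 c2)
  have H0: "H > 0" using c \<epsilon> by (simp add: H)
  have "c1 * C \<le> c1 * a ^ 4" using c apow[of 4] by (intro mult_left_mono) auto
  moreover have "6 / \<eta> \<le> c1 * C" using C(7) c by (simp only: pos_divide_le_eq[of c1] mult.commute)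
  ultimately have F\<eta>: "6 / \<eta> \<le> F" using F1 by linarith
  then have F6: "6 \<le> \<eta> * F" using \<eta> by (simp add: pos_divide_le_eq mult.commute)
  have F0: "F > 0"
  proof -
    have "0 < 6 / \<eta>" using \<eta> by simp
    then show ?thesis using F\<eta> by linarith
  qed
  define z where "z = (\<delta> + 2 * \<epsilon>) * \<mu>"
  define G where "G = real (Phi z)"
  have zeq: "z = \<delta> * \<mu> + 2 * \<epsilon> * \<mu>" by (simp add: z_def algebra_simps)
  have G1: "G \<le> (1 + \<eta> / 4) * F"
  proof -
    have "Phi z \<le> Phi (\<delta> * \<mu>) + Phi (2 * \<epsilon> * \<mu>)" unfolding zeq by (rule Phi_add)
    then have "G \<le> F + real (Phi (2 * \<epsilon> * \<mu>))" unfolding G_def F_def by simp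
    then show ?thesis using ratio unfolding \<mu>_def[symmetric] F_def[symmetric] by (simp add: algebra_simps)
  qed
  have G2: "G \<ge> F"
    unfolding G_def F_def of_nat_le_iff zeq using \<epsilon> \<mu> by (intro Phi_mono) simp
  have G0: "G > 0" using G2 F0 by linarith
  \<comment> \<open>Pruning then loses at most \<open>\<theta> * G = \<epsilon> * \<mu>\<close>
    intercalates and leaves at most \<open>G / \<theta> = G\<^sup>2 / (\<epsilon> * \<mu>)\<close>
    rows, columns and symbols. This has order \<open>a ^ 8 / a ^ 6 = a\<^sup>2\<close>, negligible
    against \<open>k = a ^ 3\<close>.\<close>
  define \<theta> where "\<theta> = \<epsilon> * \<mu> / G"
  have \<theta>: "\<theta> > 0" using \<epsilon> \<mu> G0 by (simp add: \<theta>_def)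
  obtain P ra ca sa where P: "latin P" "dom P \<subseteq> {1..ra} \<times> {1..ca}" "ran P \<subseteq> {1..sa}"
    "card (dom P) \<le> Phi z" "z - \<theta> * Phi z \<le> num_intercalates P"
    "\<theta> * ra \<le> Phi z" "\<theta> * ca \<le> Phi z" "\<theta> * sa \<le> Phi z"
    by (rule pruned_optimal_array[OF less_imp_le[OF \<theta>]])
  have NP: "(\<delta> + \<epsilon>) * \<mu> \<le> num_intercalates P"
  proof -
    have "\<theta> * Phi z = \<epsilon> * \<mu>" using G0 by (simp add: \<theta>_def flip: G_def)
    then show ?thesis using P(5) by (simp add: z_def algebra_simps)
  qed
  have Ha: "x \<le> H * a\<^sup>2" if "\<theta> * x \<le> Phi z" for x
  proof -
    have "x \<le> G / \<theta>" using that \<theta> by (simp add: G_def pos_le_divide_eq mult.commute)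
    also have "\<dots> = G\<^sup>2 / (\<epsilon> * \<mu>)" by (simp add: \<theta>_def power2_eq_square)
    also have "\<dots> \<le> (2 * (c2 * a ^ 4))\<^sup>2 / (\<epsilon> * \<mu>)"
    proof (intro divide_right_mono power_mono)
      have "(1 + \<eta> / 4) * F \<le> 2 * F" using \<eta> F0 by (intro mult_right_mono) auto
      then show "G \<le> 2 * (c2 * a ^ 4)" using G1 F2 by linarith
    qed (use G0 \<epsilon> \<mu> in auto)
    also have "\<dots> = H * a\<^sup>2"
    proof -
      have "(2 * (c2 * a ^ 4))\<^sup>2 = 4 * c2\<^sup>2 * (a\<^sup>2 * a ^ 6)"
        by (simp add: power_mult_distrib flip: power_mult power_add)
      moreover have "4 * c2\<^sup>2 * (x * w) / (\<epsilon> * (w / 4)) = 16 * c2\<^sup>2 / \<epsilon> * x" if "w > 0" for x w :: real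
        using that by simp
      ultimately show ?thesis using a1 by (simp only: H \<mu>a zero_less_power)
    qed
    finally show ?thesis .
  qed
  have H\<xi>: "H * a\<^sup>2 \<le> \<xi> * ?\<kappa>"
  proof -
    have "H \<le> C * \<xi>" using C(3) \<xi>0 by (simp add: pos_divide_le_eq)
    also have "\<dots> \<le> a * \<xi>" using a(3) \<xi>0 by (intro mult_right_mono) auto
    finally have "H \<le> \<xi> * a" by (simp add: mult.commute)
    then have "H * a\<^sup>2 \<le> \<xi> * a * a\<^sup>2" by (intro mult_right_mono) auto
    then show ?thesis by (simp add: a(2) power2_eq_square power3_eq_cube)
  qed
  have \<xi>C: "2 \<le> \<xi> * C" using C(2) \<xi>0 by (simp add: pos_divide_le_eq mult.commute)
  have k\<xi>: "?\<kappa> \<le> \<xi> * ?N"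
  proof -
    have "?\<kappa> * 1 \<le> ?\<kappa> * (\<xi> * C)" using \<xi>C by (intro mult_left_mono) auto
    also have "\<dots> = \<xi> * (C * a ^ 3)" by (simp add: a(2))
    also have "\<dots> \<le> \<xi> * ?N" using a(4) \<xi>0 by (intro mult_left_mono) auto
    finally show ?thesis by simp
  qed
  have kN: "?\<kappa> \<le> ?N"
  proof -
    have "\<xi> * ?N \<le> 1 * ?N" using \<xi>0 by (intro mult_right_mono) auto
    then show ?thesis using k\<xi> by linarith
  qed
  have \<xi>kN: "\<xi> * ?\<kappa> \<le> \<xi> * ?N" using kN \<xi>0 by (intro mult_left_mono) auto
  have two\<xi>: "2 \<le> \<xi> * ?N"
  proof -
    have "\<xi> * C \<le> \<xi> * ?N" using a(6) \<xi>0 by (intro mult_left_mono) auto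
    then show ?thesis using \<xi>C by linarith
  qed
  have two\<xi>k: "2 \<le> \<xi> * ?\<kappa>"
  proof -
    have "\<xi> * C \<le> \<xi> * ?\<kappa>" using apow[of 3] \<xi>0 by (intro mult_left_mono) (auto simp: a(2))
    then show ?thesis using \<xi>C by linarith
  qed
  have \<xi>lt: "\<xi> * ?\<kappa> < ?\<kappa>" "\<xi> * ?N < ?N"
  proof -
    have "?\<kappa> > 0" using a1 by (simp add: a(2))
    then show "\<xi> * ?\<kappa> < ?\<kappa>" "\<xi> * ?N < ?N" using \<xi>0 a1 by simp_all
  qed
  have ra: "real ra \<le> \<xi> * ?\<kappa>" "ra < k" and ca: "real ca \<le> \<xi> * ?N" "ca < n" and sa: "sa \<le> n"
  proof -
    show "real ra \<le> \<xi> * ?\<kappa>" using Ha[OF P(6)] H\<xi> by linarith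
    then show "ra < k" using \<xi>lt by linarith
    show "real ca \<le> \<xi> * ?N" using Ha[OF P(7)] H\<xi> \<xi>kN by linarith
    then show "ca < n" using \<xi>lt by linarith
    show "sa \<le> n" using Ha[OF P(8)] H\<xi> \<xi>kN \<xi>lt by linarith
  qed
  define d where "d = (1 - 4 * \<xi>) * ?N"
  have dle: "d \<le> ?N - real ca - 2 - 2 * ?\<kappa>" using k\<xi> two\<xi> ca unfolding d_def by (simp add: algebra_simps)
  have dk: "?\<kappa> \<le> d"
  proof -
    have "\<xi> * ?N \<le> (1 - 4 * \<xi>) * ?N" using \<xi>0 by (intro mult_right_mono) auto
    then show ?thesis using k\<xi> unfolding d_def by linarith
  qed
  define p where "p = (d - ?\<kappa>) / ?N\<^sup>2"
  have p1: "(1 - 5 * \<xi>) / ?N \<le> p"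
  proof -
    have "(1 - 5 * \<xi>) * ?N \<le> d - ?\<kappa>" using k\<xi> unfolding d_def by (simp add: algebra_simps)
    then have "(1 - 5 * \<xi>) * ?N / ?N\<^sup>2 \<le> p" unfolding p_def by (intro divide_right_mono) auto
    then show ?thesis using a1 by (simp add: power2_eq_square)
  qed
  have p2: "1 / (2 * ?N) \<le> p"
  proof -
    have "1 / 2 / ?N \<le> (1 - 5 * \<xi>) / ?N" using \<xi>0 a1 by (intro divide_right_mono) auto
    then show ?thesis using p1 by simp
  qed
  define M where "M = p ^ 4 * ((?\<kappa> - real ra) * (?\<kappa> - real ra - 1) * (?N - real ca) * (?N - real ca - 1) * ?N * (?N - 1) / 4)"
  have M: "(1 - \<epsilon> / 2) * \<mu> \<le> M"
  proof -
    \<comment> \<open>The factor \<open>?w\<close> is lost nine times: four times in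
      \<open>p ^ 4\<close> and five times in the counts of rows, columns and symbols. Bernoulli's
      inequality gives \<open>1 - 45 * \<xi>\<close>, which is \<open>1 - \<epsilon> / 2\<close> for
      \<open>\<xi> = \<epsilon> / 90\<close>.\<close>
    let ?w = "1 - 5 * \<xi>"
    have w: "?w > 0" using \<xi>0 by simp
    have f: "?w * ?\<kappa> \<le> ?\<kappa> - real ra" "?w * ?\<kappa> \<le> ?\<kappa> - real ra - 1" "?w * ?N \<le> ?N - real ca" "?w * ?N \<le> ?N - real ca - 1"
      "1 * ?N \<le> ?N" "?w * ?N \<le> ?N - 1"
      using ra ca two\<xi> two\<xi>k by (simp_all add: algebra_simps)
    have nn: "0 \<le> ?w * ?\<kappa>" "0 \<le> ?w * ?N" using w by simp_all
    have "(1 - \<epsilon> / 2) \<le> 1 + 9 * (- 5 * \<xi>)" by (simp add: \<xi>)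
    also have "\<dots> \<le> (1 + (- 5 * \<xi>)) ^ 9"
      using Bernoulli_inequality[of "- 5 * \<xi>" 9] \<xi>0 by simp
    also have "(1 + (- 5 * \<xi>)) ^ 9 = ?w ^ 9" by simp
    finally have "(1 - \<epsilon> / 2) * \<mu> \<le> ?w ^ 9 * \<mu>" using \<mu> by (intro mult_right_mono) auto
    also have "\<dots> = (?w / ?N) ^ 4 * ((?w * ?\<kappa>) * (?w * ?\<kappa>) * (?w * ?N) * (?w * ?N) * (1 * ?N) * (?w * ?N) / 4)"
      using a1 by (simp add: \<mu>_def power_divide power_numeral_reduce)
    also have "\<dots> \<le> M"
      unfolding M_def
    proof (rule mult_mono)
      show "(?w / ?N) ^ 4 \<le> p ^ 4" using p1 w by (intro power_mono) auto
      show "(?w * ?\<kappa>) * (?w * ?\<kappa>) * (?w * ?N) * (?w * ?N) * (1 * ?N) * (?w * ?N) / 4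
        \<le> (?\<kappa> - real ra) * (?\<kappa> - real ra - 1) * (?N - real ca) * (?N - real ca - 1) * ?N * (?N - 1) / 4"
      proof (rule divide_right_mono)
        have q2: "(?w * ?\<kappa>) * (?w * ?\<kappa>) \<le> (?\<kappa> - real ra) * (?\<kappa> - real ra - 1)"
          using f nn by (intro mult_mono) linarith+
        have q3: "(?w * ?\<kappa>) * (?w * ?\<kappa>) * (?w * ?N) \<le> (?\<kappa> - real ra) * (?\<kappa> - real ra - 1) * (?N - real ca)"
          by (rule mult_mono[OF q2 f(3)]) (use f nn in \<open>auto intro!: mult_nonneg_nonneg\<close>)
        have q4: "(?w * ?\<kappa>) * (?w * ?\<kappa>) * (?w * ?N) * (?w * ?N) \<le> (?\<kappa> - real ra) * (?\<kappa> - real ra - 1) * (?N - real ca) * (?N - real ca - 1)"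
          by (rule mult_mono[OF q3 f(4)]) (use f nn in \<open>auto intro!: mult_nonneg_nonneg\<close>)
        have q5: "(?w * ?\<kappa>) * (?w * ?\<kappa>) * (?w * ?N) * (?w * ?N) * (1 * ?N) \<le> (?\<kappa> - real ra) * (?\<kappa> - real ra - 1) * (?N - real ca) * (?N - real ca - 1) * ?N"
          by (rule mult_mono[OF q4 f(5)]) (use f nn in \<open>auto intro!: mult_nonneg_nonneg\<close>)
        show "(?w * ?\<kappa>) * (?w * ?\<kappa>) * (?w * ?N) * (?w * ?N) * (1 * ?N) * (?w * ?N) \<le> (?\<kappa> - real ra) * (?\<kappa> - real ra - 1) * (?N - real ca) * (?N - real ca - 1) * ?N * (?N - 1)"
          by (rule mult_mono[OF q5 f(6)]) (use f nn in \<open>auto intro!: mult_nonneg_nonneg\<close>)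
      qed simp
    qed (use w in auto)
    finally show ?thesis .
  qed
  define v where "v = (1 - \<epsilon>) * \<mu>"
  have v0: "0 \<le> v" using \<epsilon> \<mu> by (simp add: v_def)
  have Mv: "\<epsilon> / 2 * \<mu> \<le> M - v" using M by (simp add: v_def algebra_simps)
  have vM: "v \<le> M"
  proof -
    have "0 \<le> \<epsilon> / 2 * \<mu>" using \<epsilon> \<mu> by simp
    then show ?thesis using Mv by linarith
  qed
  have k1: "k \<ge> 1" using ra by linarith
  have kN0: "?\<kappa>\<^sup>2 * ?N\<^sup>2 > 0" using k1 a1 by simp
  have plant: "(M - v) / (?\<kappa>\<^sup>2 * ?N\<^sup>2) * p ^ card (dom P) * card (latin_rectangles k n)
      \<le> card {L \<in> latin_rectangles k n. num_intercalates P + v \<le> num_intercalates L}"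
    unfolding M_def p_def
  proof (rule planted_intercalates[OF P(1,2) _ _ _ dk dle k1 v0 _ ra(2) ca(2)])
    show "ran P \<subseteq> {1..n}" using P(3) sa by auto
    show "v \<le> ((d - ?\<kappa>) / ?N\<^sup>2) ^ 4 * ((?\<kappa> - real ra) * (?\<kappa> - real ra - 1) * (?N - real ca) * (?N - real ca - 1) * ?N * (?N - 1) / 4)"
      using vM unfolding M_def p_def .
  qed (use ra ca in auto)
  \<comment> \<open>The mean argument costs at most three factors \<open>n\<close>. As
    \<open>\<eta> * F \<ge> 6\<close>, they disappear in \<open>\<eta> / 2 * F\<close>.\<close>
  have e1: "exp (- 3 * l) \<le> (M - v) / (?\<kappa>\<^sup>2 * ?N\<^sup>2)"
  proof -
    have "exp (- 3 * l) = 1 / ?N * (1 / ?N\<^sup>2)" unfolding l by (simp add: power2_eq_square exp_minus field_simps flip: exp_add)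
    also have "\<dots> \<le> \<epsilon> / 8 * (1 / ?N\<^sup>2)"
    proof (rule mult_right_mono)
      have "8 / \<epsilon> \<le> ?N" using C(4) a(6) by linarith
      then show "1 / ?N \<le> \<epsilon> / 8" using \<epsilon> a1 by (simp add: field_simps)
    qed simp
    also have "\<dots> = (\<epsilon> / 2 * \<mu>) / (?\<kappa>\<^sup>2 * ?N\<^sup>2)" using k1 by (simp add: \<mu>_def)
    also have "\<dots> \<le> (M - v) / (?\<kappa>\<^sup>2 * ?N\<^sup>2)" using Mv kN0 by (intro divide_right_mono) auto
    finally show ?thesis .
  qed
  \<comment> \<open>\<open>p\<close> is at least \<open>1 / (2 * n)\<close>, and the 2 is absorbed
    by \<open>2 \<le> exp (\<eta> / 8 * l)\<close>.\<close>
  have e2: "exp (- ((1 + \<eta> / 8) * l) * G) \<le> p ^ card (dom P)"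
  proof -
    have "2 * ?N \<le> exp ((1 + \<eta> / 8) * l)"
    proof -
      have "8 / \<eta> \<le> l" using C(5) a(5) by linarith
      then have "1 \<le> \<eta> / 8 * l" using \<eta> by (simp add: field_simps)
      then have "2 \<le> exp (\<eta> / 8 * l)" using exp_ge_add_one_self[of "\<eta> / 8 * l"] by linarith
      then have "2 * exp l \<le> exp (\<eta> / 8 * l) * exp l" by (intro mult_right_mono) auto
      also have "\<dots> = exp ((1 + \<eta> / 8) * l)" by (simp add: algebra_simps flip: exp_add)
      finally show ?thesis unfolding l .
    qed
    then have "1 / exp ((1 + \<eta> / 8) * l) \<le> 1 / (2 * ?N)" using a1 by (intro divide_left_mono) auto
    then have ep: "exp (- ((1 + \<eta> / 8) * l)) \<le> p" using p2 by (simp add: exp_minus inverse_eq_divide)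
    have "exp (- ((1 + \<eta> / 8) * l) * G) = exp (- ((1 + \<eta> / 8) * l)) ^ Phi z"
      unfolding G_def by (simp add: exp_of_nat_mult[symmetric] mult.commute)
    also have "\<dots> \<le> exp (- ((1 + \<eta> / 8) * l)) ^ card (dom P)"
      using P(4) \<eta> a1 by (intro power_decreasing) auto
    also have "\<dots> \<le> p ^ card (dom P)" using ep by (intro power_mono) auto
    finally show ?thesis .
  qed
  have "exp (- (1 + \<eta>) * F * l) \<le> exp (- 3 * l) * exp (- ((1 + \<eta> / 8) * l) * G)"
  proof -
    have "(1 + \<eta> / 8) * l * G \<le> (1 + \<eta> / 8) * l * ((1 + \<eta> / 4) * F)"
      using G1 \<eta> a1 by (intro mult_left_mono) auto
    also have "\<dots> = ((1 + \<eta> / 8) * (1 + \<eta> / 4)) * (F * l)" by simp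
    also have "\<dots> \<le> (1 + \<eta> / 2) * (F * l)"
    proof (rule mult_right_mono)
      have "\<eta> * \<eta> \<le> \<eta> * 1" using \<eta> by (intro mult_left_mono) auto
      moreover have "(1 + \<eta> / 8) * (1 + \<eta> / 4) = 1 + 3 * \<eta> / 8 + \<eta> * \<eta> / 32" by (simp add: algebra_simps)
      ultimately show "(1 + \<eta> / 8) * (1 + \<eta> / 4) \<le> 1 + \<eta> / 2" using \<eta>(1) by linarith
    qed (use F0 a1 in auto)
    finally have 1: "(1 + \<eta> / 8) * l * G \<le> (1 + \<eta> / 2) * (F * l)" .
    have "6 * l \<le> (\<eta> * F) * l" using F6 a1 by (intro mult_right_mono) auto
    then have "3 * l \<le> \<eta> / 2 * (F * l)" by simp
    then have "3 * l + (1 + \<eta> / 8) * l * G \<le> (1 + \<eta>) * F * l" using 1 by (simp add: algebra_simps)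
    then have "- (1 + \<eta>) * F * l \<le> - 3 * l + - ((1 + \<eta> / 8) * l) * G" by (simp add: algebra_simps)
    then have "exp (- (1 + \<eta>) * F * l) \<le> exp (- 3 * l + - ((1 + \<eta> / 8) * l) * G)"
      by (simp only: exp_le_cancel_iff)
    then show ?thesis by (simp only: exp_add)
  qed
  also have "\<dots> \<le> (M - v) / (?\<kappa>\<^sup>2 * ?N\<^sup>2) * p ^ card (dom P)"
    using e1 e2 by (intro mult_mono) (auto intro: order_trans[OF exp_ge_zero])
  finally have "exp (- (1 + \<eta>) * F * l) * card (latin_rectangles k n)
      \<le> (M - v) / (?\<kappa>\<^sup>2 * ?N\<^sup>2) * p ^ card (dom P) * card (latin_rectangles k n)"
    by (intro mult_right_mono) auto
  also note plant
  also have "real (card {L \<in> latin_rectangles k n. num_intercalates P + v \<le> num_intercalates L})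
      \<le> card {L \<in> latin_rectangles k n. (1 + \<delta>) * \<mu> \<le> num_intercalates L}"
  proof (intro of_nat_mono card_mono subsetI)
    fix L assume "L \<in> {L \<in> latin_rectangles k n. num_intercalates P + v \<le> num_intercalates L}"
    then have "L \<in> latin_rectangles k n" "num_intercalates P + v \<le> num_intercalates L" by auto
    moreover have "(1 + \<delta>) * \<mu> \<le> num_intercalates P + v" using NP by (simp add: v_def algebra_simps)
    ultimately show "L \<in> {L \<in> latin_rectangles k n. (1 + \<delta>) * \<mu> \<le> num_intercalates L}" by simp
  qed simp
  finally show ?thesis unfolding F_def \<mu>_def by (simp only: mult.commute)
qed

lemma lower_tail:
  fixes \<delta> \<eta> :: real and k :: "nat \<Rightarrow> nat"
  assumes \<delta>: "\<delta> > 0" and small: "(\<lambda>n. real (k n)) \<in> o(\<lambda>n. real n)"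
    and large: "(\<lambda>n. real (k n)) \<in> \<omega>(\<lambda>n. ln (real n) powr (3 / 2))" and \<eta>: "0 < \<eta>" "\<eta> \<le> 1"
  shows "\<forall>\<^sub>F n in sequentially.
    card (latin_rectangles (k n) n) * exp (- (1 + \<eta>) * Phi (\<delta> * ((real (k n))\<^sup>2 / 4)) * ln (real n))
      \<le> card {L \<in> latin_rectangles (k n) n. (1 + \<delta>) * ((real (k n))\<^sup>2 / 4) \<le> num_intercalates L}"
proof -
  obtain \<epsilon>0 where \<epsilon>0: "\<epsilon>0 > 0"
    "\<And>x \<mu>. 0 \<le> x \<Longrightarrow> x \<le> \<epsilon>0 \<Longrightarrow> 1 \<le> \<epsilon>0 * \<mu> \<Longrightarrow> 0 < \<mu> \<Longrightarrow> Phi (x * \<mu>) \<le> \<eta> / 4 * Phi (\<delta> * \<mu>)"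
    using Phi_small_ratio[OF \<delta>, of "\<eta> / 4"] \<eta> by auto
  define \<epsilon> where "\<epsilon> = min (\<epsilon>0 / 2) 1"
  have \<epsilon>: "\<epsilon> > 0" "\<epsilon> \<le> 1" "2 * \<epsilon> \<le> \<epsilon>0" using \<epsilon>0 by (auto simp: \<epsilon>_def)
  define \<xi> where "\<xi> = \<epsilon> / 90"
  define c1 where "c1 = (\<delta> / 8) powr (2/3)"
  define c2 where "c2 = 16 * (\<delta> / 4) powr (2/3)"
  define H where "H = 16 * c2\<^sup>2 / \<epsilon>"
  define X where "X = [1, 2 / \<xi>, H / \<xi>, 8 / \<epsilon>, 8 / \<eta>, 4 / \<delta>, 6 / \<eta> / c1]"
  define C where "C = Max (set X)"
  have CX: "x \<le> C" if "x \<in> set X" for x unfolding C_def using that by (intro Max_ge) auto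
  have C: "1 \<le> C" "2 / \<xi> \<le> C" "H / \<xi> \<le> C" "8 / \<epsilon> \<le> C" "8 / \<eta> \<le> C" "4 / \<delta> \<le> C" "6 / \<eta> / c1 \<le> C"
    by (rule CX, simp add: X_def)+
  show ?thesis using asymptotic_regime[OF small large C(1)]
  proof eventually_elim
    case (elim n)
    then obtain a where a: "a \<ge> 0" "real (k n) = a ^ 3" "C \<le> a" "C * a ^ 3 \<le> real n" "C \<le> ln (real n)" "C \<le> real n"
      by blast
    have n: "real n = exp (ln (real n))" using a(6) C(1) by simp
    define \<mu> where "\<mu> = (real (k n))\<^sup>2 / 4"
    have "a \<ge> 1" using a(3) C(1) by linarith
    then have "a ^ 1 \<le> a ^ 6" by (intro power_increasing) auto
    then have a6: "8 / \<epsilon> \<le> a ^ 6" using C(4) a(3) by simp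
    have \<mu>a: "\<mu> = a ^ 6 / 4" by (simp add: \<mu>_def a(2) flip: power_mult)
    have \<mu>: "\<mu> > 0" using \<open>a \<ge> 1\<close> by (simp add: \<mu>a)
    have "1 \<le> \<epsilon> * \<mu>" using a6 \<epsilon> by (simp add: \<mu>a field_simps)
    also have "\<dots> \<le> \<epsilon>0 * \<mu>" using \<epsilon> \<mu> by (intro mult_right_mono) auto
    finally have ratio: "Phi (2 * \<epsilon> * \<mu>) \<le> \<eta> / 4 * Phi (\<delta> * \<mu>)"
      using \<epsilon> \<mu> by (intro \<epsilon>0(2)) auto
    show ?case
      by (rule lower_tail_at[OF \<delta> \<eta> \<epsilon>(1,2) ratio[unfolded \<mu>_def] \<xi>_def c1_def c2_def H_def C a n])
  qed
qed

section \<open>Combining both tails\<close>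

theorem theorem2p2:
  fixes \<delta> :: real and k :: "nat \<Rightarrow> nat"
  assumes "\<delta> > 0"
    and "(\<lambda>n. real (k n)) \<in> o(\<lambda>n. real n)"
    and "(\<lambda>n. real (k n)) \<in> \<omega>(\<lambda>n. ln (real n) powr (3 / 2))"
  shows "\<exists>\<epsilon> :: nat \<Rightarrow> real. \<epsilon> \<in> o(\<lambda>_. 1) \<and>
    (\<forall>\<^sub>F n in sequentially.
       measure_pmf.prob (random_latin_rectangle (k n) n)
         {L. real (num_intercalates L) \<ge> (1 + \<delta>) * (real (k n))\<^sup>2 / 4}
       = exp (- (1 + \<epsilon> n) * real (Phi (\<delta> * (real (k n))\<^sup>2 / 4)) * ln (real n)))"
proof -
  define \<mu> where "\<mu> n = (real (k n))\<^sup>2 / 4" for n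
  define F where "F n = real (Phi (\<delta> * \<mu> n))" for n
  define p where "p n = measure_pmf.prob (random_latin_rectangle (k n) n) {L. (1 + \<delta>) * \<mu> n \<le> num_intercalates L}" for n
  \<comment> \<open>The claimed identity is solved for \<open>\<epsilon> n\<close>, so it holds
    whenever \<open>p n\<close> and \<open>F n * ln n\<close> are positive; what has to be shown is
    that \<open>\<epsilon>\<close> tends to 0.\<close>
  define \<epsilon> where "\<epsilon> n = - ln (p n) / (F n * ln (real n)) - 1" for n
  have basic: "\<forall>\<^sub>F n in sequentially. 0 < F n * ln (real n) \<and> latin_rectangles (k n) n \<noteq> {}"
    using asymptotic_regime[OF assms(2,3) order_refl]
  proof eventually_elim
    case (elim n)
    then obtain a where a: "real (k n) = a ^ 3" "1 \<le> a" "1 * a ^ 3 \<le> real n" "1 \<le> ln (real n)" "1 \<le> real n" by blast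
    have "0 < (\<delta> * \<mu> n / 2) powr (2/3)" using assms(1) a(1,2) by (simp add: \<mu>_def)
    also have "\<dots> \<le> F n" unfolding F_def using assms(1) a(1,2) by (intro Phi_ge_powr) (simp add: \<mu>_def)
    finally have "0 < F n" .
    moreover have "latin_rectangles (k n) n \<noteq> {}"
      by (rule latin_rectangles_nonempty) (use a in auto)
    ultimately show ?case using a(4) by simp
  qed
  have bounds: "\<forall>\<^sub>F n in sequentially. exp (- (1 + \<eta>) * F n * ln (real n)) \<le> p n \<and> p n \<le> exp (- (1 - \<eta>) * F n * ln (real n))"
    if \<eta>: "0 < \<eta>" "\<eta> \<le> 1" for \<eta>
    using basic upper_tail[OF assms \<eta>] lower_tail[OF assms \<eta>]
  proof eventually_elim
    case (elim n)
    let ?LR = "latin_rectangles (k n) n"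
    have card: "real (card ?LR) > 0" using elim(1) by (simp add: card_gt_0_iff)
    have p: "p n = card {L \<in> ?LR. (1 + \<delta>) * \<mu> n \<le> num_intercalates L} / card ?LR"
      unfolding p_def random_latin_rectangle_def using elim(1)
      by (subst measure_pmf_of_set) (auto simp: Int_def)
    show ?case unfolding p F_def using elim(2,3) card
      by (simp add: pos_le_divide_eq pos_divide_le_eq mult.commute \<mu>_def)
  qed
  have "\<epsilon> \<in> o(\<lambda>_. 1)"
  proof (rule landau_o.smallI)
    fix c :: real assume c: "c > 0"
    define \<eta> where "\<eta> = min c 1"
    have \<eta>: "0 < \<eta>" "\<eta> \<le> 1" "\<eta> \<le> c" using c by (auto simp: \<eta>_def)
    show "\<forall>\<^sub>F n in sequentially. norm (\<epsilon> n) \<le> c * norm (1 :: real)"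
      using basic bounds[OF \<eta>(1,2)]
    proof eventually_elim
      case (elim n)
      let ?y = "F n * ln (real n)"
      have y: "?y > 0" using elim(1) by simp
      have p: "p n > 0" using elim(2) exp_gt_zero[of "- (1 + \<eta>) * F n * ln (real n)"] by linarith
      have "ln (exp (- (1 + \<eta>) * F n * ln (real n))) \<le> ln (p n)" using elim(2) p by (subst ln_le_cancel_iff) auto
      then have 1: "- ln (p n) \<le> (1 + \<eta>) * ?y" by (simp add: algebra_simps)
      have "ln (p n) \<le> ln (exp (- (1 - \<eta>) * F n * ln (real n)))" using elim(2) p by (subst ln_le_cancel_iff) auto
      then have 2: "(1 - \<eta>) * ?y \<le> - ln (p n)" by (simp add: algebra_simps)
      have "- ln (p n) / ?y \<le> 1 + \<eta>" "1 - \<eta> \<le> - ln (p n) / ?y"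
        using 1 2 y by (simp_all only: pos_divide_le_eq pos_le_divide_eq)
      then have "\<bar>\<epsilon> n\<bar> \<le> \<eta>" unfolding \<epsilon>_def by linarith
      then show ?case using \<eta>(3) by simp
    qed
  qed
  moreover have "\<forall>\<^sub>F n in sequentially. p n = exp (- (1 + \<epsilon> n) * F n * ln (real n))"
    \<comment> \<open>The lower bound for \<open>\<eta> = 1\<close> makes \<open>p n\<close>
      positive, so \<open>exp (ln (p n)) = p n\<close>.\<close>
    using basic bounds[OF zero_less_one order_refl]
  proof eventually_elim
    case (elim n)
    let ?y = "F n * ln (real n)"
    have p: "p n > 0" using elim(2) exp_gt_zero[of "- (1 + 1) * F n * ln (real n)"] by linarith
    have "- (1 + \<epsilon> n) * F n * ln (real n) = - ((- ln (p n) / ?y) * ?y)" by (simp add: \<epsilon>_def)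
    also have "\<dots> = ln (p n)"
    proof -
      have "x / w * w = x" if "w > 0" for x w :: real using that by simp
      from this[OF conjunct1[OF elim(1)]] show ?thesis by (simp only: minus_minus)
    qed
    finally show ?case using p by simp
  qed
  ultimately show ?thesis unfolding p_def F_def \<mu>_def by (intro exI[of _ \<epsilon>]) simp
qed

end
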